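(* There is a $C^*$-algebra $\mathcal A$ satisfying a short exact sequence of $C^*$-algebras $$0\rightarrow \mathcal K(\ell_2)\xrightarrow{\iota} \mathcal A \rightarrow\mathcal K(\ell_2(\mathfrak c))\rightarrow 0,$$ where $\iota[\mathcal K(\ell_2)]$ is an essential ideal of $\mathcal A$, such that $\mathcal A$ is not stable.
   Context: $\mathcal K(H)$ denotes the $C^*$-algebra of compact operators on the complex Hilbert space $H$; $\ell_2$ is the separable infinite-dimensional Hilbert space, $\mathfrak c$ is the cardinality of the continuum, and $\ell_2(\mathfrak c)$ is the Hilbert space of density $\mathfrak c$. A $C^*$-algebra $\mathcal A$ is stable if $\mathcal A\cong\mathcal A\otimes\mathcal K(\ell_2)$. *)

theory Defs
  imports "HOL-Analysis.Analysis"
begin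

section \<open>The Hilbert space of square-summable families\<close>

text \<open>
  \<open>'i ell2\<close> has an orthonormal basis indexed by \<open>'i\<close>; thus \<open>nat ell2\<close> is \<open>\<ell>\<^sub>2\<close> and
  \<open>real ell2\<close> is \<open>\<ell>\<^sub>2(\<cc>)\<close>. The real inner product instance is the real part of \<open>cinner\<close>,
  which is conjugate-linear in its first argument.
\<close>

typedef 'i ell2 = "{f :: 'i \<Rightarrow> complex. (\<lambda>i. (cmod (f i))\<^sup>2) summable_on UNIV}"
  morphisms coord Abs_ell2
  by (rule exI[of _ "\<lambda>_. 0"]) simp

setup_lifting type_definition_ell2

lemma coord_summable: "(\<lambda>i. (cmod (coord x i))\<^sup>2) summable_on UNIV"
  using coord[of x] by simp

lemma ell2_eqI: "(\<And>i. coord x i = coord y i) \<Longrightarrow> x = y"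
  by (metis coord_inject ext)

lemma ell2_prod_summable:
  assumes "(\<lambda>i. (cmod (f i))\<^sup>2) summable_on (UNIV :: 'i set)"
    and "(\<lambda>i. (cmod (g i))\<^sup>2) summable_on (UNIV :: 'i set)"
  shows "(\<lambda>i. cnj (f i) * g i) summable_on UNIV"
proof -
  have "(\<lambda>i. norm (cnj (f i) * g i)) summable_on UNIV"
    by (rule abs_summable_product)
      (use assms in \<open>simp_all add: norm_mult power2_eq_square\<close>)
  then show ?thesis by (rule abs_summable_summable)
qed

lemma ell2_add_summable:
  assumes "(\<lambda>i. (cmod (f i))\<^sup>2) summable_on (UNIV :: 'i set)"
    and "(\<lambda>i. (cmod (g i))\<^sup>2) summable_on (UNIV :: 'i set)"
  shows "(\<lambda>i. (cmod (f i + g i))\<^sup>2) summable_on UNIV"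
proof (rule summable_on_comparison_test)
  show "(\<lambda>i. 2 * (cmod (f i))\<^sup>2 + 2 * (cmod (g i))\<^sup>2) summable_on UNIV"
    by (intro summable_on_add summable_on_cmult_right assms)
  fix i
  have "(cmod (f i + g i))\<^sup>2 \<le> (cmod (f i) + cmod (g i))\<^sup>2"
    by (intro power_mono norm_triangle_ineq) simp
  also have "\<dots> \<le> 2 * (cmod (f i))\<^sup>2 + 2 * (cmod (g i))\<^sup>2"
    using sum_squares_bound[of "cmod (f i)" "cmod (g i)"] by (simp add: power2_sum)
  finally show "(cmod (f i + g i))\<^sup>2 \<le> 2 * (cmod (f i))\<^sup>2 + 2 * (cmod (g i))\<^sup>2" .
qed simp

lemma ell2_scale_summable:
  assumes "(\<lambda>i. (cmod (f i))\<^sup>2) summable_on (UNIV :: 'i set)"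
  shows "(\<lambda>i. (cmod (c * f i))\<^sup>2) summable_on UNIV"
  by (simp add: norm_mult power_mult_distrib summable_on_cmult_right assms)

lift_definition scaleC :: "complex \<Rightarrow> 'i ell2 \<Rightarrow> 'i ell2" is "\<lambda>c f i. c * f i"
  by (rule ell2_scale_summable)

lift_definition cinner :: "'i ell2 \<Rightarrow> 'i ell2 \<Rightarrow> complex"
  is "\<lambda>f g. \<Sum>\<^sub>\<infinity>i. cnj (f i) * g i" .

lemma coord_scaleC [simp]: "coord (scaleC c x) i = c * coord x i"
  by transfer simp

lemma cinner_summable: "(\<lambda>i. cnj (coord x i) * coord y i) summable_on UNIV"
  by (intro ell2_prod_summable coord_summable)

lemma cinner_has_sum: "((\<lambda>i. cnj (coord x i) * coord y i) has_sum cinner x y) UNIV"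
  unfolding cinner.rep_eq by (intro has_sum_infsum cinner_summable)

lemma cinner_commute: "cinner x y = cnj (cinner y x)"
  unfolding cinner.rep_eq by (subst infsum_cnj[symmetric]) (simp add: mult.commute)

lemma cinner_self_has_sum: "((\<lambda>i. (cmod (coord x i))\<^sup>2) has_sum Re (cinner x x)) UNIV"
  using has_sum_Re[OF cinner_has_sum[of x x]] by (simp only: cmod_power2) (simp add: power2_eq_square)

instantiation ell2 :: (type) real_vector
begin

lift_definition zero_ell2 :: "'a ell2" is "\<lambda>_. 0" by simp
lift_definition plus_ell2 :: "'a ell2 \<Rightarrow> 'a ell2 \<Rightarrow> 'a ell2" is "\<lambda>f g i. f i + g i"
  by (rule ell2_add_summable)
lift_definition uminus_ell2 :: "'a ell2 \<Rightarrow> 'a ell2" is "\<lambda>f i. - f i" by simp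
definition minus_ell2 :: "'a ell2 \<Rightarrow> 'a ell2 \<Rightarrow> 'a ell2" where "minus_ell2 x y = x + (- y)"
definition scaleR_ell2 :: "real \<Rightarrow> 'a ell2 \<Rightarrow> 'a ell2"
  where "scaleR_ell2 r x = scaleC (complex_of_real r) x"

lemma coord_add [simp]: "coord (x + y) i = coord x i + coord y i" by transfer simp
lemma coord_zero [simp]: "coord 0 i = 0" by transfer simp
lemma coord_uminus [simp]: "coord (- x) i = - coord x i" by transfer simp
lemma coord_minus [simp]: "coord (x - y) i = coord x i - coord y i" by (simp add: minus_ell2_def)
lemma coord_scaleR [simp]: "coord (r *\<^sub>R x) i = of_real r * coord x i" by (simp add: scaleR_ell2_def)

instance
  by standard (auto intro!: ell2_eqI simp: algebra_simps)

end

lemma cinner_add_left: "cinner (x + y) z = cinner x z + cinner y z"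
  unfolding cinner.rep_eq
  by (subst infsum_add[symmetric]) (auto intro: cinner_summable intro!: infsum_cong simp: distrib_right)

lemma cinner_scaleC_left: "cinner (scaleC c x) y = cnj c * cinner x y"
  unfolding cinner.rep_eq
  by (subst infsum_cmult_right[symmetric]) (auto intro: cinner_summable intro!: infsum_cong simp: distrib_right)

instantiation ell2 :: (type) real_inner
begin

definition inner_ell2 :: "'a ell2 \<Rightarrow> 'a ell2 \<Rightarrow> real" where "inner_ell2 x y = Re (cinner x y)"
definition norm_ell2 :: "'a ell2 \<Rightarrow> real" where "norm_ell2 x = sqrt (inner x x)"
definition sgn_ell2 :: "'a ell2 \<Rightarrow> 'a ell2" where "sgn_ell2 x = x /\<^sub>R norm x"
definition dist_ell2 :: "'a ell2 \<Rightarrow> 'a ell2 \<Rightarrow> real" where "dist_ell2 x y = norm (x - y)"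
definition uniformity_ell2 :: "('a ell2 \<times> 'a ell2) filter"
  where "uniformity_ell2 = (INF e\<in>{0<..}. principal {(x, y). dist x y < e})"
definition open_ell2 :: "'a ell2 set \<Rightarrow> bool"
  where "open_ell2 U \<longleftrightarrow> (\<forall>x\<in>U. eventually (\<lambda>(x', y). x' = x \<longrightarrow> y \<in> U) uniformity)"

instance
proof
  fix x y z :: "'a ell2" and r :: real
  show "dist x y = norm (x - y)" by (fact dist_ell2_def)
  show "sgn x = x /\<^sub>R norm x" by (fact sgn_ell2_def)
  show "(uniformity :: ('a ell2 \<times> 'a ell2) filter) = (INF e\<in>{0<..}. principal {(x, y). dist x y < e})"
    by (fact uniformity_ell2_def)
  show "open U \<longleftrightarrow> (\<forall>x\<in>U. eventually (\<lambda>(x', y). x' = x \<longrightarrow> y \<in> U) uniformity)"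
    for U :: "'a ell2 set" by (fact open_ell2_def)
  show "inner x y = inner y x"
    unfolding inner_ell2_def by (subst cinner_commute) simp
  show "inner (x + y) z = inner x z + inner y z"
    by (simp add: inner_ell2_def cinner_add_left)
  show "inner (r *\<^sub>R x) y = r * inner x y"
    by (simp add: inner_ell2_def scaleR_ell2_def cinner_scaleC_left)
  show "0 \<le> inner x x"
    unfolding inner_ell2_def by (rule has_sum_nonneg[OF cinner_self_has_sum]) simp
  show "inner x x = 0 \<longleftrightarrow> x = 0"
  proof
    assume "inner x x = 0"
    then have "((\<lambda>i. (cmod (coord x i))\<^sup>2) has_sum 0) UNIV"
      using cinner_self_has_sum[of x] by (simp add: inner_ell2_def)
    then have "(cmod (coord x i))\<^sup>2 = 0" for i
      by (rule nonneg_has_sum_le_0D) auto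
    then show "x = 0" by (intro ell2_eqI) simp
  next
    assume "x = 0"
    then show "inner x x = 0"
      unfolding inner_ell2_def cinner.rep_eq by simp
  qed
  show "norm x = sqrt (inner x x)" by (fact norm_ell2_def)
qed

end

lemma cinner_add_right: "cinner x (y + z) = cinner x y + cinner x z"
  unfolding cinner_commute[of x] by (simp add: cinner_add_left)

lemma cinner_scaleC_right: "cinner x (scaleC c y) = c * cinner x y"
  unfolding cinner_commute[of x] by (simp add: cinner_scaleC_left)

lemma cinner_diff_left: "cinner (x - y) z = cinner x z - cinner y z"
  using cinner_add_left[of "x - y" y z] by simp

lemma cinner_diff_right: "cinner x (y - z) = cinner x y - cinner x z"
  using cinner_add_right[of x "y - z" z] by simp

lemma norm_ell2_has_sum: "((\<lambda>i. (cmod (coord x i))\<^sup>2) has_sum (norm x)\<^sup>2) UNIV"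
  using cinner_self_has_sum[of x] by (simp add: power2_norm_eq_inner inner_ell2_def)

lemma norm_coord_le: "cmod (coord x i) \<le> norm x"
proof -
  have "(\<Sum>i\<in>{i}. (cmod (coord x i))\<^sup>2) \<le> (norm x)\<^sup>2"
    by (rule finite_sum_le_has_sum[OF norm_ell2_has_sum]) auto
  then have "(cmod (coord x i))\<^sup>2 \<le> (norm x)\<^sup>2" by simp
  then show ?thesis by (rule power2_le_imp_le) simp
qed

lemma norm_scaleC [simp]: "norm (scaleC c x) = cmod c * norm x"
proof -
  have "((\<lambda>i. (cmod (coord (scaleC c x) i))\<^sup>2) has_sum (cmod c)\<^sup>2 * (norm x)\<^sup>2) UNIV"
    using has_sum_cmult_right[OF norm_ell2_has_sum[of x], of "(cmod c)\<^sup>2"]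
    by (simp add: norm_mult power_mult_distrib)
  then have "(norm (scaleC c x))\<^sup>2 = (cmod c * norm x)\<^sup>2"
    by (simp add: has_sum_unique[OF norm_ell2_has_sum] power_mult_distrib)
  then show ?thesis by (rule power2_eq_imp_eq) auto
qed

lemma cinner_self: "cinner x x = of_real ((norm x)\<^sup>2)"
proof (rule complex_eqI)
  show "Re (cinner x x) = Re (of_real ((norm x)\<^sup>2))"
    by (simp add: power2_norm_eq_inner inner_ell2_def)
  have "Im (cinner x x) = Im (cnj (cinner x x))" by (subst cinner_commute) (rule refl)
  then show "Im (cinner x x) = Im (of_real ((norm x)\<^sup>2))" by simp
qed

lemma ell2_norm_boundI:
  assumes "\<And>F. finite F \<Longrightarrow> (\<Sum>i\<in>F. (cmod (f i))\<^sup>2) \<le> B\<^sup>2" "0 \<le> B"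
  obtains x where "coord x = f" "norm x \<le> B"
proof -
  have s: "(\<lambda>i. (cmod (f i))\<^sup>2) summable_on UNIV"
    by (rule nonneg_bdd_above_summable_on) (use assms in \<open>auto intro!: bdd_aboveI2\<close>)
  define x where "x = Abs_ell2 f"
  have x: "coord x = f" using s by (simp add: x_def Abs_ell2_inverse)
  have "(norm x)\<^sup>2 \<le> B\<^sup>2"
    by (rule has_sum_le_finite_sums[OF norm_ell2_has_sum]) (use assms x in simp)
  then show ?thesis using that x assms(2) power2_le_imp_le by blast
qed

instance ell2 :: (type) complete_space
proof
  fix X :: "nat \<Rightarrow> 'a ell2"
  assume X: "Cauchy X"
  have "Cauchy (\<lambda>n. coord (X n) i)" for i
  proof (rule CauchyI)
    fix e :: real assume "0 < e"
    obtain M where M: "\<forall>m\<ge>M. \<forall>n\<ge>M. norm (X m - X n) < e"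
      by (rule exE[OF CauchyD[OF X \<open>0 < e\<close>]])
    then have "cmod (coord (X m) i - coord (X n) i) < e" if "m \<ge> M" "n \<ge> M" for m n
      using norm_coord_le[of "X m - X n" i] M that by fastforce
    then show "\<exists>M. \<forall>m\<ge>M. \<forall>n\<ge>M. cmod (coord (X m) i - coord (X n) i) < e" by blast
  qed
  then have "\<forall>i. \<exists>l. (\<lambda>n. coord (X n) i) \<longlonglongrightarrow> l"
    by (simp add: Cauchy_convergent_iff convergent_def)
  then obtain f where f: "\<And>i. (\<lambda>n. coord (X n) i) \<longlonglongrightarrow> f i"
    by metis
  have key: "\<exists>y. coord y = (\<lambda>i. coord (X m) i - f i) \<and> norm y \<le> e"
    if "0 < e" and M: "\<And>n. n \<ge> M \<Longrightarrow> norm (X m - X n) \<le> e" for m M e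
  proof -
    have "(\<Sum>i\<in>F. (cmod (coord (X m) i - f i))\<^sup>2) \<le> e\<^sup>2" if "finite F" for F
    proof (rule LIMSEQ_le_const2)
      show "(\<lambda>n. \<Sum>i\<in>F. (cmod (coord (X m) i - coord (X n) i))\<^sup>2)
          \<longlonglongrightarrow> (\<Sum>i\<in>F. (cmod (coord (X m) i - f i))\<^sup>2)"
        by (intro tendsto_intros f)
      have "(\<Sum>i\<in>F. (cmod (coord (X m) i - coord (X n) i))\<^sup>2) \<le> e\<^sup>2" if "n \<ge> M" for n
      proof -
        have "(\<Sum>i\<in>F. (cmod (coord (X m - X n) i))\<^sup>2) \<le> (norm (X m - X n))\<^sup>2"
          by (rule finite_sum_le_has_sum[OF norm_ell2_has_sum]) (use \<open>finite F\<close> in auto)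
        also have "\<dots> \<le> e\<^sup>2" by (intro power_mono M that) simp
        finally show ?thesis by simp
      qed
      then show "\<exists>N. \<forall>n\<ge>N. (\<Sum>i\<in>F. (cmod (coord (X m) i - coord (X n) i))\<^sup>2) \<le> e\<^sup>2" by blast
    qed
    then show ?thesis
      by (rule ell2_norm_boundI) (use \<open>0 < e\<close> in auto)
  qed
  obtain M1 where M1: "\<forall>m\<ge>M1. \<forall>n\<ge>M1. norm (X m - X n) < 1"
    using CauchyD[OF X zero_less_one] ..
  then have "norm (X M1 - X n) \<le> 1" if "n \<ge> M1" for n using that by (simp add: less_imp_le)
  then obtain y where y: "coord y = (\<lambda>i. coord (X M1) i - f i)"
    using key[of 1 M1 M1] by auto
  define x where "x = X M1 - y"
  have x: "coord x i = f i" for i by (simp add: x_def y)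
  have "X \<longlonglongrightarrow> x"
  proof (rule metric_LIMSEQ_I)
    fix e :: real assume "0 < e"
    obtain M where M: "\<forall>m\<ge>M. \<forall>n\<ge>M. norm (X m - X n) < e / 2"
      by (rule exE[OF CauchyD[OF X half_gt_zero[OF \<open>0 < e\<close>]]])
    have "dist (X m) x < e" if "m \<ge> M" for m
    proof -
      have "norm (X m - X n) \<le> e / 2" if "n \<ge> M" for n
        using M that \<open>m \<ge> M\<close> by (simp add: less_imp_le)
      then obtain z where z: "coord z = (\<lambda>i. coord (X m) i - f i)" "norm z \<le> e / 2"
        using key[of "e/2" M m] \<open>0 < e\<close> by auto
      have "z = X m - x" by (intro ell2_eqI) (simp add: z x)
      then show ?thesis using z(2) \<open>0 < e\<close> by (simp add: dist_norm)
    qed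
    then show "\<exists>no. \<forall>n\<ge>no. dist (X n) x < e" by blast
  qed
  then show "convergent X" by (auto simp: convergent_def)
qed

instance ell2 :: (type) banach ..


lemma norm_cinner_le: "cmod (cinner x y) \<le> norm x * norm y"
proof (cases "cinner x y = 0")
  case False
  define c where "c = sgn (cinner x y)"
  have c: "cmod c = 1" using False by (simp add: c_def norm_sgn)
  have "cnj c * cinner x y = of_real (cmod (cinner x y))"
    using False by (simp add: c_def sgn_eq complex_norm_square[symmetric] mult.commute
        power2_eq_square[symmetric])
      (simp add: power2_eq_square)
  then have "cmod (cinner x y) = Re (cinner (scaleC c x) y)"
    by (simp add: cinner_scaleC_left)
  also have "\<dots> \<le> norm (scaleC c x) * norm y"
    using norm_cauchy_schwarz[of "scaleC c x" y] by (simp add: inner_ell2_def)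
  finally show ?thesis by (simp add: c)
qed simp

lemma bounded_linear_scaleC: "bounded_linear (scaleC c)"
  by (rule bounded_linear_intro[of _ "cmod c"])
    (auto intro!: ell2_eqI simp: algebra_simps)

lemma bounded_linear_cinner_right: "bounded_linear (cinner x)"
proof (rule bounded_linear_intro[of _ "norm x"])
  show "cinner x (r *\<^sub>R y) = r *\<^sub>R cinner x y" for r y
    by (simp add: scaleR_ell2_def cinner_scaleC_right scaleR_conv_of_real)
  show "norm (cinner x y) \<le> norm y * norm x" for y
    using norm_cinner_le[of x y] by (simp add: mult.commute)
qed (rule cinner_add_right)

lemma bounded_linear_cinner_left: "bounded_linear (\<lambda>x. cinner x y)"
  using bounded_linear_compose[OF bounded_linear_cnj bounded_linear_cinner_right[of y]]
  by (subst cinner_commute)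

lift_definition ket :: "'i \<Rightarrow> 'i ell2" is "\<lambda>i j. if j = i then 1 else 0"
proof -
  fix i :: 'i
  show "(\<lambda>j. (cmod (if j = i then 1 else 0))\<^sup>2) summable_on UNIV"
    by (rule finite_nonzero_values_imp_summable_on, rule finite_subset[of _ "{i}"]) auto
qed

lemma coord_ket [simp]: "coord (ket i) j = (if j = i then 1 else 0)"
  by transfer simp

lemma cinner_ket [simp]: "cinner (ket i) x = coord x i"
proof -
  have "((\<lambda>j. cnj (coord (ket i) j) * coord x j) has_sum coord x i) UNIV"
    by (rule has_sum_finite_neutralI[of "{i}"]) auto
  then show ?thesis using has_sum_unique[OF cinner_has_sum] by blast
qed

lemma coord_sum: "coord (\<Sum>k\<in>F. f k) i = (\<Sum>k\<in>F. coord (f k) i)"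
  by (induction F rule: infinite_finite_induct) auto

lemma coord_ket_sum:
  "finite F \<Longrightarrow> coord (\<Sum>k\<in>F. scaleC (f k) (ket k)) i = (if i \<in> F then f i else 0)"
  by (simp add: coord_sum if_distrib cong: if_cong)

lemma ket_has_sum: "((\<lambda>i. scaleC (coord x i) (ket i)) has_sum x) UNIV"
proof -
  have nsq: "(norm (x - (\<Sum>i\<in>F. scaleC (coord x i) (ket i))))\<^sup>2 = (norm x)\<^sup>2 - (\<Sum>i\<in>F. (cmod (coord x i))\<^sup>2)"
    (is "(norm ?y)\<^sup>2 = _") if "finite F" for F
  proof -
    have "((\<lambda>i. (cmod (coord x i))\<^sup>2 - (if i \<in> F then (cmod (coord x i))\<^sup>2 else 0)) has_sum
        (norm x)\<^sup>2 - (\<Sum>i\<in>F. (cmod (coord x i))\<^sup>2)) UNIV"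
      unfolding diff_conv_add_uminus
      by (intro has_sum_add has_sum_uminusI norm_ell2_has_sum has_sum_finite_neutralI[of F] that) auto
    also have "(\<lambda>i. (cmod (coord x i))\<^sup>2 - (if i \<in> F then (cmod (coord x i))\<^sup>2 else 0)) =
        (\<lambda>i. (cmod (coord ?y i))\<^sup>2)"
      by (auto simp: coord_ket_sum that)
    finally show ?thesis by (rule has_sum_unique[OF norm_ell2_has_sum])
  qed
  have "((\<lambda>F. sqrt ((norm x)\<^sup>2 - (\<Sum>i\<in>F. (cmod (coord x i))\<^sup>2))) \<longlongrightarrow> sqrt ((norm x)\<^sup>2 - (norm x)\<^sup>2))
      (finite_subsets_at_top UNIV)"
    using norm_ell2_has_sum[of x] unfolding has_sum_def by (intro tendsto_intros)
  moreover have "\<forall>\<^sub>F F in finite_subsets_at_top UNIV.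
      sqrt ((norm x)\<^sup>2 - (\<Sum>i\<in>F. (cmod (coord x i))\<^sup>2)) = norm (x - (\<Sum>i\<in>F. scaleC (coord x i) (ket i)))"
    by (intro eventually_finite_subsets_at_top_weakI) (simp flip: nsq)
  ultimately have "((\<lambda>F. norm (x - (\<Sum>i\<in>F. scaleC (coord x i) (ket i)))) \<longlongrightarrow> 0) (finite_subsets_at_top UNIV)"
    by (simp add: tendsto_cong)
  then have "((\<lambda>F. x - (x - (\<Sum>i\<in>F. scaleC (coord x i) (ket i)))) \<longlongrightarrow> x - 0) (finite_subsets_at_top UNIV)"
    by (intro tendsto_diff tendsto_const) (rule tendsto_norm_zero_cancel)
  then show ?thesis
    unfolding has_sum_def by simp
qed


section \<open>Bounded operators\<close>

type_synonym 'i op = "'i ell2 \<Rightarrow>\<^sub>L 'i ell2"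

text \<open>The type \<^typ>\<open>'i op\<close> also contains operators that are only real-linear; its norm is
  the operator norm, and the algebra of bounded operators on the complex Hilbert space is
  \<open>bounded_ops\<close>.\<close>

definition bounded_ops :: "'i op set"
  where "bounded_ops = {T :: 'i op. \<forall>c x. T (scaleC c x) = scaleC c (T x)}"

definition scaleC_op :: "complex \<Rightarrow> 'i op \<Rightarrow> 'i op"
  where "scaleC_op c T = Blinfun (scaleC c) o\<^sub>L T"

definition adj :: "'i op \<Rightarrow> 'i op"
  where "adj T = (THE S :: 'i op. \<forall>x y. cinner (S x) y = cinner x (T y))"

definition compact_ops :: "'i op set"
  where "compact_ops = {T :: 'i op. T \<in> bounded_ops \<and> compact (closure (T ` cball 0 1))}"

lift_definition tensor_vec :: "'i ell2 \<Rightarrow> 'j ell2 \<Rightarrow> ('i \<times> 'j) ell2"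
  is "\<lambda>f g (i, j). f i * g j"
proof -
  fix f :: "'i \<Rightarrow> complex" and g :: "'j \<Rightarrow> complex"
  assume f: "(\<lambda>i. (cmod (f i))\<^sup>2) summable_on UNIV" and g: "(\<lambda>j. (cmod (g j))\<^sup>2) summable_on UNIV"
  have "(\<lambda>p. (cmod (case p of (i, j) \<Rightarrow> f i * g j))\<^sup>2) summable_on (UNIV \<times> UNIV)"
  proof (rule summable_on_SigmaI)
    show "((\<lambda>j. (cmod (case (i, j) of (i, j) \<Rightarrow> f i * g j))\<^sup>2) has_sum
        (cmod (f i))\<^sup>2 * (\<Sum>\<^sub>\<infinity>j. (cmod (g j))\<^sup>2)) UNIV" for i
      using has_sum_cmult_right[OF has_sum_infsum[OF g]] by (simp add: norm_mult power_mult_distrib)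
    show "(\<lambda>i. (cmod (f i))\<^sup>2 * (\<Sum>\<^sub>\<infinity>j. (cmod (g j))\<^sup>2)) summable_on UNIV"
      by (rule summable_on_cmult_left[OF f])
  qed simp
  then show "(\<lambda>p. (cmod (case p of (i, j) \<Rightarrow> f i * g j))\<^sup>2) summable_on UNIV" by simp
qed

definition op_tensor :: "'i op \<Rightarrow> 'j op \<Rightarrow> ('i \<times> 'j) op"
  where "op_tensor S T = (THE R :: ('i \<times> 'j) op. R \<in> bounded_ops \<and>
    (\<forall>x y. R (tensor_vec x y) = tensor_vec (S x) (T y)))"

lemma scaleC_op_apply [simp]: "scaleC_op c T x = scaleC c (T x)"
  by (simp add: scaleC_op_def bounded_linear_Blinfun_apply bounded_linear_scaleC)

lemma bounded_opsD: "T \<in> bounded_ops \<Longrightarrow> T (scaleC c x) = scaleC c (T x)"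
  by (simp add: bounded_ops_def)

lemma op_eq_on_kets:
  fixes S T :: "'i op"
  assumes "S \<in> bounded_ops" "T \<in> bounded_ops" "\<And>i. S (ket i) = T (ket i)"
  shows "S = T"
proof (rule blinfun_eqI)
  fix x
  have "((\<lambda>i. S (scaleC (coord x i) (ket i))) has_sum S x) UNIV"
    and "((\<lambda>i. T (scaleC (coord x i) (ket i))) has_sum T x) UNIV"
    by (intro has_sum_bounded_linear[OF blinfun.bounded_linear_right ket_has_sum])+
  then show "S x = T x"
    using assms by (simp add: bounded_opsD has_sum_unique)
qed

subsection \<open>Existence and uniqueness of the adjoint\<close>

lemma cinner_ext: "(\<And>y. cinner x y = cinner x' y) \<Longrightarrow> x = x'"
  by (rule ell2_eqI) (metis cinner_commute cinner_ket)

lemma adj_ex1: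
  fixes T :: "'i op"
  assumes T: "T \<in> bounded_ops"
  shows "\<exists>!S :: 'i op. \<forall>x y. cinner (S x) y = cinner x (T y)"
proof -
  have ex: "\<exists>z. (\<forall>y. cinner z y = cinner x (T y)) \<and> norm z \<le> norm x * norm T" for x
  proof -
    define f where "f i = cinner (T (ket i)) x" for i
    have "(\<Sum>i\<in>F. (cmod (f i))\<^sup>2) \<le> (norm x * norm T)\<^sup>2" if F: "finite F" for F
    proof -
      define s where "s = (\<Sum>i\<in>F. (cmod (f i))\<^sup>2)"
      define u where "u = (\<Sum>i\<in>F. scaleC (f i) (ket i))"
      have s0: "0 \<le> s" by (simp add: s_def sum_nonneg)
      have "((\<lambda>i. (cmod (coord u i))\<^sup>2) has_sum s) UNIV"
        by (rule has_sum_finite_neutralI[of F]) (auto simp: F u_def s_def coord_ket_sum)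
      then have nu: "(norm u)\<^sup>2 = s" using has_sum_unique[OF norm_ell2_has_sum] by blast
      interpret L: bounded_linear "\<lambda>v. cinner (T v) x"
        by (rule bounded_linear_compose[OF bounded_linear_cinner_left blinfun.bounded_linear_right])
      have "cinner (T u) x = (\<Sum>i\<in>F. cnj (f i) * f i)"
        unfolding u_def by (simp add: L.sum bounded_opsD[OF T] cinner_scaleC_left f_def)
      also have "\<dots> = of_real s"
        by (simp add: s_def complex_norm_square mult.commute del: of_real_power)
      finally have "s = cmod (cinner (T u) x)" using s0 by simp
      also have "\<dots> \<le> norm (T u) * norm x" by (rule norm_cinner_le)
      also have "\<dots> \<le> norm T * norm u * norm x"
        by (intro mult_right_mono norm_blinfun) simp
      finally have "(norm u)\<^sup>2 \<le> norm u * (norm x * norm T)" by (simp add: nu mult_ac)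
      then have "norm u \<le> norm x * norm T"
        by (cases "norm u = 0") (simp_all add: power2_eq_square)
      then have "(norm u)\<^sup>2 \<le> (norm x * norm T)\<^sup>2" by (intro power_mono) auto
      then show ?thesis by (simp add: nu s_def)
    qed
    then obtain z where z: "coord z = f" "norm z \<le> norm x * norm T"
      by (rule ell2_norm_boundI) auto
    have "cinner z y = cinner x (T y)" for y
    proof -
      have "((\<lambda>i. cinner x (T (scaleC (coord y i) (ket i)))) has_sum cinner x (T y)) UNIV"
        by (intro has_sum_bounded_linear[OF bounded_linear_compose[OF
              bounded_linear_cinner_right blinfun.bounded_linear_right] ket_has_sum])
      moreover have "cinner x (T (scaleC (coord y i) (ket i))) = cnj (coord z i) * coord y i" for i
        by (simp add: bounded_opsD[OF T] cinner_scaleC_right z f_def cinner_commute[of x] mult.commute)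
      ultimately show ?thesis using has_sum_unique[OF cinner_has_sum] by simp
    qed
    then show ?thesis using z(2) by blast
  qed
  then obtain S where S: "\<And>x y. cinner (S x) y = cinner x (T y)" and nS: "\<And>x. norm (S x) \<le> norm x * norm T"
    by metis
  have "bounded_linear S"
    by (rule bounded_linear_intro[OF _ _ nS])
      (auto intro!: cinner_ext simp: S cinner_add_left scaleR_ell2_def cinner_scaleC_left)
  then have "\<forall>x y. cinner (Blinfun S x) y = cinner x (T y)"
    by (simp add: S bounded_linear_Blinfun_apply)
  moreover have "S' = S''"
    if "\<forall>x y. cinner (blinfun_apply S' x) y = cinner x (T y)"
      "\<forall>x y. cinner (blinfun_apply S'' x) y = cinner x (T y)" for S' S'' :: "'i op"
    by (intro blinfun_eqI cinner_ext) (simp add: that)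
  ultimately show ?thesis by blast
qed

lemma cinner_adj: "T \<in> bounded_ops \<Longrightarrow> cinner (adj T x) y = cinner x (T y)"
  unfolding adj_def using theI'[OF adj_ex1] by blast

lemma adj_bounded_ops: "T \<in> bounded_ops \<Longrightarrow> adj T \<in> bounded_ops"
  unfolding bounded_ops_def[of] mem_Collect_eq
  by (intro allI cinner_ext) (simp add: cinner_adj bounded_ops_def cinner_scaleC_left)

subsection \<open>Existence and uniqueness of tensor products of operators\<close>

lemma coord_tensor_vec [simp]: "coord (tensor_vec x y) (i, j) = coord x i * coord y j"
  by transfer simp

lemma ket_tensor: "tensor_vec (ket i) (ket j) = ket (i, j)"
  by (rule ell2_eqI) (auto simp: split_paired_all)

lemma ell2_row_ex: "\<exists>r. \<forall>j. coord r j = coord x (i, j)"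
proof -
  have "(\<lambda>j. (cmod (coord x (i, j)))\<^sup>2) summable_on UNIV"
    using summable_on_SigmaD1[of "\<lambda>i j. (cmod (coord x (i, j)))\<^sup>2" UNIV "\<lambda>_. UNIV" i]
      coord_summable[of x] by (simp add: case_prod_unfold)
  then show ?thesis by (intro exI[of _ "Abs_ell2 (\<lambda>j. coord x (i, j))"]) (simp add: Abs_ell2_inverse)
qed

definition ell2_row :: "('i \<times> 'j) ell2 \<Rightarrow> 'i \<Rightarrow> 'j ell2"
  where "ell2_row x i = (SOME r. \<forall>j. coord r j = coord x (i, j))"

lemma coord_row [simp]: "coord (ell2_row x i) j = coord x (i, j)"
  unfolding ell2_row_def by (rule someI_ex[OF ell2_row_ex, THEN spec])

lemma norm_rows_has_sum: "((\<lambda>i. (norm (ell2_row x i))\<^sup>2) has_sum (norm x)\<^sup>2) UNIV"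
proof (rule has_sum_SigmaD)
  show "((\<lambda>p. (cmod (coord x p))\<^sup>2) has_sum (norm x)\<^sup>2) (UNIV \<times> UNIV)"
    using norm_ell2_has_sum[of x] by simp
  show "((\<lambda>j. (cmod (coord x (i, j)))\<^sup>2) has_sum (norm (ell2_row x i))\<^sup>2) UNIV" for i
    using norm_ell2_has_sum[of "ell2_row x i"] by simp
qed

lemma op_amplify_ex:
  fixes T :: "'j op"
  assumes T: "T \<in> bounded_ops"
  shows "\<exists>R :: ('i \<times> 'j) op. R \<in> bounded_ops \<and> (\<forall>x y. R (tensor_vec x y) = tensor_vec x (T y))"
proof -
  have ex: "\<exists>z. (\<forall>i j. coord z (i, j) = coord (T (ell2_row x i)) j) \<and> norm z \<le> norm x * norm T"
    for x :: "('i \<times> 'j) ell2"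
  proof -
    define f where "f = (\<lambda>(i, j). coord (T (ell2_row x i)) j)"
    have le: "(norm (T (ell2_row x i)))\<^sup>2 \<le> (norm T)\<^sup>2 * (norm (ell2_row x i))\<^sup>2" for i
      using power_mono[OF norm_blinfun[of T "ell2_row x i"], of 2] by (simp add: power_mult_distrib)
    have s0: "((\<lambda>i. (norm T)\<^sup>2 * (norm (ell2_row x i))\<^sup>2) has_sum (norm T)\<^sup>2 * (norm x)\<^sup>2) UNIV"
      by (intro has_sum_cmult_right norm_rows_has_sum)
    have s1: "(\<lambda>i. (norm (T (ell2_row x i)))\<^sup>2) summable_on UNIV"
      by (rule summable_on_comparison_test[OF has_sum_imp_summable[OF s0]]) (use le in auto)
    have row: "((\<lambda>j. (cmod (f (i, j)))\<^sup>2) has_sum (norm (T (ell2_row x i)))\<^sup>2) UNIV" for i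
      unfolding f_def using norm_ell2_has_sum by simp
    have s2: "(\<lambda>p. (cmod (f p))\<^sup>2) summable_on (UNIV \<times> UNIV)"
      by (rule summable_on_SigmaI[OF row s1]) simp
    define z where "z = Abs_ell2 f"
    have z: "coord z = f" using s2 by (simp add: z_def Abs_ell2_inverse)
    have "((\<lambda>i. (norm (T (ell2_row x i)))\<^sup>2) has_sum (norm z)\<^sup>2) UNIV"
      by (rule has_sum_SigmaD[OF _ row]) (use norm_ell2_has_sum[of z] in \<open>simp add: z\<close>)
    then have "(norm z)\<^sup>2 \<le> (norm T)\<^sup>2 * (norm x)\<^sup>2"
      by (rule has_sum_mono[OF _ s0 le])
    then have "(norm z)\<^sup>2 \<le> (norm x * norm T)\<^sup>2" by (simp add: power_mult_distrib mult.commute)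
    then have "norm z \<le> norm x * norm T" by (rule power2_le_imp_le) simp
    then show ?thesis by (intro exI[of _ z]) (simp add: z f_def)
  qed
  then obtain R where R: "\<And>x i j. coord (R x) (i, j) = coord (T (ell2_row x i)) j"
    and nR: "\<And>x :: ('i \<times> 'j) ell2. norm (R x) \<le> norm x * norm T"
    by metis
  have row_add: "ell2_row (x + y) i = ell2_row x i + ell2_row y i"
    and row_scaleC: "ell2_row (scaleC c x) i = scaleC c (ell2_row x i)" for x y :: "('i \<times> 'j) ell2" and c i
    by (rule ell2_eqI; simp)+
  have Radd: "R (x + y) = R x + R y" and RscaleC: "R (scaleC c x) = scaleC c (R x)" for x y c
    by (rule ell2_eqI; simp add: split_paired_all R row_add row_scaleC blinfun.add_right bounded_opsD[OF T])+
  have bl: "bounded_linear R"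
    by (rule bounded_linear_intro[OF Radd _ nR]) (simp add: scaleR_ell2_def RscaleC)
  have "ell2_row (tensor_vec x y) i = scaleC (coord x i) y" for x and y :: "'j ell2" and i :: 'i
    by (rule ell2_eqI) simp
  then have "R (tensor_vec x y) = tensor_vec x (T y)" for x y
    by (intro ell2_eqI) (simp add: split_paired_all R bounded_opsD[OF T])
  then show ?thesis
    using bl RscaleC by (intro exI[of _ "Blinfun R"]) (simp add: bounded_ops_def bounded_linear_Blinfun_apply)
qed

lemma ell2_flip_ex:
  "\<exists>W :: ('i \<times> 'j) ell2 \<Rightarrow>\<^sub>L ('j \<times> 'i) ell2.
    (\<forall>c x. W (scaleC c x) = scaleC c (W x)) \<and> (\<forall>x y. W (tensor_vec x y) = tensor_vec y x)"
proof -
  have ex: "\<exists>z. (\<forall>i j. coord z (j, i) = coord x (i, j)) \<and> norm z = norm x" for x :: "('i \<times> 'j) ell2"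
  proof -
    have s: "((\<lambda>p. (cmod (coord x (prod.swap p)))\<^sup>2) has_sum (norm x)\<^sup>2) UNIV"
      using has_sum_reindex_bij_betw[of prod.swap UNIV UNIV "\<lambda>p. (cmod (coord x p))\<^sup>2"]
        norm_ell2_has_sum[of x] by simp
    define z where "z = Abs_ell2 (\<lambda>p. coord x (prod.swap p))"
    have z: "coord z = (\<lambda>p. coord x (prod.swap p))"
      using has_sum_imp_summable[OF s] by (simp add: z_def Abs_ell2_inverse)
    have "(norm z)\<^sup>2 = (norm x)\<^sup>2"
      using has_sum_unique[OF norm_ell2_has_sum[of z]] s z by simp
    then have "norm z = norm x" by (rule power2_eq_imp_eq) auto
    then show ?thesis by (intro exI[of _ z]) (simp add: z)
  qed
  then obtain W where W: "\<And>x i j. coord (W x) (j, i) = coord x (i, j)"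
    and nW: "\<And>x :: ('i \<times> 'j) ell2. norm (W x) = norm x"
    by metis
  have bl: "bounded_linear W"
    by (rule bounded_linear_intro[of _ 1]) (auto intro!: ell2_eqI simp: W nW)
  have "W (scaleC c x) = scaleC c (W x)" "W (tensor_vec y z) = tensor_vec z y" for c x y z
    by (auto intro!: ell2_eqI simp: W)
  then show ?thesis
    using bl by (intro exI[of _ "Blinfun W"]) (simp add: bounded_linear_Blinfun_apply)
qed

lemma op_tensor_ex1:
  fixes S :: "'i op" and T :: "'j op"
  assumes S: "S \<in> bounded_ops" and T: "T \<in> bounded_ops"
  shows "\<exists>!R :: ('i \<times> 'j) op. R \<in> bounded_ops \<and> (\<forall>x y. R (tensor_vec x y) = tensor_vec (S x) (T y))"
proof -
  obtain R1 :: "('i \<times> 'j) op" where R1: "R1 \<in> bounded_ops" "\<And>x y. R1 (tensor_vec x y) = tensor_vec x (T y)"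
    using op_amplify_ex[OF T] by blast
  obtain R2 :: "('j \<times> 'i) op" where R2: "R2 \<in> bounded_ops" "\<And>x y. R2 (tensor_vec x y) = tensor_vec x (S y)"
    using op_amplify_ex[OF S] by blast
  obtain W :: "('i \<times> 'j) ell2 \<Rightarrow>\<^sub>L ('j \<times> 'i) ell2" where W: "\<And>c x. W (scaleC c x) = scaleC c (W x)"
    "\<And>x y. W (tensor_vec x y) = tensor_vec y x"
    using ell2_flip_ex by blast
  obtain V :: "('j \<times> 'i) ell2 \<Rightarrow>\<^sub>L ('i \<times> 'j) ell2" where V: "\<And>c x. V (scaleC c x) = scaleC c (V x)"
    "\<And>x y. V (tensor_vec x y) = tensor_vec y x"
    using ell2_flip_ex by blast
  have "(V o\<^sub>L R2 o\<^sub>L W o\<^sub>L R1) \<in> bounded_ops \<and>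
      (\<forall>x y. (V o\<^sub>L R2 o\<^sub>L W o\<^sub>L R1) (tensor_vec x y) = tensor_vec (S x) (T y))"
    using R1 R2 V W by (simp add: bounded_ops_def)
  moreover have "R = R'"
    if "R \<in> bounded_ops" "\<forall>x y. R (tensor_vec x y) = tensor_vec (S x) (T y)"
      "R' \<in> bounded_ops" "\<forall>x y. R' (tensor_vec x y) = tensor_vec (S x) (T y)" for R R' :: "('i \<times> 'j) op"
    by (rule op_eq_on_kets) (use that in \<open>auto simp: split_paired_all ket_tensor[symmetric]\<close>)
  ultimately show ?thesis by blast
qed

lemma op_tensor:
  assumes "S \<in> bounded_ops" "T \<in> bounded_ops"
  shows op_tensor_bounded_ops: "op_tensor S T \<in> bounded_ops"
    and op_tensor_apply: "op_tensor S T (tensor_vec x y) = tensor_vec (S x) (T y)"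
  unfolding op_tensor_def using theI'[OF op_tensor_ex1[OF assms]] by blast+


section \<open>C*-algebras\<close>

record 'a star_alg =
  carrier :: "'a set"
  plus_of :: "'a \<Rightarrow> 'a \<Rightarrow> 'a"
  zero_of :: 'a
  scale_of :: "complex \<Rightarrow> 'a \<Rightarrow> 'a"
  times_of :: "'a \<Rightarrow> 'a \<Rightarrow> 'a"
  star_of :: "'a \<Rightarrow> 'a"
  norm_of :: "'a \<Rightarrow> real"

definition diff_of :: "'a star_alg \<Rightarrow> 'a \<Rightarrow> 'a \<Rightarrow> 'a"
  where "diff_of A x y = plus_of A x (scale_of A (-1) y)"

locale cstar_algebra =
  fixes A :: "'a star_alg" (structure)
  assumes zero_closed: "zero_of A \<in> carrier A"
    and plus_closed: "\<lbrakk>x \<in> carrier A; y \<in> carrier A\<rbrakk> \<Longrightarrow> plus_of A x y \<in> carrier A"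
    and scale_closed: "x \<in> carrier A \<Longrightarrow> scale_of A c x \<in> carrier A"
    and times_closed: "\<lbrakk>x \<in> carrier A; y \<in> carrier A\<rbrakk> \<Longrightarrow> times_of A x y \<in> carrier A"
    and star_closed: "x \<in> carrier A \<Longrightarrow> star_of A x \<in> carrier A"
    and plus_assoc: "\<lbrakk>x \<in> carrier A; y \<in> carrier A; z \<in> carrier A\<rbrakk> \<Longrightarrow>
      plus_of A (plus_of A x y) z = plus_of A x (plus_of A y z)"
    and plus_commute: "\<lbrakk>x \<in> carrier A; y \<in> carrier A\<rbrakk> \<Longrightarrow> plus_of A x y = plus_of A y x"
    and plus_zero: "x \<in> carrier A \<Longrightarrow> plus_of A x (zero_of A) = x"
    and diff_self: "x \<in> carrier A \<Longrightarrow> diff_of A x x = zero_of A"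
    and scale_plus: "\<lbrakk>x \<in> carrier A; y \<in> carrier A\<rbrakk> \<Longrightarrow>
      scale_of A c (plus_of A x y) = plus_of A (scale_of A c x) (scale_of A c y)"
    and plus_scale: "x \<in> carrier A \<Longrightarrow>
      scale_of A (c + d) x = plus_of A (scale_of A c x) (scale_of A d x)"
    and scale_scale: "x \<in> carrier A \<Longrightarrow> scale_of A c (scale_of A d x) = scale_of A (c * d) x"
    and scale_one: "x \<in> carrier A \<Longrightarrow> scale_of A 1 x = x"
    and times_assoc: "\<lbrakk>x \<in> carrier A; y \<in> carrier A; z \<in> carrier A\<rbrakk> \<Longrightarrow>
      times_of A (times_of A x y) z = times_of A x (times_of A y z)"
    and times_plus: "\<lbrakk>x \<in> carrier A; y \<in> carrier A; z \<in> carrier A\<rbrakk> \<Longrightarrow>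
      times_of A x (plus_of A y z) = plus_of A (times_of A x y) (times_of A x z)"
    and plus_times: "\<lbrakk>x \<in> carrier A; y \<in> carrier A; z \<in> carrier A\<rbrakk> \<Longrightarrow>
      times_of A (plus_of A x y) z = plus_of A (times_of A x z) (times_of A y z)"
    and scale_times: "\<lbrakk>x \<in> carrier A; y \<in> carrier A\<rbrakk> \<Longrightarrow>
      times_of A (scale_of A c x) y = scale_of A c (times_of A x y)"
    and times_scale: "\<lbrakk>x \<in> carrier A; y \<in> carrier A\<rbrakk> \<Longrightarrow>
      times_of A x (scale_of A c y) = scale_of A c (times_of A x y)"
    and star_star: "x \<in> carrier A \<Longrightarrow> star_of A (star_of A x) = x"
    and star_plus: "\<lbrakk>x \<in> carrier A; y \<in> carrier A\<rbrakk> \<Longrightarrow>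
      star_of A (plus_of A x y) = plus_of A (star_of A x) (star_of A y)"
    and star_scale: "x \<in> carrier A \<Longrightarrow> star_of A (scale_of A c x) = scale_of A (cnj c) (star_of A x)"
    and star_times: "\<lbrakk>x \<in> carrier A; y \<in> carrier A\<rbrakk> \<Longrightarrow>
      star_of A (times_of A x y) = times_of A (star_of A y) (star_of A x)"
    and norm_nonneg: "x \<in> carrier A \<Longrightarrow> 0 \<le> norm_of A x"
    and norm_eq_zero: "x \<in> carrier A \<Longrightarrow> norm_of A x = 0 \<longleftrightarrow> x = zero_of A"
    and norm_plus: "\<lbrakk>x \<in> carrier A; y \<in> carrier A\<rbrakk> \<Longrightarrow>
      norm_of A (plus_of A x y) \<le> norm_of A x + norm_of A y"
    and norm_scale: "x \<in> carrier A \<Longrightarrow> norm_of A (scale_of A c x) = cmod c * norm_of A x"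
    and norm_times: "\<lbrakk>x \<in> carrier A; y \<in> carrier A\<rbrakk> \<Longrightarrow>
      norm_of A (times_of A x y) \<le> norm_of A x * norm_of A y"
    and cstar_identity: "x \<in> carrier A \<Longrightarrow> norm_of A (times_of A (star_of A x) x) = (norm_of A x)\<^sup>2"
    and complete: "\<lbrakk>\<And>n. X n \<in> carrier A;
        \<forall>e>0. \<exists>M::nat. \<forall>m\<ge>M. \<forall>n\<ge>M. norm_of A (diff_of A (X m) (X n)) < e\<rbrakk> \<Longrightarrow>
      \<exists>x\<in>carrier A. (\<lambda>n. norm_of A (diff_of A (X n) x)) \<longlonglongrightarrow> 0"

definition star_hom :: "'a star_alg \<Rightarrow> 'b star_alg \<Rightarrow> ('a \<Rightarrow> 'b) \<Rightarrow> bool"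
  where "star_hom A B \<phi> \<longleftrightarrow>
    (\<forall>x\<in>carrier A. \<phi> x \<in> carrier B) \<and>
    (\<forall>x\<in>carrier A. \<forall>y\<in>carrier A. \<phi> (plus_of A x y) = plus_of B (\<phi> x) (\<phi> y)) \<and>
    (\<forall>c. \<forall>x\<in>carrier A. \<phi> (scale_of A c x) = scale_of B c (\<phi> x)) \<and>
    (\<forall>x\<in>carrier A. \<forall>y\<in>carrier A. \<phi> (times_of A x y) = times_of B (\<phi> x) (\<phi> y)) \<and>
    (\<forall>x\<in>carrier A. \<phi> (star_of A x) = star_of B (\<phi> x))"

definition isomorphic :: "'a star_alg \<Rightarrow> 'b star_alg \<Rightarrow> bool"
  where "isomorphic A B \<longleftrightarrow> (\<exists>\<phi>. star_hom A B \<phi> \<and> bij_betw \<phi> (carrier A) (carrier B))"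

definition short_exact ::
    "'a star_alg \<Rightarrow> 'b star_alg \<Rightarrow> 'c star_alg \<Rightarrow> ('a \<Rightarrow> 'b) \<Rightarrow> ('b \<Rightarrow> 'c) \<Rightarrow> bool"
  where "short_exact I A B \<iota> q \<longleftrightarrow>
    star_hom I A \<iota> \<and> star_hom A B q \<and> inj_on \<iota> (carrier I) \<and>
    \<iota> ` carrier I = {x \<in> carrier A. q x = zero_of B} \<and> q ` carrier A = carrier B"

definition closed_ideal :: "'a star_alg \<Rightarrow> 'a set \<Rightarrow> bool"
  where "closed_ideal A J \<longleftrightarrow>
    J \<subseteq> carrier A \<and> zero_of A \<in> J \<and>
    (\<forall>x\<in>J. \<forall>y\<in>J. plus_of A x y \<in> J) \<and> (\<forall>c. \<forall>x\<in>J. scale_of A c x \<in> J) \<and>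
    (\<forall>a\<in>carrier A. \<forall>x\<in>J. times_of A a x \<in> J \<and> times_of A x a \<in> J) \<and>
    (\<forall>x\<in>carrier A. (\<forall>e>0. \<exists>y\<in>J. norm_of A (diff_of A x y) < e) \<longrightarrow> x \<in> J)"

definition essential_ideal :: "'a star_alg \<Rightarrow> 'a set \<Rightarrow> bool"
  where "essential_ideal A J \<longleftrightarrow> closed_ideal A J \<and>
    (\<forall>J'. closed_ideal A J' \<and> J' \<noteq> {zero_of A} \<longrightarrow> J \<inter> J' \<noteq> {zero_of A})"

subsection \<open>Algebras of operators\<close>

definition op_algebra :: "'i op set \<Rightarrow> 'i op star_alg"
  where "op_algebra S = \<lparr>carrier = S, plus_of = (+), zero_of = 0, scale_of = scaleC_op,
    times_of = (o\<^sub>L), star_of = adj, norm_of = norm\<rparr>"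

abbreviation compact_algebra :: "'i op star_alg"
  where "compact_algebra \<equiv> op_algebra compact_ops"

lemma module_scaleC_op: "module (scaleC_op :: complex \<Rightarrow> 'i op \<Rightarrow> 'i op)"
  by standard (auto intro!: blinfun_eqI ell2_eqI simp: blinfun.add_left algebra_simps)

lemma adj_eqI:
  fixes S T :: "'i op"
  assumes "T \<in> bounded_ops" "\<And>x y. cinner (S x) y = cinner x (T y)"
  shows "adj T = S"
  by (intro blinfun_eqI cinner_ext) (simp add: cinner_adj assms)

lemma norm_scaleC_op: "norm (scaleC_op c T) = cmod c * norm T"
proof (rule antisym)
  have le: "norm (scaleC_op c T) \<le> cmod c * norm T" for c and T :: "'a op"
    by (rule norm_blinfun_bound) (auto simp: mult.assoc intro!: mult_left_mono norm_blinfun)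
  show "norm (scaleC_op c T) \<le> cmod c * norm T" by (rule le)
  show "cmod c * norm T \<le> norm (scaleC_op c T)"
  proof (cases "c = 0")
    case False
    then have "T = scaleC_op (inverse c) (scaleC_op c T)"
      by (intro blinfun_eqI ell2_eqI) simp
    then have "norm T \<le> cmod (inverse c) * norm (scaleC_op c T)" using le by metis
    then show ?thesis using False by (simp add: norm_divide field_simps)
  qed simp
qed

lemma bounded_ops_closed:
  assumes "S \<in> bounded_ops" "T \<in> bounded_ops"
  shows "S + T \<in> bounded_ops" "S o\<^sub>L T \<in> bounded_ops"
  using assms by (auto simp: bounded_ops_def blinfun.add_left intro!: ell2_eqI simp: algebra_simps)

lemma scaleC_op_bounded_ops: "T \<in> bounded_ops \<Longrightarrow> scaleC_op c T \<in> bounded_ops"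
  by (auto simp: bounded_ops_def intro!: ell2_eqI simp: algebra_simps)

lemma cinner_adj_right: "T \<in> bounded_ops \<Longrightarrow> cinner x (adj T y) = cinner (T x) y"
  by (subst (1 2) cinner_commute) (simp add: cinner_adj)

lemma adj_adj: "T \<in> bounded_ops \<Longrightarrow> adj (adj T) = T"
  by (intro adj_eqI adj_bounded_ops cinner_adj_right[symmetric])

lemma
  assumes "S \<in> bounded_ops" "T \<in> bounded_ops"
  shows adj_add: "adj (S + T) = adj S + adj T"
    and adj_compose: "adj (S o\<^sub>L T) = adj T o\<^sub>L adj S"
  by (rule adj_eqI; simp add: assms bounded_ops_closed blinfun.add_left cinner_adj
      cinner_add_left cinner_add_right)+

lemma adj_scaleC: "T \<in> bounded_ops \<Longrightarrow> adj (scaleC_op c T) = scaleC_op (cnj c) (adj T)"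
  by (rule adj_eqI)
    (simp_all add: scaleC_op_bounded_ops cinner_adj cinner_scaleC_left cinner_scaleC_right)

lemma norm_adj_compose:
  assumes T: "T \<in> bounded_ops"
  shows "norm (adj T o\<^sub>L T) = (norm T)\<^sup>2"
proof -
  have sq: "(norm T)\<^sup>2 \<le> norm (adj T o\<^sub>L T)" if T: "T \<in> bounded_ops" for T :: "'a op"
  proof -
    have "norm T \<le> sqrt (norm (adj T o\<^sub>L T))"
    proof (rule norm_blinfun_bound)
      fix x
      have "(norm (T x))\<^sup>2 = cmod (cinner (T x) (T x))"
        by (simp add: cinner_self norm_power)
      also have "cinner (T x) (T x) = cinner ((adj T o\<^sub>L T) x) x"
        by (simp add: cinner_adj[OF T])
      also have "cmod \<dots> \<le> norm ((adj T o\<^sub>L T) x) * norm x" by (rule norm_cinner_le)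
      also have "\<dots> \<le> norm (adj T o\<^sub>L T) * norm x * norm x"
        by (intro mult_right_mono norm_blinfun) simp
      finally have "(norm (T x))\<^sup>2 \<le> (sqrt (norm (adj T o\<^sub>L T)) * norm x)\<^sup>2"
        by (simp add: power_mult_distrib) (simp add: power2_eq_square mult.assoc)
      then show "norm (T x) \<le> sqrt (norm (adj T o\<^sub>L T)) * norm x"
        by (rule power2_le_imp_le) simp
    qed simp
    then have "(norm T)\<^sup>2 \<le> (sqrt (norm (adj T o\<^sub>L T)))\<^sup>2" by (intro power_mono) auto
    then show ?thesis by simp
  qed
  have le: "norm T \<le> norm (adj T)" if "T \<in> bounded_ops" for T :: "'a op"
  proof -
    have "(norm T)\<^sup>2 \<le> norm (adj T) * norm T"
      using sq[OF that] norm_blinfun_compose[of "adj T" T] by linarith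
    then show ?thesis by (cases "norm T = 0") (simp_all add: power2_eq_square)
  qed
  have "norm (adj T) = norm T"
    using le[OF T] le[OF adj_bounded_ops[OF T]] adj_adj[OF T] by simp
  then have "norm (adj T o\<^sub>L T) \<le> (norm T)\<^sup>2"
    using norm_blinfun_compose[of "adj T" T] by (simp add: power2_eq_square)
  then show ?thesis using sq[OF T] by simp
qed

lemma cstar_algebra_op_algebra:
  fixes S :: "'i op set"
  assumes "S \<subseteq> bounded_ops" "closed S" "0 \<in> S"
    and "\<And>x y. x \<in> S \<Longrightarrow> y \<in> S \<Longrightarrow> x + y \<in> S" "\<And>c x. x \<in> S \<Longrightarrow> scaleC_op c x \<in> S"
    and "\<And>x y. x \<in> S \<Longrightarrow> y \<in> S \<Longrightarrow> x o\<^sub>L y \<in> S" "\<And>x. x \<in> S \<Longrightarrow> adj x \<in> S"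
  shows "cstar_algebra (op_algebra S)"
proof -
  interpret module "scaleC_op :: complex \<Rightarrow> 'i op \<Rightarrow> 'i op" by (rule module_scaleC_op)
  have B: "x \<in> bounded_ops" if "x \<in> S" for x using assms(1) that by blast
  have m1: "scaleC_op (- 1) x = - x" for x :: "'i op" by simp
  note [simp] = op_algebra_def diff_of_def m1
  show ?thesis
  proof (standard, goal_cases)
    case (29 X)
    then have "Cauchy X" unfolding Cauchy_def by (simp add: dist_norm)
    then obtain L where L: "X \<longlonglongrightarrow> L" by (auto simp: Cauchy_convergent_iff convergent_def)
    have "L \<in> S" by (rule closed_sequentially[OF \<open>closed S\<close> _ L]) (use 29 in simp)
    moreover have "(\<lambda>n. norm (X n - L)) \<longlonglongrightarrow> 0"
      using L by (simp add: tendsto_norm_zero_iff LIM_zero_iff)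
    ultimately show ?case by auto
  qed (use assms in \<open>auto simp: B scale_right_distrib scale_left_distrib norm_scaleC_op
      norm_triangle_ineq norm_blinfun_compose norm_adj_compose adj_adj adj_add adj_scaleC adj_compose
      bounded_opsD blinfun.add_left blinfun.add_right intro!: blinfun_eqI\<close>)
qed

corollary cstar_algebra_bounded_ops: "cstar_algebra (op_algebra (bounded_ops :: 'i op set))"
proof (rule cstar_algebra_op_algebra)
  have "bounded_ops = (\<Inter>c. \<Inter>x. {T :: 'i op. T (scaleC c x) = scaleC c (T x)})"
    by (auto simp: bounded_ops_def)
  also have "closed \<dots>"
    by (intro closed_INT ballI closed_Collect_eq continuous_intros
        bounded_linear.continuous_on[OF bounded_linear_scaleC])
  finally show "closed (bounded_ops :: 'i op set)" .
  show "0 \<in> (bounded_ops :: 'i op set)" by (auto simp: bounded_ops_def intro: ell2_eqI)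
qed (auto intro: bounded_ops_closed scaleC_op_bounded_ops adj_bounded_ops)

section \<open>Stability\<close>

definition spatial_tensor :: "'i op set \<Rightarrow> 'j op set \<Rightarrow> ('i \<times> 'j) op set"
  where "spatial_tensor S T = closure (module.span scaleC_op {op_tensor a b | a b. a \<in> S \<and> b \<in> T})"

definition faithful_rep :: "'a star_alg \<Rightarrow> ('a \<Rightarrow> 'i op) \<Rightarrow> bool"
  where "faithful_rep A \<pi> \<longleftrightarrow> star_hom A (op_algebra bounded_ops) \<pi> \<and> inj_on \<pi> (carrier A)"

text \<open>
  \<open>A \<otimes> K(\<ell>\<^sub>2)\<close> is the spatial tensor product, formed in an arbitrary faithful representation \<open>\<pi>\<close> of
  \<open>A\<close>; up to isomorphism it does not depend on \<open>\<pi>\<close>, and it is the only C*-tensor product because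
  \<open>K(\<ell>\<^sub>2)\<close> is nuclear. The index type \<^typ>\<open>'a\<close> is large enough: a direct sum of at most
  \<open>|A|\<close> many GNS representations, each on a space of density at most \<open>|A|\<close>, is faithful, and
  representations may be degenerate.
\<close>

definition stable_algebra :: "'a star_alg \<Rightarrow> bool"
  where "stable_algebra A \<longleftrightarrow> (\<exists>\<pi> :: 'a \<Rightarrow> 'a op. faithful_rep A \<pi> \<and>
    isomorphic A (op_algebra (spatial_tensor (\<pi> ` carrier A) (compact_ops :: nat op set))))"

end

(*
  The branches of the tree 2^<omega, coded in nat and indexed by the reals, form an almost disjoint
  family of size continuum.  A family of pairwise disjoint pairs of branches gives a C*-algebra A
  on l2: modulo compact operators, a finite matrix x acts simultaneously on the copies of its index
  set found on each high level of the tree, once along the first and once along the second branches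
  of the pairs.  This yields K(l2) -> A -> K(l2(c)) for every choice of the pairs.

  A multiplier of A has a matrix P of complex numbers over the nodes, and the entries of P tend to
  zero between a first and a second branch.  There are only continuum many matrices P, so the pairs
  can be chosen by recursion along a well-order of the reals with initial segments of size less
  than continuum, where stage alpha makes the pair violate this condition for the alpha-th matrix
  whenever that is possible.  If P comes from a multiplier, it was not possible, so entries of P
  tend to zero along any two distinct branches not used before stage alpha; hence the multiplier
  acts as a scalar on every later basis vector of l2(c).  A stable algebra has two anticommuting
  multipliers of square one; at a common basis vector they would give anticommuting scalars of
  square one.
*)
theory Submission
  imports Defs
begin

section \<open>Coordinate operators\<close>

text \<open>Both ends of the extension are stable, so only the gluing can obstruct stability. The
  multipliers of A \<otimes> K(l2) include 1 \<otimes> D for every bounded D on l2, so it is enough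
  that any two multipliers of A are scalar at a common basis vector of l2(c). Diagonalizing over
  operators on l2(c) itself is hopeless, as there are 2^c of them for c stages; the ideal K(l2) is
  what reduces a multiplier to a matrix over countably many nodes. The reason for two branches per
  index is a test that a choice of pairs can influence. Elements of A have no limiting entries from
  one kind of branch to the other, while their limiting entries among first branches are those of a
  compact operator on l2(c) and give no restriction. Multipliers obtained from an isomorphism with A
  \<otimes> K(l2) are not given as operators on l2; hence they are handled as double centralizers,
  and their matrices are read off rank-one projections.\<close>

definition pull :: "('j \<Rightarrow> 'i option) \<Rightarrow> 'i ell2 \<Rightarrow>\<^sub>L 'j ell2"
  where "pull h = Blinfun (\<lambda>u. Abs_ell2 (\<lambda>j. case h j of None \<Rightarrow> 0 | Some i \<Rightarrow> coord u i))"

text \<open>Injectivity of \<open>h\<close> on its domain turns a finite sum of squares into a sum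
  over distinct coordinates of \<open>u\<close>. A value \<open>None\<close> yields the coordinate
  0, so \<open>pull h\<close> is a partial isometry.\<close>

lemma pull_ex:
  assumes h: "inj_on h (dom h)"
  obtains v where "coord v = (\<lambda>j. case h j of None \<Rightarrow> 0 | Some i \<Rightarrow> coord u i)" "norm v \<le> norm u"
proof (rule ell2_norm_boundI[of "\<lambda>j. case h j of None \<Rightarrow> 0 | Some i \<Rightarrow> coord u i" "norm u"])
  fix G :: "'a set"
  assume G: "finite G"
  have inj: "inj_on (the \<circ> h) (G \<inter> dom h)"
    using h by (auto simp: inj_on_def domIff)
  have "(\<Sum>j\<in>G. (cmod (case h j of None \<Rightarrow> 0 | Some i \<Rightarrow> coord u i))\<^sup>2) =
      (\<Sum>j\<in>G \<inter> dom h. (cmod (coord u ((the \<circ> h) j)))\<^sup>2)"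
    by (rule sum.mono_neutral_cong_right[OF G]) (auto split: option.splits)
  also have "\<dots> = (\<Sum>i\<in>(the \<circ> h) ` (G \<inter> dom h). (cmod (coord u i))\<^sup>2)"
    using sum.reindex[OF inj, of "\<lambda>i. (cmod (coord u i))\<^sup>2"] by (simp add: o_def)
  also have "\<dots> \<le> (norm u)\<^sup>2"
    by (rule finite_sum_le_has_sum[OF norm_ell2_has_sum]) (use G in auto)
  finally show "(\<Sum>j\<in>G. (cmod (case h j of None \<Rightarrow> 0 | Some i \<Rightarrow> coord u i))\<^sup>2) \<le> (norm u)\<^sup>2" .
qed (use that in auto)

lemma
  assumes h: "inj_on h (dom h)"
  shows coord_pull: "coord (pull h u) j = (case h j of None \<Rightarrow> 0 | Some i \<Rightarrow> coord u i)"
    and norm_pull_le: "norm (pull h u) \<le> norm u"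
proof -
  define P where "P u = Abs_ell2 (\<lambda>j. case h j of None \<Rightarrow> 0 | Some i \<Rightarrow> coord u i)" for u
  have P: "coord (P u) j = (case h j of None \<Rightarrow> 0 | Some i \<Rightarrow> coord u i)" "norm (P u) \<le> norm u" for u j
    by (rule pull_ex[OF h, of u]; simp add: P_def flip: coord_inject; metis coord_inverse P_def)+
  have "bounded_linear P"
    by (rule bounded_linear_intro[of _ 1]) (auto intro!: ell2_eqI simp: P split: option.splits)
  moreover have "pull h = Blinfun P"
    by (simp add: pull_def P_def[abs_def])
  ultimately have "pull h u = P u" for u
    by (simp add: bounded_linear_Blinfun_apply)
  then show "coord (pull h u) j = (case h j of None \<Rightarrow> 0 | Some i \<Rightarrow> coord u i)" "norm (pull h u) \<le> norm u"
    by (simp_all add: P)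
qed

lemma pull_scaleC: "inj_on h (dom h) \<Longrightarrow> pull h (scaleC c u) = scaleC c (pull h u)"
  by (rule ell2_eqI) (simp add: coord_pull split: option.splits)

definition proj :: "'i set \<Rightarrow> 'i op"
  where "proj F = pull (\<lambda>i. if i \<in> F then Some i else None)"

lemma inj_on_dom_restrict: "inj_on (\<lambda>i. if i \<in> F then Some i else None) (dom (\<lambda>i. if i \<in> F then Some i else None))"
  by (auto simp: inj_on_def split: if_splits)

lemma coord_proj [simp]: "coord (proj F u) i = (if i \<in> F then coord u i else 0)"
  by (simp add: proj_def coord_pull inj_on_dom_restrict)

lemma proj_bounded_ops [simp]: "proj F \<in> bounded_ops"
  by (auto simp: bounded_ops_def intro: ell2_eqI)

lemma norm_proj_apply_le: "norm (proj F u) \<le> norm u"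
  unfolding proj_def by (rule norm_pull_le[OF inj_on_dom_restrict])

lemma norm_ket [simp]: "norm (ket i) = 1"
proof -
  have "(norm (ket i))\<^sup>2 = 1\<^sup>2" using cinner_self[of "ket i"] by (simp flip: of_real_power)
  then show ?thesis by (rule power2_eq_imp_eq) auto
qed

lemma proj_ket: "proj F (ket i) = (if i \<in> F then ket i else 0)"
  by (rule ell2_eqI) simp

lemma proj_proj: "proj F (proj G u) = proj (F \<inter> G) u"
  by (rule ell2_eqI) simp

lemma proj_eq_sum: "finite F \<Longrightarrow> proj F u = (\<Sum>i\<in>F. scaleC (coord u i) (ket i))"
  by (rule ell2_eqI) (simp add: coord_ket_sum)

lemma proj_approx:
  assumes "0 < e"
  obtains F where "finite F" "norm (x - proj F x) < e"
proof -
  have "((\<lambda>F. \<Sum>i\<in>F. scaleC (coord x i) (ket i)) \<longlongrightarrow> x) (finite_subsets_at_top UNIV)"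
    using ket_has_sum[of x] unfolding has_sum_def .
  then have "\<forall>\<^sub>F F in finite_subsets_at_top UNIV. dist (\<Sum>i\<in>F. scaleC (coord x i) (ket i)) x < e"
    using assms tendstoD by blast
  then obtain F where "finite F" "dist (\<Sum>i\<in>F. scaleC (coord x i) (ket i)) x < e"
    unfolding eventually_finite_subsets_at_top by blast
  then show ?thesis using that by (simp add: proj_eq_sum dist_norm norm_minus_commute)
qed

text \<open>The remainder for \<open>G\<close> is a coordinate projection of the remainder for
  \<open>F\<close>.\<close>

lemma norm_diff_proj_mono:
  assumes "F \<subseteq> G"
  shows "norm (x - proj G x) \<le> norm (x - proj F x)"
proof -
  have "x - proj G x = proj (- G) (x - proj F x)"
    using assms by (intro ell2_eqI) auto
  then show ?thesis using norm_proj_apply_le by metis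
qed

lemma proj_approx_finite:
  fixes X :: "'i ell2 set"
  assumes "finite X" "0 < e"
  obtains F where "finite F" "\<And>x. x \<in> X \<Longrightarrow> norm (x - proj F x) < e"
proof -
  have "\<forall>x :: 'i ell2. \<exists>F. finite F \<and> norm (x - proj F x) < e" using proj_approx[OF assms(2)] by metis
  then obtain f where f: "\<And>x :: 'i ell2. finite (f x) \<and> norm (x - proj (f x) x) < e"
    by (rule choice[THEN exE]) blast
  show ?thesis
  proof (rule that)
    show "finite (\<Union>x\<in>X. f x)" using f assms by simp
    show "norm (x - proj (\<Union>x\<in>X. f x) x) < e" if "x \<in> X" for x
      by (rule le_less_trans[OF norm_diff_proj_mono f[THEN conjunct2]]) (use that in blast)
  qed
qed

lemma coord_adj_ket:
  assumes "T \<in> bounded_ops"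
  shows "coord (adj T (ket i)) j = cnj (coord (T (ket j)) i)"
  by (metis assms cinner_adj_right cinner_commute cinner_ket)

lemma norm_adj:
  assumes T: "T \<in> bounded_ops"
  shows "norm (adj T) = norm T"
proof -
  have le: "norm T \<le> norm (adj T)" if "T \<in> bounded_ops" for T :: "'a op"
  proof -
    have "(norm T)\<^sup>2 \<le> norm (adj T) * norm T"
      using norm_adj_compose[OF that] norm_blinfun_compose[of "adj T" T] by simp
    then show ?thesis by (cases "norm T = 0") (simp_all add: power2_eq_square)
  qed
  show ?thesis using le[OF T] le[OF adj_bounded_ops[OF T]] adj_adj[OF T] by simp
qed

lemma bounded_ops_diff: "S \<in> bounded_ops \<Longrightarrow> T \<in> bounded_ops \<Longrightarrow> S - T \<in> bounded_ops"
  by (auto simp: bounded_ops_def minus_blinfun.rep_eq intro!: ell2_eqI simp: algebra_simps)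

lemma adj_diff: "S \<in> bounded_ops \<Longrightarrow> T \<in> bounded_ops \<Longrightarrow> adj (S - T) = adj S - adj T"
  by (rule adj_eqI)
    (simp_all add: bounded_ops_diff minus_blinfun.rep_eq cinner_adj cinner_diff_left cinner_diff_right)

lemma zero_bounded_ops [simp]: "0 \<in> bounded_ops"
  by (auto simp: bounded_ops_def intro: ell2_eqI)

lemma adj_proj [simp]: "adj (proj F) = proj F"
  by (rule op_eq_on_kets) (auto intro!: ell2_eqI simp: adj_bounded_ops coord_adj_ket)

section \<open>Compact operators\<close>

lemma compact_ops_bounded: "T \<in> compact_ops \<Longrightarrow> T \<in> bounded_ops"
  by (simp add: compact_ops_def)

lemma compact_opsI:
  assumes "T \<in> bounded_ops" "compact K" "T ` cball 0 1 \<subseteq> K"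
  shows "T \<in> compact_ops"
proof -
  have "closure (T ` cball 0 1) \<subseteq> K"
    using assms by (simp add: closure_minimal compact_imp_closed)
  then have "compact (closure (T ` cball 0 1))"
    using compact_Int_closed[OF assms(2) closed_closure[of "T ` cball 0 1"]] by (simp add: Int_absorb1)
  then show ?thesis using assms by (simp add: compact_ops_def)
qed

text \<open>The closure of the image is complete, so its compactness is total boundedness; an
  \<open>e/2\<close>-net of the image, taken with closed balls, yields an \<open>e\<close>-net of
  the closure.\<close>

lemma compact_ops_iff_totally_bounded:
  "T \<in> compact_ops \<longleftrightarrow>
    T \<in> bounded_ops \<and> (\<forall>e>0. \<exists>k. finite k \<and> T ` cball 0 1 \<subseteq> (\<Union>x\<in>k. ball x e))"
proof
  assume T: "T \<in> compact_ops"
  show "T \<in> bounded_ops \<and> (\<forall>e>0. \<exists>k. finite k \<and> T ` cball 0 1 \<subseteq> (\<Union>x\<in>k. ball x e))"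
  proof (rule conjI[OF compact_ops_bounded[OF T]], safe)
    fix e :: real assume "0 < e"
    moreover have "compact (closure (T ` cball 0 1))" using T by (simp add: compact_ops_def)
    ultimately obtain k where k: "finite k" "closure (T ` cball 0 1) \<subseteq> (\<Union>x\<in>k. ball x e)"
      unfolding compact_eq_totally_bounded by blast
    then show "\<exists>k. finite k \<and> T ` cball 0 1 \<subseteq> (\<Union>x\<in>k. ball x e)"
      using k(1) subset_trans[OF closure_subset k(2)] by (intro exI[of _ k] conjI)
  qed
next
  assume *: "T \<in> bounded_ops \<and> (\<forall>e>0. \<exists>k. finite k \<and> T ` cball 0 1 \<subseteq> (\<Union>x\<in>k. ball x e))"
  have "\<exists>k. finite k \<and> closure (T ` cball 0 1) \<subseteq> (\<Union>x\<in>k. ball x e)" if "0 < e" for e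
  proof -
    obtain k where k: "finite k" "T ` cball 0 1 \<subseteq> (\<Union>x\<in>k. ball x (e/2))"
      using * \<open>0 < e\<close> half_gt_zero by blast
    have "T ` cball 0 1 \<subseteq> (\<Union>x\<in>k. cball x (e/2))" 
      using k(2) by (rule order_trans) (intro UN_mono ball_subset_cball order_refl)
    then have "closure (T ` cball 0 1) \<subseteq> (\<Union>x\<in>k. cball x (e/2))"
      by (rule closure_minimal) (use k in auto)
    also have "\<dots> \<subseteq> (\<Union>x\<in>k. ball x e)" 
      by (intro UN_mono order_refl) (use \<open>0 < e\<close> in auto)
    finally show ?thesis using k(1) by (intro exI[of _ k] conjI)
  qed
  then show "T \<in> compact_ops"
    using * by (simp add: compact_ops_def compact_eq_totally_bounded complete_eq_closed)
qed

lemma compact_ops_add: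
  assumes "S \<in> compact_ops" "T \<in> compact_ops"
  shows "S + T \<in> compact_ops"
proof (rule compact_opsI)
  let ?K = "{x + y | x y. x \<in> closure (S ` cball 0 1) \<and> y \<in> closure (T ` cball 0 1)}"
  show "compact ?K" using assms by (intro compact_sums) (auto simp: compact_ops_def)
  show "(S + T) ` cball 0 1 \<subseteq> ?K"
    using closure_subset[of "S ` cball 0 1"] closure_subset[of "T ` cball 0 1"]
    by (fastforce simp: blinfun.add_left)
  show "S + T \<in> bounded_ops" using assms by (simp add: bounded_ops_closed compact_ops_bounded)
qed

lemma compact_ops_compose_left:
  assumes S: "S \<in> bounded_ops" and T: "T \<in> compact_ops"
  shows "S o\<^sub>L T \<in> compact_ops"
proof (rule compact_opsI)
  show "compact (S ` closure (T ` cball 0 1))"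
    using T by (intro compact_continuous_image continuous_intros) (simp add: compact_ops_def)
  show "(S o\<^sub>L T) ` cball 0 1 \<subseteq> S ` closure (T ` cball 0 1)"
    using closure_subset[of "T ` cball 0 1"] by auto
qed (use assms in \<open>simp add: bounded_ops_closed compact_ops_bounded\<close>)

lemma compact_ops_scaleC: "T \<in> compact_ops \<Longrightarrow> scaleC_op c T \<in> compact_ops"
proof -
  assume T: "T \<in> compact_ops"
  have "scaleC_op c id_blinfun \<in> bounded_ops"
    by (rule scaleC_op_bounded_ops) (simp add: bounded_ops_def)
  moreover have "scaleC_op c T = scaleC_op c id_blinfun o\<^sub>L T" by (rule blinfun_eqI) simp
  ultimately show ?thesis using compact_ops_compose_left T by metis
qed

lemma scaleC_op_of_real: "scaleC_op (of_real r) T = r *\<^sub>R T"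
  by (intro blinfun_eqI ell2_eqI) (simp add: scaleR_blinfun.rep_eq)

lemma compact_ops_compose_right:
  assumes S: "S \<in> bounded_ops" and T: "T \<in> compact_ops"
  shows "T o\<^sub>L S \<in> compact_ops"
proof -
  \<comment> \<open>The rescaled \<open>S'\<close> maps the unit ball into itself; the added 1
    avoids a division by zero.\<close>
  define S' where "S' = S /\<^sub>R (norm S + 1)"
  have n: "norm S + 1 > 0" by (simp add: add_nonneg_pos)
  have bound: "norm (S' x) \<le> 1" if "norm x \<le> 1" for x
  proof -
    have "norm (S x) \<le> norm S * norm x" by (rule norm_blinfun)
    also have "\<dots> \<le> norm S + 1" using that by (smt (verit) mult_left_le norm_ge_zero)
    finally show ?thesis using n by (simp add: S'_def scaleR_blinfun.rep_eq field_simps)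
  qed
  have b: "S' \<in> bounded_ops"
    using scaleC_op_bounded_ops[OF S, of "of_real (inverse (norm S + 1))"]
    by (simp only: scaleC_op_of_real S'_def)
  have "T o\<^sub>L S' \<in> compact_ops"
  proof (rule compact_opsI)
    show "compact (closure (T ` cball 0 1))" using T by (simp add: compact_ops_def)
    show "(T o\<^sub>L S') ` cball 0 1 \<subseteq> closure (T ` cball 0 1)"
      using bound closure_subset[of "T ` cball 0 1"] by fastforce
  qed (use b T in \<open>simp add: bounded_ops_closed compact_ops_bounded\<close>)
  then have "scaleC_op (of_real (norm S + 1)) (T o\<^sub>L S') \<in> compact_ops"
    by (rule compact_ops_scaleC)
  also have "scaleC_op (of_real (norm S + 1)) (T o\<^sub>L S') = T o\<^sub>L S"
    unfolding scaleC_op_of_real using n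
    by (intro blinfun_eqI) (simp add: S'_def scaleR_blinfun.rep_eq blinfun.scaleR_right)
  finally show ?thesis .
qed

lemma compact_ops_proj_singleton: "proj {i} \<in> compact_ops"
proof (rule compact_opsI)
  have "bounded_linear (\<lambda>c. scaleC c (ket i))"
    by (rule bounded_linear_intro[of _ "norm (ket i)"])
      (auto intro!: ell2_eqI simp: algebra_simps scaleR_conv_of_real)
  then show "compact ((\<lambda>c. scaleC c (ket i)) ` cball 0 1)"
    by (intro compact_continuous_image[OF linear_continuous_on compact_cball])
  show "proj {i} ` cball 0 1 \<subseteq> (\<lambda>c. scaleC c (ket i)) ` cball 0 1"
  proof clarsimp
    fix x :: "'a ell2" assume "norm x \<le> 1"
    then show "proj {i} x \<in> (\<lambda>c. scaleC c (ket i)) ` cball 0 1"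
      using norm_coord_le[of x i] by (intro image_eqI[of _ _ "coord x i"]) (auto simp: proj_eq_sum)
  qed
qed simp

lemma zero_compact_ops [simp]: "0 \<in> compact_ops"
  by (rule compact_opsI[of _ "{0}"]) auto

lemma compact_ops_sum: "(\<And>i. i \<in> I \<Longrightarrow> f i \<in> compact_ops) \<Longrightarrow> (\<Sum>i\<in>I. f i) \<in> compact_ops"
  by (induction I rule: infinite_finite_induct) (auto intro: compact_ops_add)

lemma compact_ops_proj:
  assumes "finite F"
  shows "proj F \<in> compact_ops"
proof -
  have "proj F = (\<Sum>i\<in>F. proj {i})"
    using assms by (intro blinfun_eqI) (simp add: proj_eq_sum blinfun.sum_left)
  then show ?thesis by (simp add: compact_ops_sum compact_ops_proj_singleton)
qed

lemma compact_ops_finite_kets: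
  assumes T: "T \<in> bounded_ops" and "finite F" "\<And>i. i \<notin> F \<Longrightarrow> T (ket i) = 0"
  shows "T \<in> compact_ops"
proof -
  have "T = T o\<^sub>L proj F"
    by (rule op_eq_on_kets) (auto simp: T bounded_ops_closed proj_ket assms)
  then show ?thesis by (metis compact_ops_compose_left compact_ops_proj T assms(2))
qed

lemma closed_bounded_ops: "closed (bounded_ops :: 'i op set)"
proof -
  have "bounded_ops = (\<Inter>c. \<Inter>x. {T :: 'i op. T (scaleC c x) = scaleC c (T x)})"
    by (auto simp: bounded_ops_def)
  also have "closed \<dots>"
    by (intro closed_INT ballI closed_Collect_eq continuous_intros
        bounded_linear.continuous_on[OF bounded_linear_scaleC])
  finally show ?thesis .
qed

text \<open>An operator within \<open>e/2\<close> of a compact one maps the unit ball into the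
  \<open>e/2\<close>-neighbourhood of a totally bounded set.\<close>

lemma closed_compact_ops: "closed (compact_ops :: 'i op set)"
proof -
  have "T \<in> compact_ops" if T: "T \<in> closure compact_ops" for T :: "'i op"
    unfolding compact_ops_iff_totally_bounded
  proof (intro conjI allI impI)
    show "T \<in> bounded_ops"
      using T closed_bounded_ops closure_minimal[of "compact_ops :: 'i op set" bounded_ops] compact_ops_bounded by blast
    fix e :: real assume "0 < e"
    then obtain S where S: "S \<in> compact_ops" "dist S T < e/2"
      using T unfolding closure_approachable by (metis half_gt_zero)
    obtain k where k: "finite k" "S ` cball 0 1 \<subseteq> (\<Union>x\<in>k. ball x (e/2))"
      using S \<open>0 < e\<close> unfolding compact_ops_iff_totally_bounded by (metis half_gt_zero)
    have "T x \<in> (\<Union>x\<in>k. ball x e)" if "norm x \<le> 1" for x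
    proof -
      have "S x \<in> (\<Union>x\<in>k. ball x (e/2))" by (rule subsetD[OF k(2)]) (use that in simp)
      then obtain y where y: "y \<in> k" "dist y (S x) < e/2" by auto
      have "norm ((S - T) x) \<le> norm (S - T) * norm x" by (rule norm_blinfun)
      also have "\<dots> \<le> norm (S - T)" using that by (simp add: mult_left_le)
      finally have "dist (S x) (T x) < e/2" using S by (simp add: dist_norm minus_blinfun.rep_eq)
      then have "dist y (T x) < e" using y dist_triangle[of y "T x" "S x"] by simp
      then show ?thesis using y by auto
    qed
    then show "\<exists>k. finite k \<and> T ` cball 0 1 \<subseteq> (\<Union>x\<in>k. ball x e)"
      using k(1) by (intro exI[of _ k]) auto
  qed
  then show ?thesis using closure_subset_eq by blast
qed

text \<open>A finite net of the image of the unit ball fixes finitely many output coordinates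
  \<open>F\<close>. The rows of \<open>T\<close> at these, given by the vectors
  \<open>adj T (ket i)\<close>, then fix finitely many input coordinates \<open>G\<close>. The union
  \<open>H\<close> serves on both sides.\<close>

lemma compact_ops_approx:
  assumes T: "T \<in> compact_ops" and e: "0 < e"
  obtains F where "finite F" "norm (T - (proj F o\<^sub>L T o\<^sub>L proj F)) \<le> e"
proof -
  have bT: "T \<in> bounded_ops" using T by (rule compact_ops_bounded)
  \<comment> \<open>Three errors of size \<open>e/12\<close> give the \<open>e/4\<close> of
    \<open>A\<close>, the cut of the input costs the \<open>e/4\<close> of \<open>B\<close>, and
    cutting the output by \<open>H\<close> instead of \<open>F\<close> doubles the sum.\<close>
  have "0 < e/12" using e by simp
  then have "\<exists>k. finite k \<and> T ` cball 0 1 \<subseteq> (\<Union>x\<in>k. ball x (e/12))"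
    using T unfolding compact_ops_iff_totally_bounded by blast
  then obtain k where k: "finite k" "T ` cball 0 1 \<subseteq> (\<Union>x\<in>k. ball x (e/12))"
    by (elim exE conjE)
  obtain F where F: "finite F" "\<And>x. x \<in> k \<Longrightarrow> norm (x - proj F x) < e/12"
    using proj_approx_finite[OF k(1), of "e/12"] e by auto
  \<comment> \<open>An error \<open>d\<close> in each of the \<open>card F\<close> rows adds up to
    at most \<open>e/4\<close>; the added 1 keeps \<open>d\<close> positive for empty
    \<open>F\<close>.\<close>
  define d where "d = e / (4 * (real (card F) + 1))"
  have d: "0 < d" using e by (simp add: d_def)
  obtain G where G: "finite G" "\<And>x. x \<in> (\<lambda>i. adj T (ket i)) ` F \<Longrightarrow> norm (x - proj G x) < d"
    using proj_approx_finite[OF finite_imageI[OF F(1), of "\<lambda>i. adj T (ket i)"] d] by metis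
  define H where "H = F \<union> G"
  have A: "norm (T x - proj F (T x)) \<le> e/4" if x: "norm x \<le> 1" for x
  proof -
    have "T x \<in> (\<Union>x\<in>k. ball x (e/12))" by (rule subsetD[OF k(2)]) (use x in simp)
    then obtain y where y: "y \<in> k" "dist y (T x) < e/12" by auto
    have "T x - proj F (T x) = (T x - y) + (y - proj F y) + proj F (y - T x)"
      by (simp add: blinfun.diff_right)
    also have "norm \<dots> \<le> norm (T x - y) + norm (y - proj F y) + norm (proj F (y - T x))"
      by (intro norm_triangle_mono norm_triangle_ineq) simp
    also have "\<dots> \<le> e/12 + e/12 + e/12"
      using y F(2)[OF y(1)] norm_proj_apply_le[of F "y - T x"]
      by (intro add_mono) (auto simp: dist_norm norm_minus_commute)
    finally show ?thesis by simp
  qed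
  have B: "norm (proj F (T (x - proj H x))) \<le> e/4" if x: "norm x \<le> 1" for x
  proof -
    have c: "cmod (coord (T (x - proj H x)) i) \<le> d" if i: "i \<in> F" for i
    proof -
      have "coord (T (x - proj H x)) i = cinner (adj T (ket i)) (x - proj H x)"
        by (simp add: cinner_adj[OF bT])
      also have "\<dots> = cinner (adj T (ket i)) ((id_blinfun - proj H) x)"
        by (simp add: minus_blinfun.rep_eq)
      also have "\<dots> = cinner ((id_blinfun - proj H) (adj T (ket i))) x"
      proof -
        have "id_blinfun - proj H = proj (- H)"
          by (intro blinfun_eqI ell2_eqI) (simp add: minus_blinfun.rep_eq)
        then show ?thesis using cinner_adj[OF proj_bounded_ops, of "- H"] by simp
      qed
      also have "cmod \<dots> \<le> norm ((id_blinfun - proj H) (adj T (ket i))) * norm x"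
        by (rule norm_cinner_le)
      also have "\<dots> \<le> norm ((id_blinfun - proj H) (adj T (ket i)))"
        using x by (simp add: mult_left_le)
      also have "\<dots> \<le> norm (adj T (ket i) - proj G (adj T (ket i)))"
        using norm_diff_proj_mono[of G H "adj T (ket i)"] by (simp add: H_def minus_blinfun.rep_eq)
      also have "\<dots> \<le> d" using G(2)[OF imageI[OF i]] by simp
      finally show ?thesis .
    qed
    have "norm (proj F (T (x - proj H x))) \<le> (\<Sum>i\<in>F. norm (scaleC (coord (T (x - proj H x)) i) (ket i)))"
      unfolding proj_eq_sum[OF F(1)] by (rule norm_sum)
    also have "\<dots> \<le> (\<Sum>i\<in>F. d)" by (rule sum_mono) (simp add: c)
    also have "\<dots> \<le> e/4" using e by (simp add: d_def field_simps)
    finally show ?thesis .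
  qed
  show ?thesis
  proof (rule that[of H])
    show "finite H" using F G by (simp add: H_def)
    show "norm (T - (proj H o\<^sub>L T o\<^sub>L proj H)) \<le> e"
    proof (rule norm_blinfun_bound)
      have half: "norm (T x - proj F (T (proj H x))) \<le> e/2" if "norm x \<le> 1" for x
      proof -
        have "T x - proj F (T (proj H x)) = (T x - proj F (T x)) + proj F (T (x - proj H x))"
          by (simp add: blinfun.diff_right)
        then have "norm (T x - proj F (T (proj H x))) \<le> e/4 + e/4"
          by (simp only: norm_triangle_mono[OF A[OF that] B[OF that]])
        then show ?thesis by simp
      qed
      have unit: "norm ((T - (proj H o\<^sub>L T o\<^sub>L proj H)) x) \<le> e" if x: "norm x \<le> 1" for x
      proof -
        have y: "norm (proj H x) \<le> 1" using x norm_proj_apply_le order_trans by blast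
        \<comment> \<open>As \<open>F\<close> lies in \<open>H\<close>, the error of the two-sided
          cut is a difference of two errors bounded by \<open>half\<close>, one at \<open>x\<close>
          and one at \<open>proj H x\<close>.\<close>
        have "(T - (proj H o\<^sub>L T o\<^sub>L proj H)) x =
            (T x - proj F (T (proj H x))) - proj H (T (proj H x) - proj F (T (proj H (proj H x))))"
          by (simp add: minus_blinfun.rep_eq blinfun.diff_right proj_proj H_def Int_absorb1)
        also have "norm \<dots> \<le> e/2 + e/2"
          by (rule order_trans[OF norm_triangle_ineq4 add_mono[OF half[OF x]
                order_trans[OF norm_proj_apply_le half[OF y]]]])
        finally show ?thesis by simp
      qed
      show "norm ((T - (proj H o\<^sub>L T o\<^sub>L proj H)) x) \<le> e * norm x" for x
      proof (cases "x = 0")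
        case False
        then show ?thesis using unit[of "x /\<^sub>R norm x"]
          by (simp add: blinfun.scaleR_right field_simps)
      qed simp
    qed (use e in simp)
  qed
qed

text \<open>The adjoint is isometric and turns the approximating corners of \<open>T\<close> into
  finite corners of \<open>adj T\<close>, which are compact.\<close>

lemma compact_ops_adj:
  assumes T: "T \<in> compact_ops"
  shows "adj T \<in> compact_ops"
proof -
  have bT: "T \<in> bounded_ops" using T by (rule compact_ops_bounded)
  have "\<exists>S\<in>compact_ops. dist S (adj T) < e" if "0 < e" for e
  proof -
    obtain F where F: "finite F" "norm (T - (proj F o\<^sub>L T o\<^sub>L proj F)) \<le> e/2"
      using compact_ops_approx[OF T, of "e/2"] \<open>0 < e\<close> by auto
    define S where "S = proj F o\<^sub>L adj T o\<^sub>L proj F"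
    have "S = adj (proj F o\<^sub>L T o\<^sub>L proj F)"
      by (simp add: adj_compose bounded_ops_closed bT) (intro blinfun_eqI, simp add: S_def)
    then have "adj T - S = adj (T - (proj F o\<^sub>L T o\<^sub>L proj F))"
      by (simp add: adj_diff bounded_ops_closed bT)
    then have "norm (adj T - S) \<le> e/2"
      using F by (simp add: norm_adj bounded_ops_diff bounded_ops_closed bT)
    moreover have "S \<in> compact_ops"
      unfolding S_def by (intro compact_ops_compose_left compact_ops_proj F bounded_ops_closed
          adj_bounded_ops bT proj_bounded_ops)
    ultimately show ?thesis
      using \<open>0 < e\<close> by (intro bexI[of _ S]) (auto simp: dist_norm norm_minus_commute)
  qed
  then show ?thesis
    using closed_approachable[OF closed_compact_ops] by blast
qed

text \<open>An injective sequence of indices leaves every finite set, and a finite corner of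
  \<open>T\<close> vanishes on the basis vectors outside of it. This makes compact perturbations
  invisible along a branch.\<close>

lemma compact_ops_ket_tendsto:
  assumes T: "T \<in> compact_ops" and j: "inj (j :: nat \<Rightarrow> 'i)"
  shows "(\<lambda>n. T (ket (j n))) \<longlonglongrightarrow> 0"
proof (rule LIMSEQ_I)
  fix e :: real assume "0 < e"
  then obtain F where F: "finite F" "norm (T - (proj F o\<^sub>L T o\<^sub>L proj F)) \<le> e/2"
    using compact_ops_approx[OF T, of "e/2"] by auto
  have small: "norm (T (ket i)) < e" if "i \<notin> F" for i
  proof -
    have "norm ((T - (proj F o\<^sub>L T o\<^sub>L proj F)) (ket i)) \<le> norm (T - (proj F o\<^sub>L T o\<^sub>L proj F)) * norm (ket i)"
      by (rule norm_blinfun)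
    then show ?thesis using F that \<open>0 < e\<close> by (simp add: minus_blinfun.rep_eq proj_ket)
  qed
  have "finite (j -` F)" using F(1) j by (rule finite_vimageI)
  then obtain N where "\<And>n. n \<in> j -` F \<Longrightarrow> n < N"
    by (meson finite_nat_set_iff_bounded)
  then show "\<exists>N. \<forall>n\<ge>N. norm (T (ket (j n)) - 0) < e"
    using small by (metis diff_zero leD vimage_eq)
qed

section \<open>Amplifications\<close>

lemma blinfun_eq_on_kets:
  fixes S T :: "'i ell2 \<Rightarrow>\<^sub>L 'j ell2"
  assumes "\<And>c x. S (scaleC c x) = scaleC c (S x)" "\<And>c x. T (scaleC c x) = scaleC c (T x)"
    and "\<And>i. S (ket i) = T (ket i)"
  shows "S = T"
proof (rule blinfun_eqI)
  fix x
  have "((\<lambda>i. S (scaleC (coord x i) (ket i))) has_sum S x) UNIV"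
    and "((\<lambda>i. T (scaleC (coord x i) (ket i))) has_sum T x) UNIV"
    by (intro has_sum_bounded_linear[OF blinfun.bounded_linear_right ket_has_sum])+
  then show "S x = T x"
    using assms by (simp add: has_sum_unique)
qed

lemma id_bounded_ops [simp]: "id_blinfun \<in> bounded_ops"
  by (simp add: bounded_ops_def)

lemma ell2_row_eq_pull: "ell2_row x k = pull (\<lambda>j. Some (k, j)) x"
  by (rule ell2_eqI) (subst coord_pull, auto simp: inj_on_def)

text \<open>Taking a row is a coordinate operator, so both sides are bounded and complex-linear in
  \<open>u\<close> and can be compared on basis vectors.\<close>

lemma ell2_row_op_tensor_id:
  fixes T :: "'j op" and u :: "('k \<times> 'j) ell2"
  assumes T: "T \<in> bounded_ops"
  shows "ell2_row (op_tensor id_blinfun T u) k = T (ell2_row u k)"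
proof -
  let ?R = "op_tensor (id_blinfun :: 'k op) T" and ?r = "pull (\<lambda>j. Some (k, j)) :: ('k \<times> 'j) ell2 \<Rightarrow>\<^sub>L 'j ell2"
  have i: "inj_on (\<lambda>j :: 'j. Some (k, j)) (dom (\<lambda>j. Some (k, j)))"
    by (auto simp: inj_on_def)
  have "?r o\<^sub>L ?R = T o\<^sub>L ?r"
  proof (rule blinfun_eq_on_kets)
    fix p :: "'k \<times> 'j"
    obtain k' j where p: "p = (k', j)" by (cases p)
    have "?R (ket p) = tensor_vec (ket k') (T (ket j))"
      by (simp add: p op_tensor_apply T flip: ket_tensor)
    moreover have "?r (tensor_vec (ket k') v) = (if k' = k then v else 0)" for v
      by (rule ell2_eqI) (simp add: coord_pull[OF i])
    moreover have "?r (ket p) = (if k' = k then ket j else 0)"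
      by (rule ell2_eqI) (auto simp: coord_pull[OF i] p)
    ultimately show "(?r o\<^sub>L ?R) (ket p) = (T o\<^sub>L ?r) (ket p)" by simp
  qed (simp_all add: pull_scaleC[OF i] bounded_opsD[OF T] bounded_opsD[OF op_tensor_bounded_ops] T)
  then show ?thesis
    by (metis ell2_row_eq_pull blinfun_apply_blinfun_compose)
qed

text \<open>The squared norm is the sum over the rows, and each row grows at most by the factor
  \<open>norm T\<close>.\<close>

lemma norm_op_tensor_id_le:
  fixes T :: "'j op"
  assumes T: "T \<in> bounded_ops"
  shows "norm (op_tensor (id_blinfun :: 'k op) T) \<le> norm T"
proof (rule norm_blinfun_bound)
  fix u :: "('k \<times> 'j) ell2"
  let ?R = "op_tensor (id_blinfun :: 'k op) T"
  have "((\<lambda>k. (norm (T (ell2_row u k)))\<^sup>2) has_sum (norm (?R u))\<^sup>2) UNIV"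
    using norm_rows_has_sum[of "?R u"] by (simp add: ell2_row_op_tensor_id T)
  moreover have "((\<lambda>k. (norm T)\<^sup>2 * (norm (ell2_row u k))\<^sup>2) has_sum (norm T)\<^sup>2 * (norm u)\<^sup>2) UNIV"
    by (intro has_sum_cmult_right norm_rows_has_sum)
  moreover have "(norm (T (ell2_row u k)))\<^sup>2 \<le> (norm T)\<^sup>2 * (norm (ell2_row u k))\<^sup>2" for k
    using power_mono[OF norm_blinfun[of T "ell2_row u k"], of 2] by (simp add: power_mult_distrib)
  ultimately have "(norm (?R u))\<^sup>2 \<le> (norm T)\<^sup>2 * (norm u)\<^sup>2" by (rule has_sum_mono)
  then have "(norm (?R u))\<^sup>2 \<le> (norm T * norm u)\<^sup>2" by (simp add: power_mult_distrib)
  then show "norm (?R u) \<le> norm T * norm u" by (rule power2_le_imp_le) simp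
qed simp

section \<open>Lifting finite matrices along branches\<close>

text \<open>\<open>node i \<alpha> n\<close> is the node of level \<open>n\<close> on one of the two branches that form the pair of index \<open>\<alpha>\<close>;
  \<open>i\<close> selects the branch.\<close>

locale branches =
  fixes node :: "bool \<Rightarrow> 'a \<Rightarrow> nat \<Rightarrow> nat"
  assumes node_level: "node i \<alpha> n = node j \<beta> m \<Longrightarrow> n = m"
    and node_split: "(i, \<alpha>) \<noteq> (j, \<beta>) \<Longrightarrow> \<exists>N. \<forall>n\<ge>N. node i \<alpha> n \<noteq> node j \<beta> n"
begin

text \<open>If \<open>sep F N\<close>, the nodes of level at least \<open>N\<close> on the branches with index in \<open>F\<close> are in bijection
  with \<open>(bool \<times> {N..}) \<times> F\<close>, so that their span is \<open>\<ell>\<^sub>2(bool \<times> {N..}) \<otimes> \<ell>\<^sub>2(F)\<close>, and \<open>Lift\<close> amplifies an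
  operator on the second factor.\<close>

definition code :: "'a set \<Rightarrow> nat \<Rightarrow> (bool \<times> nat) \<times> 'a \<Rightarrow> nat option"
  where "code F N = (\<lambda>((i, n), \<alpha>). if \<alpha> \<in> F \<and> N \<le> n then Some (node i \<alpha> n) else None)"

definition sep :: "'a set \<Rightarrow> nat \<Rightarrow> bool"
  where "sep F N \<longleftrightarrow> inj_on (code F N) (dom (code F N))"

text \<open>The partial inverse of \<open>code F N\<close>, unambiguous under
  \<open>sep F N\<close>: \<open>pull (code F N)\<close> leads from the nodes to the tensor product,
  \<open>pull (decode F N)\<close> leads back.\<close>

definition decode :: "'a set \<Rightarrow> nat \<Rightarrow> nat \<Rightarrow> ((bool \<times> nat) \<times> 'a) option"
  where "decode F N j = (if \<exists>p. code F N p = Some j then Some (SOME p. code F N p = Some j) else None)"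

definition Lift :: "'a set \<Rightarrow> nat \<Rightarrow> 'a op \<Rightarrow> nat op"
  where "Lift F N x = pull (decode F N) o\<^sub>L op_tensor id_blinfun x o\<^sub>L pull (code F N)"

lemma inj_node: "inj (node i \<alpha>)"
  by (auto intro: injI dest: node_level)

lemma decode_iff_code:
  assumes "sep F N"
  shows "decode F N j = Some p \<longleftrightarrow> code F N p = Some j"
proof
  assume "decode F N j = Some p"
  then show "code F N p = Some j"
    by (auto simp: decode_def split: if_splits intro: someI)
next
  assume *: "code F N p = Some j"
  then have "code F N (SOME p. code F N p = Some j) = Some j" by (rule someI)
  then have "(SOME p. code F N p = Some j) = p"
    using assms * unfolding sep_def inj_on_def by (metis domI)
  then show "decode F N j = Some p" using * by (metis decode_def)
qed

lemma decode_iff: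
  assumes "sep F N"
  shows "decode F N j = Some ((i, n), \<alpha>) \<longleftrightarrow> \<alpha> \<in> F \<and> N \<le> n \<and> j = node i \<alpha> n"
  by (auto simp: decode_iff_code[OF assms] code_def)

lemma inj_decode: "sep F N \<Longrightarrow> inj_on (decode F N) (dom (decode F N))"
  by (rule inj_onI) (metis decode_iff_code domD option.inject)

lemma inj_code: "sep F N \<Longrightarrow> inj_on (code F N) (dom (code F N))"
  by (simp add: sep_def)

lemma coord_Lift:
  assumes "sep F N" "x \<in> bounded_ops"
  shows "coord (Lift F N x u) j = (case decode F N j of None \<Rightarrow> 0
    | Some (k, \<beta>) \<Rightarrow> coord (x (ell2_row (pull (code F N) u) k)) \<beta>)"
  by (simp add: Lift_def coord_pull[OF inj_decode[OF assms(1)]] split: option.splits)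
    (metis assms(2) coord_row ell2_row_op_tensor_id)

lemma row_code:
  assumes "sep F N"
  shows "coord (ell2_row (pull (code F N) u) (i, n)) \<alpha> =
    (if \<alpha> \<in> F \<and> N \<le> n then coord u (node i \<alpha> n) else 0)"
  by (simp add: coord_pull[OF inj_code[OF assms]]) (simp add: code_def)

text \<open>The way back through the nodes keeps only indices in \<open>F\<close> and levels from
  \<open>N\<close> on, which explains the factor \<open>proj F\<close> and the value 0.\<close>

lemma row_code_Lift:
  assumes "sep F N" "x \<in> bounded_ops"
  shows "ell2_row (pull (code F N) (Lift F N x u)) (i, n) =
    (if N \<le> n then proj F (x (ell2_row (pull (code F N) u) (i, n))) else 0)"
proof (rule ell2_eqI)
  fix \<alpha>
  show "coord (ell2_row (pull (code F N) (Lift F N x u)) (i, n)) \<alpha> =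
    coord (if N \<le> n then proj F (x (ell2_row (pull (code F N) u) (i, n))) else 0) \<alpha>"
  proof (cases "\<alpha> \<in> F \<and> N \<le> n")
    case True
    then have "decode F N (node i \<alpha> n) = Some ((i, n), \<alpha>)"
      using decode_iff[OF assms(1)] by blast
    then show ?thesis using True by (simp add: row_code[OF assms(1)] coord_Lift[OF assms] del: coord_row)
  qed (auto simp: row_code[OF assms(1)] simp del: coord_row)
qed

lemma Lift_bounded_ops:
  assumes "sep F N" "x \<in> bounded_ops"
  shows "Lift F N x \<in> bounded_ops"
  using assms by (simp add: bounded_ops_def[of] Lift_def pull_scaleC inj_code inj_decode
      bounded_opsD[OF op_tensor_bounded_ops])

lemma Lift_add:
  assumes "sep F N" "x \<in> bounded_ops" "y \<in> bounded_ops"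
  shows "Lift F N (x + y) = Lift F N x + Lift F N y"
  by (intro blinfun_eqI ell2_eqI)
    (auto simp: coord_Lift assms bounded_ops_closed blinfun.add_left split: option.splits)

lemma Lift_scaleC:
  assumes "sep F N" "x \<in> bounded_ops"
  shows "Lift F N (scaleC_op c x) = scaleC_op c (Lift F N x)"
  by (intro blinfun_eqI ell2_eqI)
    (auto simp: coord_Lift assms scaleC_op_bounded_ops split: option.splits)

text \<open>Between the two lifts the vectors are cut to the coordinates in \<open>F\<close>; the
  condition on \<open>y\<close> makes this cut harmless.\<close>

lemma Lift_compose:
  assumes "sep F N" "x \<in> bounded_ops" "y \<in> bounded_ops" and y: "proj F o\<^sub>L y = y"
  shows "Lift F N (x o\<^sub>L y) = Lift F N x o\<^sub>L Lift F N y"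
proof (intro blinfun_eqI ell2_eqI)
  fix u j
  have y': "proj F (y v) = y v" for v using y by (metis blinfun_apply_blinfun_compose)
  show "coord (Lift F N (x o\<^sub>L y) u) j = coord ((Lift F N x o\<^sub>L Lift F N y) u) j"
  proof (cases "decode F N j")
    case (Some p)
    then obtain i n \<alpha> where p: "decode F N j = Some ((i, n), \<alpha>)" by (metis prod.exhaust)
    then have "N \<le> n" using decode_iff[OF assms(1)] by blast
    then show ?thesis
      by (simp add: coord_Lift assms bounded_ops_closed p row_code_Lift y')
  qed (simp add: coord_Lift assms bounded_ops_closed)
qed

lemma norm_Lift_le:
  assumes "sep F N" "x \<in> bounded_ops"
  shows "norm (Lift F N x) \<le> norm x"
proof (rule norm_blinfun_bound)
  fix u
  have "norm (Lift F N x u) \<le> norm (op_tensor (id_blinfun :: (bool \<times> nat) op) x (pull (code F N) u))"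
    by (simp add: Lift_def norm_pull_le[OF inj_decode[OF assms(1)]])
  also have "\<dots> \<le> norm (op_tensor (id_blinfun :: (bool \<times> nat) op) x) * norm (pull (code F N) u)"
    by (rule norm_blinfun)
  also have "\<dots> \<le> norm x * norm u"
    by (intro mult_mono norm_op_tensor_id_le assms norm_pull_le inj_code) auto
  finally show "norm (Lift F N x u) \<le> norm x * norm u" .
qed simp

lemma row_code_ket:
  assumes "sep F N"
  shows "ell2_row (pull (code F N) (ket j)) k = (case decode F N j of None \<Rightarrow> 0
    | Some (k', \<alpha>) \<Rightarrow> if k' = k then ket \<alpha> else 0)"
proof (rule ell2_eqI)
  fix \<beta>
  obtain i n where k: "k = (i, n)" by (cases k)
  show "coord (ell2_row (pull (code F N) (ket j)) k) \<beta> = coord (case decode F N j of None \<Rightarrow> 0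
    | Some (k', \<alpha>) \<Rightarrow> if k' = k then ket \<alpha> else 0) \<beta>"
  proof (cases "\<beta> \<in> F \<and> N \<le> n \<and> node i \<beta> n = j")
    case True
    then have "decode F N j = Some ((i, n), \<beta>)" using decode_iff[OF assms] by blast
    then show ?thesis using True by (simp add: k row_code[OF assms] del: coord_row)
  next
    case False
    then have "decode F N j \<noteq> Some ((i, n), \<beta>)" by (auto simp: decode_iff[OF assms])
    then show ?thesis using False by (auto simp: k row_code[OF assms] simp del: coord_row split: option.splits)
  qed
qed

lemma coord_Lift_ket:
  assumes "sep F N" "x \<in> bounded_ops"
  shows "coord (Lift F N x (ket j')) j = (case decode F N j of None \<Rightarrow> 0
    | Some (k, \<beta>) \<Rightarrow> case decode F N j' of None \<Rightarrow> 0
      | Some (k', \<alpha>) \<Rightarrow> if k' = k then coord (x (ket \<alpha>)) \<beta> else 0)"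
  by (auto simp: coord_Lift[OF assms] row_code_ket[OF assms(1)] split: option.splits)

lemma coord_Lift_node:
  assumes "sep F N" "x \<in> bounded_ops" "\<alpha> \<in> F" "\<beta> \<in> F" "N \<le> n"
  shows "coord (Lift F N x (ket (node i \<alpha> n))) (node i' \<beta> n) =
    (if i = i' then coord (x (ket \<alpha>)) \<beta> else 0)"
proof -
  have "decode F N (node i \<alpha> n) = Some ((i, n), \<alpha>)" "decode F N (node i' \<beta> n) = Some ((i', n), \<beta>)"
    using decode_iff[OF assms(1)] assms by blast+
  then show ?thesis by (simp add: coord_Lift_ket assms(1,2))
qed

lemma adj_Lift:
  assumes "sep F N" "x \<in> bounded_ops"
  shows "adj (Lift F N x) = Lift F N (adj x)"
  by (rule op_eq_on_kets; (intro ell2_eqI)?)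
    (auto simp: assms Lift_bounded_ops adj_bounded_ops coord_adj_ket coord_Lift_ket split: option.splits)

text \<open>Since \<open>x\<close> lives on \<open>F\<close>, the additional branches contribute
  nothing, and from level \<open>N'\<close> on the lifts agree. They can differ only on the finitely
  many basis vectors at nodes of level below \<open>N'\<close> over \<open>F\<close>.\<close>

lemma Lift_diff_compact:
  assumes s: "sep F N" "sep F' N'" and F: "finite F" "F \<subseteq> F'" "N \<le> N'"
    and x: "x \<in> bounded_ops" "proj F o\<^sub>L x o\<^sub>L proj F = x"
  shows "Lift F N x - Lift F' N' x \<in> compact_ops"
proof (rule compact_ops_finite_kets)
  let ?D = "(\<lambda>(i, \<alpha>, n). node i \<alpha> n) ` (UNIV \<times> F \<times> {..<N'})"
  show "finite ?D" using F by simp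
  show "Lift F N x - Lift F' N' x \<in> bounded_ops"
    by (intro bounded_ops_diff Lift_bounded_ops s x)
  have x0: "x (ket \<alpha>) = 0" if "\<alpha> \<notin> F" for \<alpha>
    using arg_cong[OF x(2), of "\<lambda>y. y (ket \<alpha>)"] that by (simp add: proj_ket)
  have x1: "coord (x v) \<alpha> = 0" if "\<alpha> \<notin> F" for \<alpha> v
    using arg_cong[OF x(2), of "\<lambda>y. coord (y v) \<alpha>"] that by simp
  fix j' assume j': "j' \<notin> ?D"
  have "coord (Lift F N x (ket j')) j = coord (Lift F' N' x (ket j')) j" for j
  proof -
    have dec: "decode F' N' l = Some ((i, n), \<alpha>)" if "decode F N l = Some ((i, n), \<alpha>)" "N' \<le> n" for l i n \<alpha>
      using that F decode_iff[OF s(1)] decode_iff[OF s(2)] by blast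
    have dec': "decode F N l = Some ((i, n), \<alpha>)" if "decode F' N' l = Some ((i, n), \<alpha>)" "\<alpha> \<in> F" for l i n \<alpha>
      using that F decode_iff[OF s(1)] decode_iff[OF s(2)] by (meson order_trans)
    have big: "N' \<le> n" if "decode F N j' = Some ((i, n), \<alpha>)" for i n \<alpha>
      using that j' decode_iff[OF s(1)] by force
    show ?thesis
    proof (cases "decode F N j'")
      case None
      have "\<alpha> \<notin> F" if "decode F' N' j' = Some ((i, n), \<alpha>)" for i n \<alpha>
        using dec'[OF that] None by auto
      then show ?thesis
        using None by (auto simp: coord_Lift_ket s x x0 split: option.splits)
    next
      case (Some p)
      then obtain i n \<alpha> where 1: "decode F N j' = Some ((i, n), \<alpha>)" by (metis prod.exhaust)
      then have 2: "decode F' N' j' = Some ((i, n), \<alpha>)" by (intro dec big)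
      have 3: "decode F N j = Some ((i, n), \<beta>)" if "decode F' N' j = Some ((i, n), \<beta>)" "\<beta> \<in> F" for \<beta>
        using that by (rule dec')
      have 4: "decode F' N' j = Some ((i, n), \<beta>)" if "decode F N j = Some ((i, n), \<beta>)" for \<beta>
        using that big[OF 1] by (rule dec)
      show ?thesis
      proof (cases "\<exists>\<beta>. decode F N j = Some ((i, n), \<beta>)")
        case True
        then show ?thesis using 4 by (auto simp: coord_Lift_ket s x 1 2)
      next
        case False
        then have "\<beta> \<notin> F" if "decode F' N' j = Some ((i, n), \<beta>)" for \<beta> using 3 that by blast
        then show ?thesis using False
          by (auto simp: coord_Lift_ket s x 1 2 x1 split: option.splits)
      qed
    qed
  qed
  then show "(Lift F N x - Lift F' N' x) (ket j') = 0"
    by (intro ell2_eqI) (simp add: minus_blinfun.rep_eq)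
qed

lemma sep_mono: "sep F N \<Longrightarrow> N \<le> N' \<Longrightarrow> sep F N'"
  unfolding sep_def inj_on_def dom_def code_def by (auto split: if_splits) (metis order_trans)+

text \<open>Finitely many branches are pairwise distinct beyond the largest of their splitting
  levels, and nodes of different levels never coincide.\<close>

lemma sep_ex:
  assumes F: "finite F"
  obtains N where "sep F N"
proof -
  define I where "I = (UNIV :: bool set) \<times> F"
  have "\<forall>p q. \<exists>N. p \<noteq> q \<longrightarrow> (\<forall>n\<ge>N. case_prod node p n \<noteq> case_prod node q n)"
    using node_split by (simp add: split_paired_all)
  then obtain f where "\<forall>p q. p \<noteq> q \<longrightarrow> (\<forall>n\<ge>f p q. case_prod node p n \<noteq> case_prod node q n)"
    by metis
  then have f: "p \<noteq> q \<Longrightarrow> n \<ge> f p q \<Longrightarrow> case_prod node p n \<noteq> case_prod node q n" for p q n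
    by blast
  \<comment> \<open>The inserted 0 gives \<open>Max\<close> a nonempty set when \<open>F\<close> is
    empty.\<close>
  define N where "N = Max (insert 0 ((\<lambda>(p, q). f p q) ` (I \<times> I)))"
  have fin: "finite (insert 0 ((\<lambda>(p, q). f p q) ` (I \<times> I)))" using F by (simp add: I_def)
  have N: "f p q \<le> N" if "p \<in> I" "q \<in> I" for p q
    unfolding N_def by (rule Max_ge[OF fin]) (use that in force)
  have "sep F N"
    unfolding sep_def
  proof (rule inj_onI)
    fix p q assume p: "p \<in> dom (code F N)" and q: "q \<in> dom (code F N)" and eq: "code F N p = code F N q"
    obtain i n \<alpha> where p': "p = ((i, n), \<alpha>)" by (metis prod.exhaust)
    obtain j m \<beta> where q': "q = ((j, m), \<beta>)" by (metis prod.exhaust)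
    have *: "\<alpha> \<in> F" "\<beta> \<in> F" "N \<le> n" "N \<le> m" "node i \<alpha> n = node j \<beta> m"
      using p q eq by (auto simp: p' q' code_def split: if_splits)
    then have "n = m" using node_level by blast
    moreover have "(i, \<alpha>) = (j, \<beta>)"
    proof (rule ccontr)
      assume "(i, \<alpha>) \<noteq> (j, \<beta>)"
      moreover have "f (i, \<alpha>) (j, \<beta>) \<le> n" using N[of "(i, \<alpha>)" "(j, \<beta>)"] * by (simp add: I_def)
      ultimately show False using f[of "(i, \<alpha>)" "(j, \<beta>)" n] * \<open>n = m\<close> by simp
    qed
    ultimately show "p = q" by (simp add: p' q')
  qed
  then show ?thesis by (rule that)
qed

end

section \<open>The extension\<close>

lemma tendsto_adj:
  assumes "\<And>n. X n \<in> bounded_ops" "X \<longlonglongrightarrow> T"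
  shows "(\<lambda>n. adj (X n)) \<longlonglongrightarrow> adj T"
proof -
  have T: "T \<in> bounded_ops" by (rule closed_sequentially[OF closed_bounded_ops assms])
  have "(\<lambda>n. norm (X n - T)) \<longlonglongrightarrow> 0"
    using assms(2) by (simp add: tendsto_norm_zero_iff LIM_zero_iff)
  also have "(\<lambda>n. norm (X n - T)) = (\<lambda>n. norm (adj (X n) - adj T))"
    by (metis adj_diff assms(1) T norm_adj bounded_ops_diff)
  finally show ?thesis by (simp add: tendsto_norm_zero_iff LIM_zero_iff)
qed

lemma tendsto_compose: "X \<longlonglongrightarrow> S \<Longrightarrow> Y \<longlonglongrightarrow> T \<Longrightarrow> (\<lambda>n. X n o\<^sub>L Y n) \<longlonglongrightarrow> (S o\<^sub>L T)"
  by (rule bounded_bilinear.tendsto[OF bounded_bilinear_blinfun_compose])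

lemma tendsto_scaleC_op: "X \<longlonglongrightarrow> T \<Longrightarrow> (\<lambda>n. scaleC_op c (X n)) \<longlonglongrightarrow> scaleC_op c T"
  unfolding scaleC_op_def by (intro tendsto_compose tendsto_const)

lemma op_compose_assoc: "(a o\<^sub>L b) o\<^sub>L c = a o\<^sub>L (b o\<^sub>L c)"
  by (rule blinfun_eqI) simp

lemma scaleC_op_minus_one: "scaleC_op (-1) T = - T"
  by (auto intro!: blinfun_eqI ell2_eqI simp: uminus_blinfun.rep_eq)

lemma norm_sum_kets:
  assumes "finite F" "inj_on g F"
  shows "(norm (\<Sum>\<beta>\<in>F. scaleC (c \<beta>) (ket (g \<beta>))))\<^sup>2 = (\<Sum>\<beta>\<in>F. (cmod (c \<beta>))\<^sup>2)"
proof -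
  define d where "d j = c (inv_into F g j)" for j
  have d: "d (g \<beta>) = c \<beta>" if "\<beta> \<in> F" for \<beta> using assms that by (simp add: d_def)
  define u where "u = (\<Sum>\<beta>\<in>F. scaleC (c \<beta>) (ket (g \<beta>)))"
  have "u = (\<Sum>\<beta>\<in>F. scaleC (d (g \<beta>)) (ket (g \<beta>)))"
    unfolding u_def by (rule sum.cong) (simp_all add: d)
  also have "\<dots> = (\<Sum>j\<in>g ` F. scaleC (d j) (ket j))"
    using sum.reindex[OF assms(2), of "\<lambda>j. scaleC (d j) (ket j)"] by (simp add: o_def)
  finally have u: "u = (\<Sum>j\<in>g ` F. scaleC (d j) (ket j))" .
  have "((\<lambda>j. (cmod (coord u j))\<^sup>2) has_sum (\<Sum>j\<in>g ` F. (cmod (d j))\<^sup>2)) UNIV"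
    by (rule has_sum_finite_neutralI[of "g ` F"]) (auto simp: u coord_ket_sum assms(1))
  then have "(norm u)\<^sup>2 = (\<Sum>j\<in>g ` F. (cmod (d j))\<^sup>2)"
    using has_sum_unique[OF norm_ell2_has_sum] by blast
  also have "\<dots> = (\<Sum>\<beta>\<in>F. (cmod (d (g \<beta>)))\<^sup>2)"
    using sum.reindex[OF assms(2), of "\<lambda>j. (cmod (d j))\<^sup>2"] by (simp add: o_def)
  also have "\<dots> = (\<Sum>\<beta>\<in>F. (cmod (c \<beta>))\<^sup>2)" by (rule sum.cong) (simp_all add: d)
  finally show ?thesis by (simp add: u_def)
qed

lemma norm_ell2_row_le: "norm (ell2_row u k) \<le> norm u"
  unfolding ell2_row_eq_pull by (rule norm_pull_le) (auto simp: inj_on_def)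

section \<open>The graph of the quotient map: star-algebra operations, norm bound, kernel and
  range\<close>

context branches
begin

text \<open>The parameters \<open>F\<close> and \<open>N\<close> stay visible so that two pairs can
  be brought to common ones, for which lifting is exactly additive and multiplicative.\<close>

definition approx :: "'a set \<Rightarrow> nat \<Rightarrow> 'a op \<Rightarrow> nat op \<Rightarrow> bool"
  where "approx F N x a \<longleftrightarrow> finite F \<and> sep F N \<and> x \<in> bounded_ops \<and>
    proj F o\<^sub>L x o\<^sub>L proj F = x \<and> a - Lift F N x \<in> compact_ops"

text \<open>The closure of \<open>fin_lifts\<close> turns out to be the graph of the quotient map.\<close>

definition fin_lifts :: "(nat op \<times> 'a op) set"
  where "fin_lifts = {(a, x). \<exists>F N. approx F N x a}"

definition lifts :: "(nat op \<times> 'a op) set"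
  where "lifts = closure fin_lifts"

lemma approx_proj:
  assumes "approx F N x a" "F \<subseteq> G"
  shows "proj G o\<^sub>L x = x" "x o\<^sub>L proj G = x"
proof -
  have x: "proj F o\<^sub>L x o\<^sub>L proj F = x" using assms by (simp add: approx_def)
  have *: "proj F (x (proj F v)) = x v" for v using x by (metis blinfun_apply_blinfun_compose)
  have G: "proj G (proj F v) = proj F v" "proj F (proj G v) = proj F v" for v
    using assms(2) by (simp_all add: proj_proj Int_absorb1 Int_absorb2)
  show "proj G o\<^sub>L x = x"
    by (rule blinfun_eqI) (metis * G blinfun_apply_blinfun_compose)
  show "x o\<^sub>L proj G = x"
    by (rule blinfun_eqI) (metis * G blinfun_apply_blinfun_compose)
qed

text \<open>Larger parameters change the lift by a compact operator, which is absorbed into the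
  perturbation.\<close>

lemma approx_enlarge:
  assumes a: "approx F N x a" and G: "finite G" "F \<subseteq> G" "N \<le> M" "sep G M"
  shows "approx G M x a"
proof -
  have x: "x \<in> bounded_ops" "proj F o\<^sub>L x o\<^sub>L proj F = x" "finite F" "sep F N"
    "a - Lift F N x \<in> compact_ops"
    using a by (auto simp: approx_def)
  have "(a - Lift F N x) + (Lift F N x - Lift G M x) \<in> compact_ops"
    by (intro compact_ops_add x Lift_diff_compact G)
  then show ?thesis
    using approx_proj[OF a G(2)] x G by (simp add: approx_def)
qed

text \<open>The prescribed set \<open>G\<close> places given indices inside the common
  \<open>F\<close>, as reading off matrix entries requires.\<close>

lemma fin_lifts_common:
  assumes "(a, x) \<in> fin_lifts" "(b, y) \<in> fin_lifts" "finite G"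
  obtains F N where "G \<subseteq> F" "approx F N x a" "approx F N y b"
proof -
  obtain F N where 1: "approx F N x a" using assms by (auto simp: fin_lifts_def)
  obtain F' N' where 2: "approx F' N' y b" using assms by (auto simp: fin_lifts_def)
  define H where "H = F \<union> F' \<union> G"
  have H: "finite H" using 1 2 assms by (simp add: H_def approx_def)
  obtain M where M: "sep H M" using sep_ex[OF H] by blast
  define K where "K = Max {M, N, N'}"
  have K: "M \<le> K" "N \<le> K" "N' \<le> K" by (simp_all add: K_def)
  have "sep H K" using sep_mono[OF M K(1)] .
  then show ?thesis
    using that[of H K] approx_enlarge[OF 1 H] approx_enlarge[OF 2 H] K by (auto simp: H_def)
qed

lemma approx_bounded: "approx F N x a \<Longrightarrow> a \<in> bounded_ops"
  using bounded_ops_closed(1)[of "a - Lift F N x" "Lift F N x"]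
  by (simp add: approx_def compact_ops_bounded Lift_bounded_ops)

lemma fin_lifts_bounded: "(a, x) \<in> fin_lifts \<Longrightarrow> a \<in> bounded_ops \<and> x \<in> compact_ops"
proof -
  assume "(a, x) \<in> fin_lifts"
  then obtain F N where a: "approx F N x a" by (auto simp: fin_lifts_def)
  then have "proj F o\<^sub>L x \<in> compact_ops"
    unfolding approx_def by (blast intro: compact_ops_compose_right compact_ops_proj)
  then show ?thesis using approx_proj[OF a order_refl] approx_bounded[OF a] by simp
qed

lemma fin_lifts_add:
  assumes "(a, x) \<in> fin_lifts" "(b, y) \<in> fin_lifts"
  shows "(a + b, x + y) \<in> fin_lifts"
proof -
  obtain F N where 1: "approx F N x a" and 2: "approx F N y b"
    using fin_lifts_common[OF assms finite.emptyI] by blast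
  have "(a - Lift F N x) + (b - Lift F N y) \<in> compact_ops"
    using 1 2 by (intro compact_ops_add) (auto simp: approx_def)
  also have "(a - Lift F N x) + (b - Lift F N y) = (a + b) - Lift F N (x + y)"
    using 1 2 by (simp add: Lift_add approx_def)
  finally have "(a + b) - Lift F N (x + y) \<in> compact_ops" .
  moreover have "proj F o\<^sub>L (x + y) o\<^sub>L proj F = (proj F o\<^sub>L x o\<^sub>L proj F) + (proj F o\<^sub>L y o\<^sub>L proj F)"
    by (rule blinfun_eqI) (simp add: blinfun.add_left blinfun.add_right)
  ultimately have "approx F N (x + y) (a + b)"
    using 1 2 by (simp add: approx_def bounded_ops_closed)
  then show ?thesis by (auto simp: fin_lifts_def)
qed

lemma scaleC_op_compose:
  "scaleC_op c S o\<^sub>L T = scaleC_op c (S o\<^sub>L T)"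
  "S \<in> bounded_ops \<Longrightarrow> S o\<^sub>L scaleC_op c T = scaleC_op c (S o\<^sub>L T)"
  by (auto intro!: blinfun_eqI simp: bounded_opsD)

lemma scaleC_op_diff: "scaleC_op c (S - T) = scaleC_op c S - scaleC_op c T"
  by (auto intro!: blinfun_eqI ell2_eqI simp: blinfun.diff_left right_diff_distrib)

lemma fin_lifts_scaleC:
  assumes "(a, x) \<in> fin_lifts"
  shows "(scaleC_op c a, scaleC_op c x) \<in> fin_lifts"
proof -
  obtain F N where 1: "approx F N x a" using assms by (auto simp: fin_lifts_def)
  have "scaleC_op c (a - Lift F N x) \<in> compact_ops"
    using 1 by (intro compact_ops_scaleC) (auto simp: approx_def)
  then have "approx F N (scaleC_op c x) (scaleC_op c a)"
    using 1 by (simp add: approx_def scaleC_op_bounded_ops Lift_scaleC scaleC_op_compose scaleC_op_diff)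
  then show ?thesis by (auto simp: fin_lifts_def)
qed

lemma fin_lifts_adj:
  assumes "(a, x) \<in> fin_lifts"
  shows "(adj a, adj x) \<in> fin_lifts"
proof -
  obtain F N where 1: "approx F N x a" using assms by (auto simp: fin_lifts_def)
  note [simp] = approx_bounded[OF 1]
  have [simp]: "x \<in> bounded_ops" "sep F N" using 1 by (auto simp: approx_def)
  have "adj (a - Lift F N x) \<in> compact_ops"
    using 1 by (intro compact_ops_adj) (auto simp: approx_def)
  moreover have "adj (proj F o\<^sub>L x o\<^sub>L proj F) = proj F o\<^sub>L adj x o\<^sub>L proj F"
    by (simp add: adj_compose bounded_ops_closed op_compose_assoc)
  then have "proj F o\<^sub>L adj x o\<^sub>L proj F = adj x"
    using 1 by (simp add: approx_def)
  ultimately have "approx F N (adj x) (adj a)"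
    using 1 by (simp add: approx_def adj_bounded_ops adj_diff Lift_bounded_ops adj_Lift)
  then show ?thesis by (auto simp: fin_lifts_def)
qed

lemma fin_lifts_compose:
  assumes "(a, x) \<in> fin_lifts" "(b, y) \<in> fin_lifts"
  shows "(a o\<^sub>L b, x o\<^sub>L y) \<in> fin_lifts"
proof -
  obtain F N where 1: "approx F N x a" and 2: "approx F N y b"
    using fin_lifts_common[OF assms finite.emptyI] by blast
  have b: "x \<in> bounded_ops" "y \<in> bounded_ops" "sep F N" "a \<in> bounded_ops" "b \<in> bounded_ops"
    using 1 2 approx_bounded by (auto simp: approx_def)
  have "(a o\<^sub>L (b - Lift F N y)) + ((a - Lift F N x) o\<^sub>L Lift F N y) \<in> compact_ops"
    using 1 2 b unfolding approx_def
    by (intro compact_ops_add compact_ops_compose_left compact_ops_compose_right Lift_bounded_ops) auto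
  also have "(a o\<^sub>L (b - Lift F N y)) + ((a - Lift F N x) o\<^sub>L Lift F N y) =
      (a o\<^sub>L b) - (Lift F N x o\<^sub>L Lift F N y)"
    by (rule blinfun_eqI) (simp add: blinfun.add_left blinfun.diff_left blinfun.diff_right)
  also have "Lift F N x o\<^sub>L Lift F N y = Lift F N (x o\<^sub>L y)"
    by (rule Lift_compose[symmetric]) (use b approx_proj[OF 2] in auto)
  finally have "(a o\<^sub>L b) - Lift F N (x o\<^sub>L y) \<in> compact_ops" .
  moreover have "proj F o\<^sub>L (x o\<^sub>L y) o\<^sub>L proj F = x o\<^sub>L y"
    using approx_proj[OF 1 order_refl] approx_proj[OF 2 order_refl]
    by (metis op_compose_assoc)
  ultimately have "approx F N (x o\<^sub>L y) (a o\<^sub>L b)"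
    using 1 b by (simp add: approx_def bounded_ops_closed)
  then show ?thesis by (auto simp: fin_lifts_def)
qed

lemma inj_on_node: "sep F N \<Longrightarrow> N \<le> n \<Longrightarrow> inj_on (\<lambda>\<beta>. node i \<beta> n) F"
proof (rule inj_onI)
  fix \<alpha> \<beta> assume s: "sep F N" "N \<le> n" "\<alpha> \<in> F" "\<beta> \<in> F" "node i \<alpha> n = node i \<beta> n"
  then have "decode F N (node i \<alpha> n) = Some ((i, n), \<alpha>)" "decode F N (node i \<alpha> n) = Some ((i, n), \<beta>)"
    by (auto simp: decode_iff)
  then show "\<alpha> = \<beta>" by simp
qed

text \<open>\<open>Lift F N x\<close> acts as \<open>x\<close> on the copy of \<open>F\<close> at level \<open>n\<close>, where a compact perturbation vanishes as
  \<open>n\<close> grows.\<close>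

lemma fin_lifts_norm:
  assumes "(a, x) \<in> fin_lifts"
  shows "norm x \<le> norm a"
proof -
  obtain F N where 1: "approx F N x a" using assms by (auto simp: fin_lifts_def)
  have F: "finite F" and s: "sep F N" and x: "x \<in> bounded_ops" and K: "a - Lift F N x \<in> compact_ops"
    using 1 by (auto simp: approx_def)
  have x': "proj F (x (proj F v)) = x v" for v
    using 1 by (metis approx_def blinfun_apply_blinfun_compose)
  show ?thesis
  proof (rule norm_blinfun_bound)
    fix v :: "'a ell2"
    define \<Psi> where "\<Psi> n = (\<Sum>\<beta>\<in>F. scaleC (coord v \<beta>) (ket (node True \<beta> n)))" for n
    have norm\<Psi>: "norm (\<Psi> n) \<le> norm v" if "N \<le> n" for n
    proof (rule power2_le_imp_le)
      have "(norm (\<Psi> n))\<^sup>2 = (\<Sum>\<beta>\<in>F. (cmod (coord v \<beta>))\<^sup>2)"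
        unfolding \<Psi>_def by (rule norm_sum_kets[OF F inj_on_node[OF s that]])
      also have "\<dots> \<le> (norm v)\<^sup>2"
        by (rule finite_sum_le_has_sum[OF norm_ell2_has_sum]) (use F in auto)
      finally show "(norm (\<Psi> n))\<^sup>2 \<le> (norm v)\<^sup>2" .
    qed simp
    have row\<Psi>: "ell2_row (pull (code F N) (\<Psi> n)) (True, n) = proj F v" if "N \<le> n" for n
    proof (rule ell2_eqI)
      fix \<gamma>
      have "coord (\<Psi> n) (node True \<gamma> n) = coord v \<gamma>" if "\<gamma> \<in> F"
      proof -
        have "coord (\<Psi> n) (node True \<gamma> n) =
            (\<Sum>\<beta>\<in>F. coord v \<beta> * (if node True \<gamma> n = node True \<beta> n then 1 else 0))"
          by (simp add: \<Psi>_def coord_sum)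
        also have "\<dots> = (\<Sum>\<beta>\<in>F. if \<gamma> = \<beta> then coord v \<beta> else 0)"
          using inj_onD[OF inj_on_node[OF s \<open>N \<le> n\<close>]] that by (intro sum.cong refl) auto
        also have "\<dots> = coord v \<gamma>" using F that by simp
        finally show ?thesis .
      qed
      then show "coord (ell2_row (pull (code F N) (\<Psi> n)) (True, n)) \<gamma> = coord (proj F v) \<gamma>"
        using that by (simp add: row_code[OF s] del: coord_row)
    qed
    have bound: "norm (x v) \<le> norm a * norm v + norm ((a - Lift F N x) (\<Psi> n))" if "N \<le> n" for n
    proof -
      have "x v = ell2_row (pull (code F N) (Lift F N x (\<Psi> n))) (True, n)"
        using that by (simp add: row_code_Lift s x row\<Psi> x')
      then have "norm (x v) \<le> norm (pull (code F N) (Lift F N x (\<Psi> n)))"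
        by (simp add: norm_ell2_row_le)
      also have "\<dots> \<le> norm (Lift F N x (\<Psi> n))" by (rule norm_pull_le[OF inj_code[OF s]])
      also have "Lift F N x (\<Psi> n) = a (\<Psi> n) - (a - Lift F N x) (\<Psi> n)"
        by (simp add: blinfun.diff_left)
      also have "norm \<dots> \<le> norm (a (\<Psi> n)) + norm ((a - Lift F N x) (\<Psi> n))"
        by (rule norm_triangle_ineq4)
      also have "norm (a (\<Psi> n)) \<le> norm a * norm v"
        by (rule order_trans[OF norm_blinfun]) (simp add: mult_left_mono norm\<Psi> that)
      finally show ?thesis by simp
    qed
    have "(\<lambda>n. (a - Lift F N x) (\<Psi> n)) \<longlonglongrightarrow> (\<Sum>\<beta>\<in>F. scaleC (coord v \<beta>) 0)"
      unfolding \<Psi>_def blinfun.sum_right bounded_opsD[OF compact_ops_bounded[OF K]]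
      by (intro tendsto_sum bounded_linear.tendsto[OF bounded_linear_scaleC]
          compact_ops_ket_tendsto[OF K] inj_node)
    also have "(\<Sum>\<beta>\<in>F. scaleC (coord v \<beta>) 0) = (0 :: nat ell2)"
      by (rule ell2_eqI) (simp add: coord_sum)
    finally have "(\<lambda>n. norm a * norm v + norm ((a - Lift F N x) (\<Psi> n))) \<longlonglongrightarrow> norm a * norm v + 0"
      by (intro tendsto_intros tendsto_norm_zero)
    then have "norm (x v) \<le> norm a * norm v + 0"
      by (rule LIMSEQ_le_const) (use bound in blast)
    then show "norm (x v) \<le> norm a * norm v" by simp
  qed simp
qed

lemma fin_lifts_compact: "k \<in> compact_ops \<Longrightarrow> (k, 0) \<in> fin_lifts"
proof -
  assume k: "k \<in> compact_ops"
  obtain N where N: "sep {} N" using sep_ex[of "{}"] by auto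
  have "norm (Lift {} N (0 :: 'a op)) \<le> 0" using norm_Lift_le[OF N, of 0] by simp
  then have "approx {} N 0 k" using k N by (auto simp: approx_def)
  then show ?thesis by (auto simp: fin_lifts_def)
qed

lemma fin_lifts_lift:
  assumes "finite F" "x \<in> bounded_ops" "proj F o\<^sub>L x o\<^sub>L proj F = x"
  obtains a where "(a, x) \<in> fin_lifts" "norm a \<le> norm x"
proof -
  obtain N where N: "sep F N" using sep_ex[OF assms(1)] .
  have "approx F N x (Lift F N x)" using assms N by (simp add: approx_def)
  then show ?thesis using that[of "Lift F N x"] norm_Lift_le[OF N assms(2)] by (auto simp: fin_lifts_def)
qed

lemma lifts_seqE:
  assumes "(a, x) \<in> lifts"
  obtains s t where "\<And>n. (s n, t n) \<in> fin_lifts" "s \<longlonglongrightarrow> a" "t \<longlonglongrightarrow> x"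
proof -
  obtain f where f: "\<And>n. f n \<in> fin_lifts" "f \<longlonglongrightarrow> (a, x)"
    using assms unfolding lifts_def closure_sequential by blast
  show ?thesis
    by (rule that[of "\<lambda>n. fst (f n)" "\<lambda>n. snd (f n)"]) (use f tendsto_fst[OF f(2)] tendsto_snd[OF f(2)] in auto)
qed

lemma lifts_seqI:
  assumes "\<And>n. (s n, t n) \<in> lifts" "s \<longlonglongrightarrow> a" "t \<longlonglongrightarrow> x"
  shows "(a, x) \<in> lifts"
proof (rule closed_sequentially[of lifts])
  show "closed lifts" by (simp add: lifts_def)
  show "(\<lambda>n. (s n, t n)) \<longlonglongrightarrow> (a, x)" by (intro tendsto_Pair assms)
qed (rule assms)

lemma fin_lifts_subset_lifts: "p \<in> fin_lifts \<Longrightarrow> p \<in> lifts"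
  unfolding lifts_def using closure_subset by blast

lemma lifts_add:
  assumes "(a, x) \<in> lifts" "(b, y) \<in> lifts"
  shows "(a + b, x + y) \<in> lifts"
proof -
  obtain s t where 1: "\<And>n. (s n, t n) \<in> fin_lifts" "s \<longlonglongrightarrow> a" "t \<longlonglongrightarrow> x" using lifts_seqE[OF assms(1)] by metis
  obtain s' t' where 2: "\<And>n. (s' n, t' n) \<in> fin_lifts" "s' \<longlonglongrightarrow> b" "t' \<longlonglongrightarrow> y" using lifts_seqE[OF assms(2)] by metis
  have "(s n + s' n, t n + t' n) \<in> lifts" for n
    by (rule fin_lifts_subset_lifts[OF fin_lifts_add[OF 1(1) 2(1)]])
  then show ?thesis
    by (rule lifts_seqI[where s="\<lambda>n. s n + s' n" and t="\<lambda>n. t n + t' n"]) (intro tendsto_add 1 2)+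
qed

lemma lifts_compose:
  assumes "(a, x) \<in> lifts" "(b, y) \<in> lifts"
  shows "(a o\<^sub>L b, x o\<^sub>L y) \<in> lifts"
proof -
  obtain s t where 1: "\<And>n. (s n, t n) \<in> fin_lifts" "s \<longlonglongrightarrow> a" "t \<longlonglongrightarrow> x" using lifts_seqE[OF assms(1)] by metis
  obtain s' t' where 2: "\<And>n. (s' n, t' n) \<in> fin_lifts" "s' \<longlonglongrightarrow> b" "t' \<longlonglongrightarrow> y" using lifts_seqE[OF assms(2)] by metis
  have "(s n o\<^sub>L s' n, t n o\<^sub>L t' n) \<in> lifts" for n
    by (rule fin_lifts_subset_lifts[OF fin_lifts_compose[OF 1(1) 2(1)]])
  then show ?thesis
    by (rule lifts_seqI[where s="\<lambda>n. s n o\<^sub>L s' n" and t="\<lambda>n. t n o\<^sub>L t' n"]) (intro tendsto_compose 1 2)+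
qed

lemma lifts_scaleC:
  assumes "(a, x) \<in> lifts"
  shows "(scaleC_op c a, scaleC_op c x) \<in> lifts"
proof -
  obtain s t where 1: "\<And>n. (s n, t n) \<in> fin_lifts" "s \<longlonglongrightarrow> a" "t \<longlonglongrightarrow> x" using lifts_seqE[OF assms] by metis
  have "(scaleC_op c (s n), scaleC_op c (t n)) \<in> lifts" for n
    by (rule fin_lifts_subset_lifts[OF fin_lifts_scaleC[OF 1(1)]])
  then show ?thesis
    by (rule lifts_seqI[where s="\<lambda>n. scaleC_op c (s n)" and t="\<lambda>n. scaleC_op c (t n)"])
      (intro tendsto_scaleC_op 1)+
qed

lemma lifts_adj:
  assumes "(a, x) \<in> lifts"
  shows "(adj a, adj x) \<in> lifts"
proof -
  obtain s t where 1: "\<And>n. (s n, t n) \<in> fin_lifts" "s \<longlonglongrightarrow> a" "t \<longlonglongrightarrow> x" using lifts_seqE[OF assms] by metis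
  have b: "s n \<in> bounded_ops" "t n \<in> bounded_ops" for n
    using fin_lifts_bounded[OF 1(1)] compact_ops_bounded by blast+
  have "(adj (s n), adj (t n)) \<in> lifts" for n
    by (rule fin_lifts_subset_lifts[OF fin_lifts_adj[OF 1(1)]])
  then show ?thesis
    by (rule lifts_seqI[where s="\<lambda>n. adj (s n)" and t="\<lambda>n. adj (t n)"])
      (intro tendsto_adj 1 b)+
qed

lemma lifts_bounded:
  assumes "(a, x) \<in> lifts"
  shows "a \<in> bounded_ops" "x \<in> compact_ops"
proof -
  obtain s t where 1: "\<And>n. (s n, t n) \<in> fin_lifts" "s \<longlonglongrightarrow> a" "t \<longlonglongrightarrow> x" using lifts_seqE[OF assms] by metis
  show "a \<in> bounded_ops"
    by (rule closed_sequentially[OF closed_bounded_ops _ 1(2)]) (use fin_lifts_bounded[OF 1(1)] in blast)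
  show "x \<in> compact_ops"
    by (rule closed_sequentially[OF closed_compact_ops _ 1(3)]) (use fin_lifts_bounded[OF 1(1)] in blast)
qed

text \<open>The bound for finite matrices passes to limits. It makes \<open>x\<close> a function of
  \<open>a\<close>, and a contractive one.\<close>

lemma lifts_norm:
  assumes "(a, x) \<in> lifts"
  shows "norm x \<le> norm a"
proof -
  obtain s t where 1: "\<And>n. (s n, t n) \<in> fin_lifts" "s \<longlonglongrightarrow> a" "t \<longlonglongrightarrow> x" using lifts_seqE[OF assms] by metis
  show ?thesis
    by (rule LIMSEQ_le[OF tendsto_norm[OF 1(3)] tendsto_norm[OF 1(2)]]) (use fin_lifts_norm[OF 1(1)] in blast)
qed

lemma lifts_diff:
  assumes "(a, x) \<in> lifts" "(b, y) \<in> lifts"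
  shows "(a - b, x - y) \<in> lifts"
  using lifts_add[OF assms(1) lifts_scaleC[OF assms(2), of "-1"]] by (simp add: scaleC_op_minus_one)

lemma lifts_unique: "(a, x) \<in> lifts \<Longrightarrow> (a, y) \<in> lifts \<Longrightarrow> x = y"
  using lifts_norm[OF lifts_diff[of a x a y]] by simp

text \<open>For approximating pairs \<open>(s n, t n)\<close>, the lift of \<open>t n\<close> is no
  larger than \<open>t n\<close>, which tends to 0. Removing it from \<open>s n\<close> leaves
  compact operators with the same limit \<open>a\<close>.\<close>

lemma lifts_kernel:
  assumes "(a, 0) \<in> lifts"
  shows "a \<in> compact_ops"
proof -
  obtain s t where 1: "\<And>n. (s n, t n) \<in> fin_lifts" "s \<longlonglongrightarrow> a" "t \<longlonglongrightarrow> 0" using lifts_seqE[OF assms] by metis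
  have "\<exists>k\<in>compact_ops. norm (s n - k) \<le> norm (t n)" for n
  proof -
    obtain F N where "approx F N (t n) (s n)" using 1(1)[of n] by (auto simp: fin_lifts_def)
    then have "s n - Lift F N (t n) \<in> compact_ops" "norm (s n - (s n - Lift F N (t n))) \<le> norm (t n)"
      by (auto simp: approx_def norm_Lift_le)
    then show ?thesis by blast
  qed
  then obtain k where k: "\<And>n. k n \<in> compact_ops" "\<And>n. norm (s n - k n) \<le> norm (t n)" by metis
  have "(\<lambda>n. norm (t n)) \<longlonglongrightarrow> 0" using 1(3) by (rule tendsto_norm_zero)
  then have "(\<lambda>n. s n - k n) \<longlonglongrightarrow> 0"
    by (rule Lim_null_comparison[rotated]) (use k in auto)
  then have "k \<longlonglongrightarrow> a" using tendsto_diff[OF 1(2), of "\<lambda>n. s n - k n" 0] by simp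
  then show ?thesis by (rule closed_sequentially[OF closed_compact_ops k(1)])
qed

text \<open>Finite cuts of \<open>x\<close> have lifts, but independently chosen lifts of successive
  cuts need not converge. Lifting the differences of the cuts without increase of norm gives an
  absolutely convergent series instead.\<close>

lemma lifts_surj:
  assumes x: "x \<in> compact_ops"
  obtains a where "(a, x) \<in> lifts"
proof -
  have bx: "x \<in> bounded_ops" using x by (rule compact_ops_bounded)
  have "\<exists>F. finite F \<and> norm (x - (proj F o\<^sub>L x o\<^sub>L proj F)) \<le> (1/2)^n" for n :: nat
    using compact_ops_approx[OF x, of "(1/2)^n"] by (metis zero_less_power half_gt_zero zero_less_one)
  then obtain F where F: "\<And>n. finite (F n)" "\<And>n :: nat. norm (x - (proj (F n) o\<^sub>L x o\<^sub>L proj (F n))) \<le> (1/2)^n"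
    by metis
  define z where "z n = proj (F n) o\<^sub>L x o\<^sub>L proj (F n)" for n
  have bz: "z n \<in> bounded_ops" for n by (simp add: z_def bounded_ops_closed bx)
  define y where "y n = z (Suc n) - z n" for n
  have "\<exists>a. (a, y n) \<in> fin_lifts \<and> norm a \<le> norm (y n)" for n
  proof -
    let ?G = "F n \<union> F (Suc n)"
    have "proj ?G o\<^sub>L y n o\<^sub>L proj ?G = y n"
      by (rule blinfun_eqI) (simp add: y_def z_def blinfun.diff_left blinfun.diff_right proj_proj
          Int_absorb1 Int_absorb2)
    moreover have "finite ?G" "y n \<in> bounded_ops" using F by (simp_all add: y_def bounded_ops_diff bz)
    ultimately show ?thesis using fin_lifts_lift by metis
  qed
  then obtain b where b: "\<And>n. (b n, y n) \<in> fin_lifts" "\<And>n. norm (b n) \<le> norm (y n)" by metis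
  obtain b0 where b0: "(b0, z 0) \<in> fin_lifts"
  proof (rule fin_lifts_lift[of "F 0" "z 0"])
    show "proj (F 0) o\<^sub>L z 0 o\<^sub>L proj (F 0) = z 0" by (rule blinfun_eqI) (simp add: z_def proj_proj)
  qed (use F bz in auto)
  have "norm (y n) \<le> 2 * (1/2)^n" for n
  proof -
    have "y n = (x - z n) - (x - z (Suc n))" by (simp add: y_def)
    also have "norm \<dots> \<le> norm (x - z n) + norm (x - z (Suc n))" by (rule norm_triangle_ineq4)
    also have "\<dots> \<le> (1/2)^n + (1/2)^(Suc n)" unfolding z_def by (intro add_mono F)
    also have "\<dots> \<le> 2 * (1/2)^n" by simp
    finally show ?thesis .
  qed
  then have nb: "norm (b n) \<le> 2 * (1/2)^n" for n using b(2) order_trans by blast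
  have sg: "summable (\<lambda>n. 2 * (1/2 :: real)^n)" by (intro summable_mult summable_geometric) simp
  have "summable b" by (rule summable_comparison_test'[OF sg, of 0 b]) (rule nb)
  then have lim: "(\<lambda>n. b0 + (\<Sum>i<n. b i)) \<longlonglongrightarrow> b0 + suminf b"
    by (intro tendsto_intros summable_LIMSEQ)
  \<comment> \<open>By telescoping, the partial sums lift the cuts \<open>z n\<close>.\<close>
  have part: "(b0 + (\<Sum>i<n. b i), z n) \<in> fin_lifts" for n
  proof (induction n)
    case (Suc n)
    then show ?case using fin_lifts_add[OF Suc b(1)[of n]] by (simp add: y_def add.assoc)
  qed (use b0 in simp)
  have "(\<lambda>n. (1/2 :: real)^n) \<longlonglongrightarrow> 0" by (rule LIMSEQ_realpow_zero) auto
  then have "(\<lambda>n. x - z n) \<longlonglongrightarrow> 0"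
    by (rule Lim_null_comparison[rotated]) (use F in \<open>auto simp: z_def\<close>)
  then have "z \<longlonglongrightarrow> x" using tendsto_diff[OF tendsto_const[of x], of "\<lambda>n. x - z n" 0] by simp
  then show ?thesis using that lifts_seqI[OF fin_lifts_subset_lifts[OF part] lim, of x] by simp
qed

lemma coord_diff_le:
  fixes S T :: "'i ell2 \<Rightarrow>\<^sub>L 'j ell2"
  shows "cmod (coord (S (ket i)) j - coord (T (ket i)) j) \<le> norm (S - T)"
proof -
  have "cmod (coord ((S - T) (ket i)) j) \<le> norm ((S - T) (ket i))" by (rule norm_coord_le)
  also have "\<dots> \<le> norm (S - T) * norm (ket i)" by (rule norm_blinfun)
  finally show ?thesis by (simp add: minus_blinfun.rep_eq)
qed

text \<open>On high levels a lift repeats the entries of a finite matrix and never mixes the two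
  kinds of branches; a compact perturbation fades along a branch; and entries are Lipschitz in the
  operator. Hence the quotient can be read off matrix entries.\<close>

lemma lifts_entry:
  assumes "(a, x) \<in> lifts"
  shows "(\<lambda>n. coord (a (ket (node i \<alpha> n))) (node i' \<beta> n)) \<longlonglongrightarrow>
    (if i = i' then coord (x (ket \<alpha>)) \<beta> else 0)"
proof -
  let ?e = "\<lambda>a n. coord (blinfun_apply a (ket (node i \<alpha> n))) (node i' \<beta> n)"
  let ?l = "\<lambda>x :: 'a op. if i = i' then coord (x (ket \<alpha>)) \<beta> else 0"
  have fin_lifts: "?e b \<longlonglongrightarrow> ?l y" if b: "(b, y) \<in> fin_lifts" for b y
  proof -
    obtain F N where F: "{\<alpha>, \<beta>} \<subseteq> F" and 1: "approx F N y b"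
      using fin_lifts_common[OF b b, of "{\<alpha>, \<beta>}"] by (metis finite.emptyI finite.insertI)
    have s: "sep F N" "y \<in> bounded_ops" and K: "b - Lift F N y \<in> compact_ops"
      using 1 by (auto simp: approx_def)
    have "(\<lambda>n. norm ((b - Lift F N y) (ket (node i \<alpha> n)))) \<longlonglongrightarrow> 0"
      by (intro tendsto_norm_zero compact_ops_ket_tendsto[OF K] inj_node)
    then have "?e (b - Lift F N y) \<longlonglongrightarrow> 0"
      by (rule Lim_null_comparison[rotated]) (rule always_eventually, rule allI, rule norm_coord_le)
    moreover have "?e (Lift F N y) \<longlonglongrightarrow> ?l y"
      by (rule tendsto_eventually, rule eventually_sequentiallyI[of N])
        (use coord_Lift_node[OF s] F in auto)
    ultimately have "(\<lambda>n. ?e (b - Lift F N y) n + ?e (Lift F N y) n) \<longlonglongrightarrow> 0 + ?l y"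
      by (rule tendsto_add)
    then show ?thesis by (simp add: minus_blinfun.rep_eq)
  qed
  show ?thesis
  proof (rule LIMSEQ_I)
    fix e :: real assume "0 < e"
    have "(a, x) \<in> closure fin_lifts" using assms by (simp add: lifts_def)
    then obtain b y where b: "(b, y) \<in> fin_lifts" "dist (b, y) (a, x) < e/3"
      unfolding closure_approachable using \<open>0 < e\<close> by (metis prod.exhaust zero_less_divide_iff zero_less_numeral)
    have d: "norm (a - b) < e/3" "norm (x - y) < e/3"
      using b(2) dist_fst_le[of "(b, y)" "(a, x)"] dist_snd_le[of "(b, y)" "(a, x)"]
      by (simp_all add: dist_norm norm_minus_commute)
    obtain M where M: "\<And>n. n \<ge> M \<Longrightarrow> norm (?e b n - ?l y) < e/3"
      using LIMSEQ_D[OF fin_lifts[OF b(1)], of "e/3"] \<open>0 < e\<close> by auto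
    have "norm (?e a n - ?l x) < e" if "n \<ge> M" for n
    proof -
      have "norm (?l y - ?l x) \<le> norm (x - y)"
        using coord_diff_le[of x \<alpha> \<beta> y] by (simp add: norm_minus_commute)
      moreover have "norm (?e a n - ?e b n) \<le> norm (a - b)" by (rule coord_diff_le)
      moreover have "?e a n - ?l x = (?e a n - ?e b n) + (?e b n - ?l y) + (?l y - ?l x)" by simp
      then have "norm (?e a n - ?l x) \<le> norm (?e a n - ?e b n) + norm (?e b n - ?l y) + norm (?l y - ?l x)"
        by (metis norm_triangle_ineq norm_triangle_mono order_refl)
      ultimately show ?thesis using M[OF that] d by linarith
    qed
    then show "\<exists>M. \<forall>n\<ge>M. norm (?e a n - ?l x) < e" by blast
  qed
qed

section \<open>The algebra, its exact sequence and the essential ideal\<close>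

definition alg :: "nat op set"
  where "alg = {a. \<exists>x. (a, x) \<in> lifts}"

definition quot :: "nat op \<Rightarrow> 'a op"
  where "quot a = (THE x. (a, x) \<in> lifts)"

lemma quot_eq: "(a, x) \<in> lifts \<Longrightarrow> quot a = x"
  unfolding quot_def by (rule the_equality) (auto intro: lifts_unique)

lemma algI: "(a, x) \<in> lifts \<Longrightarrow> a \<in> alg"
  unfolding alg_def by blast

lemma alg_iff: "a \<in> alg \<longleftrightarrow> (a, quot a) \<in> lifts"
proof
  assume "a \<in> alg"
  then obtain x where x: "(a, x) \<in> lifts" unfolding alg_def by blast
  then show "(a, quot a) \<in> lifts" by (simp only: quot_eq[OF x])
qed (rule algI)

lemma alg_bounded: "alg \<subseteq> bounded_ops"
  using lifts_bounded(1) alg_iff by blast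

lemma compact_subset_alg: "k \<in> compact_ops \<Longrightarrow> k \<in> alg" "k \<in> compact_ops \<Longrightarrow> quot k = 0"
  using fin_lifts_subset_lifts[OF fin_lifts_compact] algI quot_eq by blast+

text \<open>The quotient map is contractive, so it sends convergent sequences of \<open>alg\<close>
  to Cauchy sequences, and the limit pair stays in the closed graph.\<close>

lemma closed_alg: "closed alg"
proof (rule closed_sequential_limits[THEN iffD2], safe)
  fix s a assume s: "\<forall>n. s n \<in> alg" "s \<longlonglongrightarrow> a"
  have q: "(s n, quot (s n)) \<in> lifts" for n using s alg_iff by blast
  have "Cauchy s" using s(2) by (rule LIMSEQ_imp_Cauchy)
  have "Cauchy (\<lambda>n. quot (s n))"
    unfolding Cauchy_def
  proof safe
    fix e :: real assume "0 < e"
    then obtain M where "\<forall>m\<ge>M. \<forall>n\<ge>M. dist (s m) (s n) < e"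
      using \<open>Cauchy s\<close> unfolding Cauchy_def by blast
    then show "\<exists>M. \<forall>m\<ge>M. \<forall>n\<ge>M. dist (quot (s m)) (quot (s n)) < e"
      unfolding dist_norm using lifts_norm[OF lifts_diff[OF q q]] by (meson le_less_trans)
  qed
  then obtain x where "(\<lambda>n. quot (s n)) \<longlonglongrightarrow> x" by (auto simp: Cauchy_convergent_iff convergent_def)
  then have "(a, x) \<in> lifts" by (rule lifts_seqI[OF q s(2)])
  then show "a \<in> alg" by (rule algI)
qed

lemma cstar_algebra_alg: "cstar_algebra (op_algebra alg)"
proof (rule cstar_algebra_op_algebra[OF alg_bounded closed_alg])
  show "0 \<in> alg" by (simp add: compact_subset_alg)
  fix x y assume "x \<in> alg" "y \<in> alg"
  then have xy: "(x, quot x) \<in> lifts" "(y, quot y) \<in> lifts" by (simp_all only: alg_iff)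
  show "x + y \<in> alg" "x o\<^sub>L y \<in> alg"
    by (rule algI[OF lifts_add[OF xy]] algI[OF lifts_compose[OF xy]])+
next
  fix c x assume "x \<in> alg"
  then have x: "(x, quot x) \<in> lifts" by (simp only: alg_iff)
  show "scaleC_op c x \<in> alg" "adj x \<in> alg"
    by (rule algI[OF lifts_scaleC[OF x]] algI[OF lifts_adj[OF x]])+
qed

lemma short_exact_alg:
  "short_exact (compact_algebra :: nat op star_alg) (op_algebra alg) (compact_algebra :: 'a op star_alg) id quot"
proof -
  have "star_hom (op_algebra alg) (compact_algebra :: 'a op star_alg) quot"
    by (auto simp: star_hom_def op_algebra_def alg_iff
        intro!: quot_eq lifts_add lifts_scaleC lifts_compose lifts_adj intro: lifts_bounded(2))
  moreover have "star_hom (compact_algebra :: nat op star_alg) (op_algebra alg) id"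
    by (auto simp: star_hom_def op_algebra_def compact_subset_alg)
  moreover have "compact_ops = {a \<in> alg. quot a = 0}"
  proof safe
    fix a assume "a \<in> alg" "quot a = 0"
    then show "a \<in> compact_ops" using alg_iff[of a] lifts_kernel[of a] by simp
  qed (simp_all only: compact_subset_alg)
  moreover have "quot ` alg = compact_ops"
  proof safe
    fix x :: "'a op" assume "x \<in> compact_ops"
    then obtain a where "(a, x) \<in> lifts" by (rule lifts_surj)
    then show "x \<in> quot ` alg" by (intro image_eqI[of _ _ a]) (auto simp: quot_eq alg_iff)
  qed (auto simp: alg_iff intro: lifts_bounded(2))
  ultimately show ?thesis by (auto simp: short_exact_def op_algebra_def)
qed

text \<open>A nonzero \<open>a\<close> in an ideal does not kill every basis vector; if
  \<open>a (ket i)\<close> is nonzero, then \<open>a o\<^sub>L proj {i}\<close> is a nonzero compact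
  element of that ideal.\<close>

lemma essential_alg: "essential_ideal (op_algebra alg) compact_ops"
  unfolding essential_ideal_def
proof (intro conjI allI impI)
  show "closed_ideal (op_algebra alg) compact_ops"
    using alg_bounded closed_approachable[OF closed_compact_ops]
    by (auto simp: closed_ideal_def op_algebra_def compact_subset_alg compact_ops_add compact_ops_scaleC
        diff_of_def scaleC_op_minus_one dist_norm norm_minus_commute intro: compact_ops_compose_left compact_ops_compose_right)
  fix J assume "closed_ideal (op_algebra alg) J \<and> J \<noteq> {zero_of (op_algebra alg)}"
  then have J: "J \<subseteq> alg" "0 \<in> J" "J \<noteq> {0}" "\<And>a x. a \<in> alg \<Longrightarrow> x \<in> J \<Longrightarrow> x o\<^sub>L a \<in> J"
    by (auto simp: closed_ideal_def op_algebra_def)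
  then obtain a where a: "a \<in> J" "a \<noteq> 0" by blast
  then have ab: "a \<in> bounded_ops" using J alg_bounded by blast
  obtain i where i: "a (ket i) \<noteq> 0"
    using op_eq_on_kets[OF ab zero_bounded_ops] a(2) by auto
  have "a o\<^sub>L proj {i} \<in> J" by (intro J a compact_subset_alg compact_ops_proj_singleton)
  moreover have "a o\<^sub>L proj {i} \<in> compact_ops" by (intro compact_ops_compose_left ab compact_ops_proj_singleton)
  moreover have "(a o\<^sub>L proj {i}) (ket i) \<noteq> 0" using i by (simp add: proj_ket)
  then have "a o\<^sub>L proj {i} \<noteq> 0" by (metis blinfun.zero_left)
  ultimately show "compact_ops \<inter> J \<noteq> {zero_of (op_algebra alg)}" by (auto simp: op_algebra_def)
qed

end

section \<open>Double centralizers\<close>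

text \<open>Two matrices are treated at once because the final contradiction needs one index \<open>\<gamma>\<close> at which
  two multipliers are simultaneously scalar.\<close>

locale diagonal_branches = branches node for node :: "bool \<Rightarrow> 'a \<Rightarrow> nat \<Rightarrow> nat" +
  assumes diagonal:
    "\<lbrakk>\<And>\<alpha> \<beta>. (\<lambda>n. P (node False \<beta> n) (node True \<alpha> n)) \<longlonglongrightarrow> (0 :: complex);
      \<And>\<alpha> \<beta>. (\<lambda>n. Q (node False \<beta> n) (node True \<alpha> n)) \<longlonglongrightarrow> (0 :: complex)\<rbrakk> \<Longrightarrow>
    \<exists>\<gamma>. \<forall>\<beta>. \<beta> \<noteq> \<gamma> \<longrightarrow> (\<lambda>n. P (node False \<beta> n) (node False \<gamma> n)) \<longlonglongrightarrow> 0 \<and>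
      (\<lambda>n. Q (node False \<beta> n) (node False \<gamma> n)) \<longlonglongrightarrow> 0"
begin

text \<open>\<open>L\<close> stands for left and \<open>L'\<close> for right multiplication by one
  multiplier; the last equation is associativity around that multiplier.\<close>

definition centralizer :: "(nat op \<Rightarrow> nat op) \<Rightarrow> (nat op \<Rightarrow> nat op) \<Rightarrow> bool"
  where "centralizer L L' \<longleftrightarrow>
    (\<forall>a\<in>alg. L a \<in> alg \<and> L' a \<in> alg) \<and>
    (\<forall>a\<in>alg. \<forall>b\<in>alg. L (a + b) = L a + L b) \<and> (\<forall>c. \<forall>a\<in>alg. L (scaleC_op c a) = scaleC_op c (L a)) \<and>
    (\<forall>a\<in>alg. \<forall>b\<in>alg. L (a o\<^sub>L b) = L a o\<^sub>L b \<and> a o\<^sub>L L b = L' a o\<^sub>L b)"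

text \<open>The projection onto the tails of both branches of the pair \<open>\<gamma>\<close>, from
  a level on where these are disjoint. It lifts the rank-one projection at
  \<open>\<gamma>\<close>.\<close>

definition branch_op :: "'a \<Rightarrow> nat op"
  where "branch_op \<gamma> = Lift {\<gamma>} (SOME N. sep {\<gamma>} N) (proj {\<gamma>})"

lemma
  shows branch_op_lifts: "(branch_op \<gamma>, proj {\<gamma>}) \<in> lifts"
    and branch_op_idem: "branch_op \<gamma> o\<^sub>L branch_op \<gamma> = branch_op \<gamma>"
    and branch_op_ket: "\<exists>N. \<forall>i. \<forall>n\<ge>N. branch_op \<gamma> (ket (node i \<gamma> n)) = ket (node i \<gamma> n)"
proof -
  define N where "N = (SOME N. sep {\<gamma>} N)"
  have "\<exists>N. sep {\<gamma>} N" using sep_ex[of "{\<gamma>}"] by auto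
  then have s: "sep {\<gamma>} N" unfolding N_def by (rule someI_ex)
  have T: "branch_op \<gamma> = Lift {\<gamma>} N (proj {\<gamma>})" by (simp add: branch_op_def N_def)
  have pp: "proj {\<gamma>} o\<^sub>L proj {\<gamma>} = proj {\<gamma>}" by (rule blinfun_eqI) (simp add: proj_proj)
  have "approx {\<gamma>} N (proj {\<gamma>}) (branch_op \<gamma>)" by (simp add: approx_def s T pp)
  then show "(branch_op \<gamma>, proj {\<gamma>}) \<in> lifts" by (intro fin_lifts_subset_lifts) (auto simp: fin_lifts_def)
  show "branch_op \<gamma> o\<^sub>L branch_op \<gamma> = branch_op \<gamma>"
    unfolding T using Lift_compose[OF s _ _ pp, of "proj {\<gamma>}"] by (simp add: pp)
  have "branch_op \<gamma> (ket (node i \<gamma> n)) = ket (node i \<gamma> n)" if "N \<le> n" for i n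
  proof (rule ell2_eqI)
    fix j
    have 1: "decode {\<gamma>} N (node i \<gamma> n) = Some ((i, n), \<gamma>)" using that by (simp add: decode_iff[OF s])
    show "coord (branch_op \<gamma> (ket (node i \<gamma> n))) j = coord (ket (node i \<gamma> n)) j"
    proof (cases "j = node i \<gamma> n")
      case True
      then show ?thesis by (simp add: T coord_Lift_ket[OF s] 1 proj_ket)
    next
      case False
      then have "decode {\<gamma>} N j \<noteq> Some ((i, n), \<beta>)" for \<beta> by (auto simp: decode_iff[OF s])
      then show ?thesis using False by (auto simp: T coord_Lift_ket[OF s] 1 split: option.splits)
    qed
  qed
  then show "\<exists>N. \<forall>i. \<forall>n\<ge>N. branch_op \<gamma> (ket (node i \<gamma> n)) = ket (node i \<gamma> n)" by blast
qed

lemma branch_op_bounded: "branch_op \<gamma> \<in> bounded_ops"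
  using lifts_bounded(1)[OF branch_op_lifts] .

lemma branch_op_not_compact: "branch_op \<gamma> \<notin> compact_ops"
proof
  assume K: "branch_op \<gamma> \<in> compact_ops"
  obtain N where N: "\<And>n. n \<ge> N \<Longrightarrow> branch_op \<gamma> (ket (node True \<gamma> n)) = ket (node True \<gamma> n)"
    using branch_op_ket by blast
  have "(\<lambda>n. norm (branch_op \<gamma> (ket (node True \<gamma> n)))) \<longlonglongrightarrow> 0"
    by (intro tendsto_norm_zero compact_ops_ket_tendsto[OF K] inj_node)
  then obtain M where M: "\<And>n. n \<ge> M \<Longrightarrow> norm (branch_op \<gamma> (ket (node True \<gamma> n))) < 1"
    using LIMSEQ_D[of _ 0 1] by fastforce
  then show False using N[of "max M N"] M[of "max M N"] by simp
qed

text \<open>If \<open>L\<close> is left multiplication by an operator, this is the entry of that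
  operator in row \<open>i\<close> and column \<open>j\<close>.\<close>

definition symbol :: "(nat op \<Rightarrow> nat op) \<Rightarrow> nat \<Rightarrow> nat \<Rightarrow> complex"
  where "symbol L i j = coord (L (proj {j}) (ket j)) i"

text \<open>At high levels \<open>branch_op \<gamma>\<close> fixes the basis vector of the node
  \<open>j\<close>, whence \<open>L (proj {j}) = L (branch_op \<gamma>) o\<^sub>L proj {j}\<close>.
  The symbol there is an entry of an element of \<open>alg\<close>, whose limits are known. The
  limit 0 for \<open>i \<noteq> i'\<close> is the condition against which the pairs are
  chosen.\<close>

lemma symbol_tendsto:
  assumes L: "centralizer L L'"
  shows "(\<lambda>n. symbol L (node i' \<beta> n) (node i \<gamma> n)) \<longlonglongrightarrow>
    (if i = i' then coord (quot (L (branch_op \<gamma>)) (ket \<gamma>)) \<beta> else 0)"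
proof -
  let ?T = "branch_op \<gamma>"
  have Ta: "?T \<in> alg" by (rule algI[OF branch_op_lifts])
  then have "L ?T \<in> alg" using L by (simp add: centralizer_def)
  then have "(L ?T, quot (L ?T)) \<in> lifts" by (simp only: alg_iff)
  then have lim: "(\<lambda>n. coord (L ?T (ket (node i \<gamma> n))) (node i' \<beta> n)) \<longlonglongrightarrow>
      (if i = i' then coord (quot (L ?T) (ket \<gamma>)) \<beta> else 0)"
    by (rule lifts_entry)
  obtain N where N: "\<And>n. n \<ge> N \<Longrightarrow> ?T (ket (node i \<gamma> n)) = ket (node i \<gamma> n)"
    using branch_op_ket by blast
  have "coord (L ?T (ket (node i \<gamma> n))) (node i' \<beta> n) = symbol L (node i' \<beta> n) (node i \<gamma> n)"
    if "n \<ge> N" for n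
  proof -
    define j where "j = node i \<gamma> n"
    have pa: "proj {j} \<in> alg" by (intro compact_subset_alg compact_ops_proj_singleton)
    have "?T o\<^sub>L proj {j} = proj {j}"
      by (rule op_eq_on_kets) (use N[OF that] in \<open>auto simp: bounded_ops_closed branch_op_bounded proj_ket j_def\<close>)
    then have "L (proj {j}) = L ?T o\<^sub>L proj {j}"
      using L Ta pa unfolding centralizer_def by metis
    then show ?thesis by (simp add: symbol_def proj_ket flip: j_def)
  qed
  then show ?thesis
    by (intro Lim_transform_eventually[OF lim] eventually_sequentiallyI)
qed

text \<open>Write \<open>T\<close> for \<open>branch_op \<gamma>\<close>. As
  \<open>L T = L T o\<^sub>L T\<close>, the image of \<open>L T\<close> in the quotient is
  concentrated in column \<open>\<gamma>\<close>; the entries of this column off the diagonal are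
  limits of symbols, hence 0. What remains is a multiple of the image of \<open>T\<close>.\<close>

lemma centralizer_scalar:
  assumes L: "centralizer L L'"
    and lim: "\<And>\<beta>. \<beta> \<noteq> \<gamma> \<Longrightarrow> (\<lambda>n. symbol L (node False \<beta> n) (node False \<gamma> n)) \<longlonglongrightarrow> 0"
  obtains c where "L (branch_op \<gamma>) - scaleC_op c (branch_op \<gamma>) \<in> compact_ops"
proof -
  let ?T = "branch_op \<gamma>"
  define x where "x = quot (L ?T)"
  have Ta: "?T \<in> alg" by (rule algI[OF branch_op_lifts])
  then have "L ?T \<in> alg" using L by (simp add: centralizer_def)
  then have x: "(L ?T, x) \<in> lifts" by (simp only: alg_iff x_def)
  have "L ?T = L ?T o\<^sub>L ?T"
    using L Ta branch_op_idem unfolding centralizer_def by metis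
  then have "(L ?T, x o\<^sub>L proj {\<gamma>}) \<in> lifts"
    using lifts_compose[OF x branch_op_lifts, of \<gamma>] by simp
  then have x1: "x = x o\<^sub>L proj {\<gamma>}" using lifts_unique x by blast
  have x0: "coord (x (ket \<gamma>)) \<beta> = 0" if "\<beta> \<noteq> \<gamma>" for \<beta>
    using LIMSEQ_unique[OF symbol_tendsto[OF L, of False \<beta> False \<gamma>] lim[OF that]] by (simp add: x_def)
  define c where "c = coord (x (ket \<gamma>)) \<gamma>"
  have "x = scaleC_op c (proj {\<gamma>})"
  proof (rule op_eq_on_kets)
    fix \<alpha>
    show "x (ket \<alpha>) = scaleC_op c (proj {\<gamma>}) (ket \<alpha>)"
    proof (cases "\<alpha> = \<gamma>")
      case True
      show ?thesis
        by (rule ell2_eqI) (use x0 in \<open>auto simp: True proj_ket c_def\<close>)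
    next
      case False
      then have "(x o\<^sub>L proj {\<gamma>}) (ket \<alpha>) = 0" by (simp add: proj_ket)
      then have "x (ket \<alpha>) = 0" using x1 by metis
      then show ?thesis using False by (auto simp: proj_ket intro: ell2_eqI)
    qed
  qed (use lifts_bounded(2)[OF x] in \<open>simp_all add: compact_ops_bounded scaleC_op_bounded_ops\<close>)
  then have "(L ?T - scaleC_op c ?T, 0) \<in> lifts"
    using lifts_diff[OF x lifts_scaleC[OF branch_op_lifts[of \<gamma>], of c]] by simp
  then show ?thesis using that lifts_kernel by blast
qed

text \<open>The right multiplication \<open>L'\<close> replaces an argument that \<open>L\<close> preserves compact operators.\<close>

lemma centralizer_product:
  assumes L: "centralizer L L'" and T: "T \<in> alg" "T o\<^sub>L T = T"
    and c: "L T - scaleC_op c T \<in> compact_ops" and d: "b - scaleC_op d T \<in> compact_ops"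
  shows "(T o\<^sub>L L b) - scaleC_op (c * d) T \<in> compact_ops"
proof -
  have bT: "T \<in> bounded_ops" using T alg_bounded by blast
  define k where "k = b - scaleC_op d T"
  have k: "k \<in> compact_ops" "k \<in> alg" using d by (auto simp: k_def compact_subset_alg)
  have dT: "scaleC_op d T \<in> alg" using T(1) algI lifts_scaleC alg_iff by blast
  have "L b = L (k + scaleC_op d T)" by (simp add: k_def)
  also have "\<dots> = L k + scaleC_op d (L T)"
    using L k dT T unfolding centralizer_def by simp
  finally have "T o\<^sub>L L b = (T o\<^sub>L L k) + scaleC_op d (T o\<^sub>L L T)"
    by (intro blinfun_eqI) (simp add: blinfun.add_left blinfun.add_right bounded_opsD[OF bT])
  also have "T o\<^sub>L L k = L' T o\<^sub>L k"
    using L k T unfolding centralizer_def by blast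
  finally have eq: "T o\<^sub>L L b = (L' T o\<^sub>L k) + scaleC_op d (T o\<^sub>L L T)" .
  have TT: "T (T v) = T v" for v using T(2) by (metis blinfun_apply_blinfun_compose)
  have "(T o\<^sub>L L b) - scaleC_op (c * d) T = (L' T o\<^sub>L k) + scaleC_op d (T o\<^sub>L (L T - scaleC_op c T))"
    unfolding eq
    by (intro blinfun_eqI ell2_eqI)
      (simp add: blinfun.add_left blinfun.diff_left blinfun.diff_right bounded_opsD[OF bT] TT algebra_simps)
  moreover have "L' T \<in> bounded_ops" using L T alg_bounded unfolding centralizer_def by blast
  ultimately show ?thesis
    using k c bT by (simp add: compact_ops_add compact_ops_scaleC compact_ops_compose_left)
qed

theorem no_anticommuting_centralizers:
  assumes L1: "centralizer L1 L1'" and L2: "centralizer L2 L2'"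
    and sq: "\<And>a. a \<in> alg \<Longrightarrow> L1 (L1 a) = a" "\<And>a. a \<in> alg \<Longrightarrow> L2 (L2 a) = a"
    and anti: "\<And>a. a \<in> alg \<Longrightarrow> L1 (L2 a) = - L2 (L1 a)"
  shows False
proof -
  have "\<exists>\<gamma>. \<forall>\<beta>. \<beta> \<noteq> \<gamma> \<longrightarrow> (\<lambda>n. symbol L1 (node False \<beta> n) (node False \<gamma> n)) \<longlonglongrightarrow> 0 \<and>
      (\<lambda>n. symbol L2 (node False \<beta> n) (node False \<gamma> n)) \<longlonglongrightarrow> 0"
    by (rule diagonal)
      (use symbol_tendsto[OF L1, of False _ True] symbol_tendsto[OF L2, of False _ True] in simp_all)
  then obtain \<gamma> where \<gamma>: "\<And>\<beta>. \<beta> \<noteq> \<gamma> \<Longrightarrow> (\<lambda>n. symbol L1 (node False \<beta> n) (node False \<gamma> n)) \<longlonglongrightarrow> 0"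
    "\<And>\<beta>. \<beta> \<noteq> \<gamma> \<Longrightarrow> (\<lambda>n. symbol L2 (node False \<beta> n) (node False \<gamma> n)) \<longlonglongrightarrow> 0"
    by blast
  define T where "T = branch_op \<gamma>"
  have T: "T \<in> alg" "T o\<^sub>L T = T"
    unfolding T_def by (rule algI[OF branch_op_lifts], rule branch_op_idem)
  obtain c where c: "L1 T - scaleC_op c T \<in> compact_ops"
    using centralizer_scalar[OF L1 \<gamma>(1)] unfolding T_def by blast
  obtain d where d: "L2 T - scaleC_op d T \<in> compact_ops"
    using centralizer_scalar[OF L2 \<gamma>(2)] unfolding T_def by blast
  \<comment> \<open>Since \<open>T\<close> is not compact, an equation between multiples of
    \<open>T\<close> modulo compact operators is an equation between scalars.\<close>
  have z: "e = 0" if "scaleC_op e T \<in> compact_ops" for e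
  proof (rule ccontr)
    assume "e \<noteq> 0"
    then have "scaleC_op (inverse e) (scaleC_op e T) = T"
      by (intro blinfun_eqI ell2_eqI) simp
    then show False
      using compact_ops_scaleC[OF that, of "inverse e"] branch_op_not_compact by (simp add: T_def)
  qed
  have "T - scaleC_op (c * c) T \<in> compact_ops"
    using centralizer_product[OF L1 T c c] sq(1)[OF T(1)] T(2) by simp
  also have "T - scaleC_op (c * c) T = scaleC_op (1 - c * c) T"
    by (intro blinfun_eqI ell2_eqI) (simp add: blinfun.diff_left algebra_simps)
  finally have cc: "c * c = 1" using z by fastforce
  have "T - scaleC_op (d * d) T \<in> compact_ops"
    using centralizer_product[OF L2 T d d] sq(2)[OF T(1)] T(2) by simp
  also have "T - scaleC_op (d * d) T = scaleC_op (1 - d * d) T"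
    by (intro blinfun_eqI ell2_eqI) (simp add: blinfun.diff_left algebra_simps)
  finally have dd: "d * d = 1" using z by fastforce
  \<comment> \<open>The two products cancel by anticommutation, so that only their scalar parts are
    left.\<close>
  have "((T o\<^sub>L L1 (L2 T)) - scaleC_op (c * d) T) + ((T o\<^sub>L L2 (L1 T)) - scaleC_op (d * c) T) \<in> compact_ops"
    by (intro compact_ops_add centralizer_product[OF L1 T c d] centralizer_product[OF L2 T d c])
  also have "((T o\<^sub>L L1 (L2 T)) - scaleC_op (c * d) T) + ((T o\<^sub>L L2 (L1 T)) - scaleC_op (d * c) T) =
      scaleC_op (- 2 * (c * d)) T"
    unfolding anti[OF T(1)]
    by (intro blinfun_eqI ell2_eqI)
      (simp add: blinfun.add_left blinfun.diff_left blinfun.minus_left blinfun.minus_right algebra_simps)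
  finally have "c * d = 0" using z by fastforce
  then show False using cc dd by auto
qed

end

section \<open>Stability yields anticommuting multipliers\<close>

lemma op_tensor_id_compose:
  assumes "S \<in> bounded_ops" "D \<in> bounded_ops" "T \<in> bounded_ops"
  shows "op_tensor id_blinfun D o\<^sub>L op_tensor S T = op_tensor S (D o\<^sub>L T)"
    and "op_tensor S T o\<^sub>L op_tensor id_blinfun D = op_tensor S (T o\<^sub>L D)"
  by (rule op_eq_on_kets;
      auto simp: assms bounded_ops_closed op_tensor_bounded_ops op_tensor_apply simp flip: ket_tensor)+

lemma id_blinfun_compose: "id_blinfun o\<^sub>L x = x"
  by (rule blinfun_eqI) simp

lemma op_tensor_id_id: "op_tensor id_blinfun id_blinfun = id_blinfun"
  by (rule op_eq_on_kets) (auto simp: op_tensor_bounded_ops op_tensor_apply simp flip: ket_tensor)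

lemma op_tensor_uminus:
  assumes "S \<in> bounded_ops" "T \<in> bounded_ops"
  shows "op_tensor S (- T) = - op_tensor S T"
proof -
  have m: "- A \<in> bounded_ops" if "A \<in> bounded_ops" for A :: "'i op"
    using scaleC_op_bounded_ops[OF that, of "-1"] by (simp add: scaleC_op_minus_one)
  show ?thesis
  proof (rule op_eq_on_kets)
    fix p :: "'a \<times> 'b"
    obtain i j where p: "p = (i, j)" by (cases p)
    show "op_tensor S (- T) (ket p) = (- op_tensor S T) (ket p)"
      unfolding p ket_tensor[symmetric]
      by (rule ell2_eqI) (simp add: op_tensor_apply assms m blinfun.minus_left split_paired_all)
  qed (simp_all add: assms m op_tensor_bounded_ops)
qed

text \<open>On elementary tensors only the second factor is multiplied by \<open>D\<close>, and
  compact operators form an ideal; linear spans and limits inherit this.\<close>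

lemma spatial_tensor_multiplier:
  fixes S :: "'i op set" and D :: "'j op"
  assumes S: "S \<subseteq> bounded_ops" and D: "D \<in> bounded_ops" and s: "s \<in> spatial_tensor S compact_ops"
  shows "op_tensor id_blinfun D o\<^sub>L s \<in> spatial_tensor S compact_ops" (is "?M o\<^sub>L s \<in> _")
    and "s o\<^sub>L op_tensor id_blinfun D \<in> spatial_tensor S compact_ops"
proof -
  interpret module scaleC_op by (rule module_scaleC_op)
  define G where "G = {op_tensor a b | a b. a \<in> S \<and> b \<in> (compact_ops :: 'j op set)}"
  have st: "spatial_tensor S compact_ops = closure (span G)"
    by (simp add: spatial_tensor_def G_def)
  have M: "?M \<in> bounded_ops" by (simp add: op_tensor_bounded_ops D)
  have l: "?M o\<^sub>L t \<in> span G" if "t \<in> span G" for t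
    using that
  proof (induction rule: span_induct_alt)
    case base
    then show ?case by (simp add: span_zero)
  next
    case (step c x y)
    then obtain a b where x: "x = op_tensor a b" "a \<in> S" "b \<in> compact_ops" by (auto simp: G_def)
    then have "a \<in> bounded_ops" "b \<in> bounded_ops" using S compact_ops_bounded by blast+
    then have "?M o\<^sub>L x = op_tensor a (D o\<^sub>L b)"
      by (simp add: op_tensor_id_compose D x)
    then have "?M o\<^sub>L x \<in> span G"
      using x D by (intro span_base) (auto simp: G_def intro: compact_ops_compose_left)
    moreover have "?M o\<^sub>L (scaleC_op c x + y) = scaleC_op c (?M o\<^sub>L x) + (?M o\<^sub>L y)"
      by (rule blinfun_eqI) (simp add: blinfun.add_left blinfun.add_right bounded_opsD[OF M])
    ultimately show ?case using step by (simp add: span_add span_scale)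
  qed
  have r: "t o\<^sub>L ?M \<in> span G" if "t \<in> span G" for t
    using that
  proof (induction rule: span_induct_alt)
    case base
    then show ?case by (simp add: span_zero)
  next
    case (step c x y)
    then obtain a b where x: "x = op_tensor a b" "a \<in> S" "b \<in> compact_ops" by (auto simp: G_def)
    then have "a \<in> bounded_ops" "b \<in> bounded_ops" using S compact_ops_bounded by blast+
    then have "x o\<^sub>L ?M = op_tensor a (b o\<^sub>L D)"
      by (simp add: op_tensor_id_compose D x)
    then have "x o\<^sub>L ?M \<in> span G"
      using x D by (intro span_base) (auto simp: G_def intro: compact_ops_compose_right)
    moreover have "(scaleC_op c x + y) o\<^sub>L ?M = scaleC_op c (x o\<^sub>L ?M) + (y o\<^sub>L ?M)"
      by (rule blinfun_eqI) (simp add: blinfun.add_left)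
    ultimately show ?case using step by (simp add: span_add span_scale)
  qed
  obtain f where f: "\<And>n. f n \<in> span G" "f \<longlonglongrightarrow> s"
    using s unfolding st closure_sequential by blast
  show "?M o\<^sub>L s \<in> spatial_tensor S compact_ops"
    unfolding st closure_sequential
    by (rule exI[of _ "\<lambda>n. ?M o\<^sub>L f n"]) (auto intro: l f tendsto_compose tendsto_const)
  show "s o\<^sub>L ?M \<in> spatial_tensor S compact_ops"
    unfolding st closure_sequential
    by (rule exI[of _ "\<lambda>n. f n o\<^sub>L ?M"]) (auto intro: r f tendsto_compose tendsto_const)
qed

text \<open>Together with \<open>swap_op\<close> these are the Pauli matrices Z and X on every block
  of coordinates \<open>2 * k\<close> and \<open>2 * k + 1\<close>.\<close>

definition sign_op :: "nat op"
  where "sign_op = proj {n. even n} - proj {n. odd n}"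

definition swap_op :: "nat op"
  where "swap_op = pull (\<lambda>n. Some (if even n then n + 1 else n - 1))"

lemma inj_swap: "inj_on (\<lambda>n :: nat. Some (if even n then n + 1 else n - 1)) A"
  by (rule inj_onI) (auto split: if_splits; presburger)

lemma coord_sign: "coord (sign_op u) n = (if even n then coord u n else - coord u n)"
  by (simp add: sign_op_def blinfun.diff_left)

lemma coord_swap: "coord (swap_op u) n = coord u (if even n then n + 1 else n - 1)"
  by (simp add: swap_op_def coord_pull[OF inj_swap])

lemma
  shows sign_bounded: "sign_op \<in> bounded_ops" and swap_bounded: "swap_op \<in> bounded_ops"
    and sign_sign: "sign_op o\<^sub>L sign_op = id_blinfun" and swap_swap: "swap_op o\<^sub>L swap_op = id_blinfun"
    and sign_swap: "sign_op o\<^sub>L swap_op = - (swap_op o\<^sub>L sign_op)"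
  by (auto simp: bounded_ops_def coord_sign coord_swap blinfun.minus_left intro!: ell2_eqI blinfun_eqI)

context diagonal_branches
begin

text \<open>Multiplication by \<open>op_tensor id_blinfun D\<close>, transported through the
  isomorphism, is a centralizer of \<open>alg\<close> that depends multiplicatively on
  \<open>D\<close>. It is applied to \<open>sign_op\<close> and \<open>swap_op\<close>.\<close>

lemma stable_imp_anticommuting:
  assumes "stable_algebra (op_algebra alg)"
  obtains L1 L1' L2 L2' where "centralizer L1 L1'" "centralizer L2 L2'"
    "\<And>a. a \<in> alg \<Longrightarrow> L1 (L1 a) = a" "\<And>a. a \<in> alg \<Longrightarrow> L2 (L2 a) = a"
    "\<And>a. a \<in> alg \<Longrightarrow> L1 (L2 a) = - L2 (L1 a)"
proof -
  obtain \<pi> :: "nat op \<Rightarrow> nat op op" and \<phi> where \<pi>: "faithful_rep (op_algebra alg) \<pi>"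
    and \<phi>: "star_hom (op_algebra alg) (op_algebra (spatial_tensor (\<pi> ` alg) (compact_ops :: nat op set))) \<phi>"
    and bij: "bij_betw \<phi> alg (spatial_tensor (\<pi> ` alg) compact_ops)"
    using assms by (auto simp: stable_algebra_def isomorphic_def op_algebra_def)
  define S where "S = spatial_tensor (\<pi> ` alg) (compact_ops :: nat op set)"
  have \<pi>S: "\<pi> ` alg \<subseteq> bounded_ops"
    using \<pi> by (auto simp: faithful_rep_def star_hom_def op_algebra_def)
  have add: "\<phi> (a + b) = \<phi> a + \<phi> b" and mult: "\<phi> (a o\<^sub>L b) = \<phi> a o\<^sub>L \<phi> b"
    and scale: "\<phi> (scaleC_op c a) = scaleC_op c (\<phi> a)"
    if "a \<in> alg" "b \<in> alg" for a b c
    using \<phi> that by (auto simp: star_hom_def op_algebra_def)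
  have S: "\<phi> a \<in> S" if "a \<in> alg" for a using bij that by (auto simp: bij_betw_def S_def)
  have inj: "\<phi> a = \<phi> b \<Longrightarrow> a = b" if "a \<in> alg" "b \<in> alg" for a b
    using bij that by (auto simp: bij_betw_def inj_on_def)
  define \<psi> where "\<psi> = inv_into alg \<phi>"
  have \<psi>: "\<psi> s \<in> alg" "\<phi> (\<psi> s) = s" if "s \<in> S" for s
    using bij that unfolding \<psi>_def S_def bij_betw_def by (auto intro: inv_into_into f_inv_into_f)
  have closed: "a + b \<in> alg" "a o\<^sub>L b \<in> alg" "scaleC_op c a \<in> alg" if "a \<in> alg" "b \<in> alg" for a b c
    using that cstar_algebra_alg cstar_algebra.plus_closed[of "op_algebra alg"]
      cstar_algebra.times_closed[of "op_algebra alg"] cstar_algebra.scale_closed[of "op_algebra alg"]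
    by (auto simp: op_algebra_def)
  define M where "M D = op_tensor (id_blinfun :: nat op op) D" for D :: "nat op"
  have M: "M D \<in> bounded_ops" if "D \<in> bounded_ops" for D
    using that by (simp add: M_def op_tensor_bounded_ops)
  define L where "L D a = \<psi> (M D o\<^sub>L \<phi> a)" for D a
  define L' where "L' D a = \<psi> (\<phi> a o\<^sub>L M D)" for D a
  have MS: "M D o\<^sub>L s \<in> S" "s o\<^sub>L M D \<in> S" if "D \<in> bounded_ops" "s \<in> S" for D s
    using spatial_tensor_multiplier[OF \<pi>S] that by (auto simp: S_def M_def)
  have La: "L D a \<in> alg" "L' D a \<in> alg" if "D \<in> bounded_ops" "a \<in> alg" for D a
    using that by (auto simp: L_def L'_def intro: \<psi> MS S)
  have L\<phi>: "\<phi> (L D a) = M D o\<^sub>L \<phi> a" "\<phi> (L' D a) = \<phi> a o\<^sub>L M D" if "D \<in> bounded_ops" "a \<in> alg" for D a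
    using that by (auto simp: L_def L'_def intro: \<psi> MS S)
  have cent: "centralizer (L D) (L' D)" if D: "D \<in> bounded_ops" for D
    unfolding centralizer_def
  proof (intro conjI ballI allI)
    fix a b c assume a: "a \<in> alg" and b: "b \<in> alg"
    show "L D (a + b) = L D a + L D b"
      by (rule inj) (auto simp: a b D La closed L\<phi> add blinfun.add_left blinfun.add_right intro!: blinfun_eqI)
    show "L D (a o\<^sub>L b) = L D a o\<^sub>L b"
      by (rule inj) (auto simp: a b D La closed L\<phi> mult op_compose_assoc)
    show "a o\<^sub>L L D b = L' D a o\<^sub>L b"
      by (rule inj) (auto simp: a b D La closed L\<phi> mult op_compose_assoc)
  next
    fix a c assume a: "a \<in> alg"
    show "L D (scaleC_op c a) = scaleC_op c (L D a)"
      by (rule inj) (auto simp: a D La closed[OF _ a] L\<phi> scale[OF _ a] bounded_opsD[OF M[OF D]] intro!: blinfun_eqI)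
  qed (simp_all add: La D)
  have comp: "\<phi> (L D (L E a)) = op_tensor id_blinfun (D o\<^sub>L E) o\<^sub>L \<phi> a"
    if "D \<in> bounded_ops" "E \<in> bounded_ops" "a \<in> alg" for D E a
    using that by (simp add: L\<phi> La M_def op_tensor_id_compose(1) flip: op_compose_assoc)
  note b = sign_bounded swap_bounded
  show ?thesis
  proof (rule that[OF cent[OF sign_bounded] cent[OF swap_bounded]])
    fix a assume a: "a \<in> alg"
    show "L sign_op (L sign_op a) = a"
      by (rule inj) (simp_all add: a b La comp sign_sign op_tensor_id_id id_blinfun_compose)
    show "L swap_op (L swap_op a) = a"
      by (rule inj) (simp_all add: a b La comp swap_swap op_tensor_id_id id_blinfun_compose)
    have "\<phi> (- L swap_op (L sign_op a)) = - \<phi> (L swap_op (L sign_op a))"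
      using scale[of "L swap_op (L sign_op a)" "L swap_op (L sign_op a)" "-1"]
      by (simp add: scaleC_op_minus_one a b La)
    moreover have "- L swap_op (L sign_op a) \<in> alg"
      using closed(3)[of "L swap_op (L sign_op a)" "L swap_op (L sign_op a)" "-1"]
      by (simp add: scaleC_op_minus_one a b La)
    ultimately show "L sign_op (L swap_op a) = - L swap_op (L sign_op a)"
      by (intro inj) (auto simp: a b La comp sign_swap op_tensor_uminus bounded_ops_closed
          blinfun.minus_left intro!: blinfun_eqI)
  qed
qed

end

section \<open>The diagonal family of branches\<close>

text \<open>Level \<open>n\<close> records which of the first \<open>n\<close> enumerated rationals
  lie below \<open>\<xi>\<close>, an initial part of its Dedekind cut; coding \<open>n\<close> as
  well keeps the levels disjoint.\<close>

definition branch_node :: "real \<Rightarrow> nat \<Rightarrow> nat"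
  where "branch_node \<xi> n = prod_encode (n, set_encode {k. k < n \<and> of_rat (from_nat k) < \<xi>})"

lemma branch_node_level: "branch_node \<xi> n = branch_node \<eta> m \<Longrightarrow> n = m"
  by (simp add: branch_node_def)

text \<open>A rational strictly between the two reals separates the nodes on all levels beyond its
  place in the enumeration.\<close>

lemma branch_node_split:
  assumes "\<xi> \<noteq> \<eta>"
  shows "\<exists>N. \<forall>n\<ge>N. branch_node \<xi> n \<noteq> branch_node \<eta> n"
proof -
  have less: "\<exists>N. \<forall>n\<ge>N. branch_node \<xi> n \<noteq> branch_node \<eta> n" if lt: "\<xi> < \<eta>" for \<xi> \<eta>
  proof -
    obtain q where q: "\<xi> < of_rat q" "of_rat q < \<eta>" using of_rat_dense[OF lt] by blast
    have "branch_node \<xi> n \<noteq> branch_node \<eta> n" if n: "n \<ge> Suc (to_nat q)" for n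
    proof
      assume "branch_node \<xi> n = branch_node \<eta> n"
      then have "{k. k < n \<and> of_rat (from_nat k) < \<xi>} = {k. k < n \<and> of_rat (from_nat k) < \<eta>}"
        by (simp add: branch_node_def set_encode_eq)
      then have "to_nat q \<in> {k. k < n \<and> of_rat (from_nat k) < \<xi>} \<longleftrightarrow>
          to_nat q \<in> {k. k < n \<and> of_rat (from_nat k) < \<eta>}"
        by (simp only:)
      then show False using n q by simp
    qed
    then show ?thesis by blast
  qed
  show ?thesis
    using assms less[of \<xi> \<eta>] less[of \<eta> \<xi>] by (metis linorder_neqE)
qed

text \<open>The rationals below the real and imaginary parts of the entries determine a matrix, so
  matrices inject into sets of naturals and thus into the reals; an inverse of this injection
  enumerates them.\<close>

lemma ex_surj_matrices: "\<exists>M :: real \<Rightarrow> nat \<Rightarrow> nat \<Rightarrow> complex. surj M"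
proof -
  define g :: "(nat \<Rightarrow> nat \<Rightarrow> complex) \<Rightarrow> nat set" where
    "g P = to_nat ` {(i, j, b, q). of_rat q < (if b then Re (P i j) else Im (P i j))}" for P
  have "inj g"
  proof (rule injI)
    fix P Q assume "g P = g Q"
    then have "{(i, j, b, q). of_rat q < (if b then Re (P i j) else Im (P i j))} =
        {(i, j, b, q). of_rat q < (if b then Re (Q i j) else Im (Q i j))}"
      unfolding g_def by (simp add: inj_image_eq_iff)
    then have *: "of_rat q < (if b then Re (P i j) else Im (P i j)) \<longleftrightarrow>
        of_rat q < (if b then Re (Q i j) else Im (Q i j))" for i j b q
      by (auto simp: set_eq_iff)
    have eq: "x = y" if "\<And>q. of_rat q < x \<longleftrightarrow> of_rat q < y" for x y :: real
      using that of_rat_dense by (metis linorder_neqE order_less_asym)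
    show "P = Q"
    proof (intro ext complex_eqI)
      show "Re (P i j) = Re (Q i j)" for i j using *[of _ True] by (intro eq) simp
      show "Im (P i j) = Im (Q i j)" for i j using *[of _ False] by (intro eq) simp
    qed
  qed
  moreover obtain h :: "nat set \<Rightarrow> real" where "inj h"
    using eqpoll_imp_lepoll[OF nat_sets_eqpoll_reals] unfolding lepoll_def by blast
  ultimately have "inj (h \<circ> g)" by (simp add: inj_compose)
  then have "surj (inv (h \<circ> g))" by (rule inj_imp_surj_inv)
  then show ?thesis by blast
qed

text \<open>A cardinal well-order on the stages, unrelated to the usual order of the reals.\<close>

abbreviation le_real :: "real rel"
  where "le_real \<equiv> card_of UNIV"

text \<open>\<open>surv\<close> says that the object enumerated at stage \<open>\<alpha>\<close> survives the choice of a pair: a pair which it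
  does not survive is taken whenever there is one.\<close>

lemma ex_diagonal_pairs:
  includes cardinal_syntax
  fixes surv :: "real set \<Rightarrow> real \<Rightarrow> real \<times> real \<Rightarrow> bool"
  defines "used f \<alpha> \<equiv> fst ` f ` underS le_real \<alpha> \<union> snd ` f ` underS le_real \<alpha>"
  defines "ok f \<alpha> p \<equiv> fst p \<notin> used f \<alpha> \<and> snd p \<notin> used f \<alpha> \<and> fst p \<noteq> snd p"
  defines "sv f \<alpha> p \<equiv> surv (fst ` f ` underS le_real \<alpha>) \<alpha> p"
  shows "\<exists>f :: real \<Rightarrow> real \<times> real. \<forall>\<alpha>. ok f \<alpha> (f \<alpha>) \<and> (sv f \<alpha> (f \<alpha>) \<longrightarrow> (\<forall>p. ok f \<alpha> p \<longrightarrow> sv f \<alpha> p))"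
proof -
  have wf: "wf (le_real - Id)"
    using card_of_Well_order[of "UNIV :: real set"] by (simp add: well_order_on_def)
  have under: "underS le_real \<alpha> = {\<beta>. (\<beta>, \<alpha>) \<in> le_real - Id}" for \<alpha>
    by (auto simp: underS_def)
  have ex: "\<exists>p. ok f \<alpha> p" for f \<alpha>
  proof -
    have inf: "infinite (UNIV :: real set)" by (rule infinite_UNIV_char_0)
    have 1: "|underS le_real \<alpha>| <o |UNIV :: real set|"
      by (rule card_of_underS[OF card_of_Card_order]) (simp add: Field_card_of)
    have im: "|g ` f ` underS le_real \<alpha>| <o |UNIV :: real set|" for g :: "real \<times> real \<Rightarrow> real"
      unfolding image_comp by (rule ordLeq_ordLess_trans[OF card_of_image 1])
    have 2: "|used f \<alpha>| <o |UNIV :: real set|"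
      unfolding used_def by (intro card_of_Un_ordLess_infinite inf im)
    \<comment> \<open>The used reals are fewer than continuum many; with a finite complement, the
      set of all reals would be smaller than itself.\<close>
    have "infinite (- used f \<alpha>)"
    proof
      assume fin: "finite (- used f \<alpha>)"
      have "|used f \<alpha> \<union> - used f \<alpha>| <o |UNIV :: real set|"
        by (intro card_of_Un_ordLess_infinite inf 2 finite_ordLess_infinite[OF card_of_Well_order card_of_Well_order])
          (simp_all add: Field_card_of fin inf)
      then show False by (simp add: ordLess_irreflexive)
    qed
    then obtain x where x: "x \<in> - used f \<alpha>" using infinite_imp_nonempty by blast
    have "infinite (- used f \<alpha> - {x})" using \<open>infinite (- used f \<alpha>)\<close> by simp
    then obtain y where "y \<in> - used f \<alpha> - {x}" using infinite_imp_nonempty by blast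
    then have "ok f \<alpha> (x, y)" using x by (simp add: ok_def)
    then show ?thesis ..
  qed
  define Q where "Q f \<alpha> p \<longleftrightarrow> ok f \<alpha> p \<and> (sv f \<alpha> p \<longrightarrow> (\<forall>p'. ok f \<alpha> p' \<longrightarrow> sv f \<alpha> p'))" for f \<alpha> p
  \<comment> \<open>The condition at \<open>\<alpha>\<close> depends on \<open>f\<close> only
    through its values below \<open>\<alpha>\<close>, as well-founded recursion with choices
    demands.\<close>
  have "\<exists>f. \<forall>\<alpha>. Q f \<alpha> (f \<alpha>)"
  proof (rule dependent_wf_choice[OF wf])
    fix f g :: "real \<Rightarrow> real \<times> real" and \<alpha> p
    assume "\<And>z. (z, \<alpha>) \<in> le_real - Id \<Longrightarrow> f z = g z"
    then have "f ` underS le_real \<alpha> = g ` underS le_real \<alpha>" unfolding under by (intro image_cong) auto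
    then show "Q f \<alpha> p = Q g \<alpha> p" by (simp add: Q_def ok_def sv_def used_def)
  next
    fix \<alpha> and f :: "real \<Rightarrow> real \<times> real"
    show "\<exists>p. Q f \<alpha> p"
    proof (cases "\<exists>p. ok f \<alpha> p \<and> \<not> sv f \<alpha> p")
      case True
      then show ?thesis unfolding Q_def by blast
    next
      case False
      then show ?thesis using ex[of f \<alpha>] unfolding Q_def by blast
    qed
  qed
  then show ?thesis unfolding Q_def .
qed

theorem ex_diagonal_branches: "\<exists>node :: bool \<Rightarrow> real \<Rightarrow> nat \<Rightarrow> nat. diagonal_branches node"
proof -
  obtain M :: "real \<Rightarrow> nat \<Rightarrow> nat \<Rightarrow> complex" where M: "surj M" using ex_surj_matrices by blast
  define zero where "zero P s t \<longleftrightarrow> (\<lambda>n. P (branch_node s n) (branch_node t n)) \<longlonglongrightarrow> (0 :: complex)" for P s t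
  \<comment> \<open>The second member is tested against the first member and also against all
    earlier first branches, since these are no longer available for a pair.\<close>
  define surv where "surv A \<alpha> p \<longleftrightarrow> (\<forall>s\<in>insert (fst p) A. zero (M \<alpha>) s (snd p))" for A \<alpha> and p :: "real \<times> real"
  define used where "used f \<alpha> = fst ` f ` underS le_real \<alpha> \<union> snd ` f ` underS le_real \<alpha>" for f :: "real \<Rightarrow> real \<times> real" and \<alpha>
  define ok where "ok f \<alpha> p \<longleftrightarrow> fst p \<notin> used f \<alpha> \<and> snd p \<notin> used f \<alpha> \<and> fst p \<noteq> snd p" for f \<alpha> p
  have "\<exists>f. \<forall>\<alpha>. ok f \<alpha> (f \<alpha>) \<and> (surv (fst ` f ` underS le_real \<alpha>) \<alpha> (f \<alpha>) \<longrightarrow>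
      (\<forall>p. ok f \<alpha> p \<longrightarrow> surv (fst ` f ` underS le_real \<alpha>) \<alpha> p))"
    unfolding ok_def used_def by (rule ex_diagonal_pairs)
  then obtain f where ok: "\<And>\<alpha>. ok f \<alpha> (f \<alpha>)"
    and sv: "\<And>\<alpha> p. surv (fst ` f ` underS le_real \<alpha>) \<alpha> (f \<alpha>) \<Longrightarrow> ok f \<alpha> p \<Longrightarrow> surv (fst ` f ` underS le_real \<alpha>) \<alpha> p"
    by metis
  have wo: "Well_order le_real" by (rule card_of_Well_order)
  have tot: "\<beta> \<in> underS le_real \<alpha> \<or> \<alpha> \<in> underS le_real \<beta>" if "\<alpha> \<noteq> \<beta>" for \<alpha> \<beta>
    using wo that by (auto simp: well_order_on_def linear_order_on_def total_on_def Field_card_of underS_def)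
  have trans: "\<beta> \<in> underS le_real \<gamma>" if "\<beta> \<in> underS le_real \<alpha>" "\<alpha> \<in> underS le_real \<gamma>" for \<alpha> \<beta> \<gamma>
    using wo that by (auto simp: well_order_on_def linear_order_on_def partial_order_on_def preorder_on_def underS_def
        dest: transD antisymD)
  have sub: "used f \<alpha> \<subseteq> used f \<gamma>" if "\<alpha> = \<gamma> \<or> \<alpha> \<in> underS le_real \<gamma>" for \<alpha> \<gamma>
    using that trans unfolding used_def by blast
  have in_used: "fst (f \<beta>) \<in> used f \<alpha>" "snd (f \<beta>) \<in> used f \<alpha>" if "\<beta> \<in> underS le_real \<alpha>" for \<alpha> \<beta>
    using that by (auto simp: used_def)
  have okD: "fst (f \<alpha>) \<notin> used f \<alpha>" "snd (f \<alpha>) \<notin> used f \<alpha>" "fst (f \<alpha>) \<noteq> snd (f \<alpha>)" for \<alpha>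
    using ok[of \<alpha>] by (auto simp: ok_def)
  define pt where "pt i \<alpha> = (if i then snd (f \<alpha>) else fst (f \<alpha>))" for i \<alpha>
  have pt_used: "pt i \<beta> \<in> used f \<alpha>" if "\<beta> \<in> underS le_real \<alpha>" for i \<alpha> \<beta>
    using in_used[OF that] by (simp add: pt_def)
  have pt_new: "pt i \<alpha> \<notin> used f \<alpha>" for i \<alpha>
    using okD[of \<alpha>] by (simp add: pt_def)
  have pt_inj: "pt i \<alpha> \<noteq> pt j \<beta>" if "(i, \<alpha>) \<noteq> (j, \<beta>)" for i j \<alpha> \<beta>
  proof (cases "\<alpha> = \<beta>")
    case True
    then show ?thesis using that okD(3)[of \<beta>] by (auto simp: pt_def)
  next
    case False
    then show ?thesis using tot[OF False] pt_used pt_new by metis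
  qed
  have key: "zero (M \<alpha>) (pt False \<beta>) (pt False \<gamma>)"
    if cross: "\<And>\<beta>. zero (M \<alpha>) (pt False \<beta>) (pt True \<alpha>)"
      and \<gamma>: "\<alpha> = \<gamma> \<or> \<alpha> \<in> underS le_real \<gamma>" and ne: "\<beta> \<noteq> \<gamma>" for \<alpha> \<beta> \<gamma>
  proof -
    let ?A = "fst ` f ` underS le_real \<alpha>"
    have "surv ?A \<alpha> (f \<alpha>)" using cross by (auto simp: surv_def pt_def)
    then have sv: "surv ?A \<alpha> p" if "ok f \<alpha> p" for p using sv that by blast
    have new: "pt i \<gamma> \<notin> used f \<alpha>" for i using sub[OF \<gamma>] pt_new by blast
    show ?thesis
    proof (cases "\<beta> \<in> underS le_real \<alpha>")
      case True
      \<comment> \<open>Here \<open>pt False \<beta>\<close> is already used and enters through the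
        set \<open>?A\<close>. The pair of stage \<open>\<gamma>\<close> is taken in reverse order,
        to put \<open>pt False \<gamma>\<close> in the tested second position.\<close>
      have "ok f \<alpha> (pt True \<gamma>, pt False \<gamma>)" using new pt_inj by (simp add: ok_def)
      from sv[OF this] True show ?thesis by (auto simp: surv_def pt_def)
    next
      case False
      then have "\<alpha> = \<beta> \<or> \<alpha> \<in> underS le_real \<beta>" using tot by blast
      then have "pt False \<beta> \<notin> used f \<alpha>" using sub pt_new by blast
      then have "ok f \<alpha> (pt False \<beta>, pt False \<gamma>)" using new pt_inj ne by (simp add: ok_def)
      from sv[OF this] show ?thesis by (auto simp: surv_def)
    qed
  qed
  have "diagonal_branches (\<lambda>i \<alpha>. branch_node (pt i \<alpha>))"
  proof
    show "n = m" if "branch_node (pt i \<alpha>) n = branch_node (pt j \<beta>) m" for i \<alpha> n j \<beta> m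
      using that by (rule branch_node_level)
    show "\<exists>N. \<forall>n\<ge>N. branch_node (pt i \<alpha>) n \<noteq> branch_node (pt j \<beta>) n" if "(i, \<alpha>) \<noteq> (j, \<beta>)" for i \<alpha> j \<beta>
      by (rule branch_node_split[OF pt_inj[OF that]])
    fix P Q :: "nat \<Rightarrow> nat \<Rightarrow> complex"
    assume P: "\<And>\<alpha> \<beta>. (\<lambda>n. P (branch_node (pt False \<beta>) n) (branch_node (pt True \<alpha>) n)) \<longlonglongrightarrow> 0"
      and Q: "\<And>\<alpha> \<beta>. (\<lambda>n. Q (branch_node (pt False \<beta>) n) (branch_node (pt True \<alpha>) n)) \<longlonglongrightarrow> 0"
    obtain a b where a: "P = M a" and b: "Q = M b" using M by (metis surjD)
    \<comment> \<open>The later of the two stages lies beyond the treatment of both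
      matrices.\<close>
    obtain \<gamma> where \<gamma>: "a = \<gamma> \<or> a \<in> underS le_real \<gamma>" "b = \<gamma> \<or> b \<in> underS le_real \<gamma>"
      using tot by metis
    have "zero P (pt False \<beta>) (pt False \<gamma>)" if "\<beta> \<noteq> \<gamma>" for \<beta>
      unfolding a by (rule key[OF _ \<gamma>(1) that]) (use P in \<open>simp add: zero_def a\<close>)
    moreover have "zero Q (pt False \<beta>) (pt False \<gamma>)" if "\<beta> \<noteq> \<gamma>" for \<beta>
      unfolding b by (rule key[OF _ \<gamma>(2) that]) (use Q in \<open>simp add: zero_def b\<close>)
    ultimately show "\<exists>\<gamma>. \<forall>\<beta>. \<beta> \<noteq> \<gamma> \<longrightarrow> (\<lambda>n. P (branch_node (pt False \<beta>) n) (branch_node (pt False \<gamma>) n)) \<longlonglongrightarrow> 0 \<and>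
        (\<lambda>n. Q (branch_node (pt False \<beta>) n) (branch_node (pt False \<gamma>) n)) \<longlonglongrightarrow> 0"
      unfolding zero_def by blast
  qed
  then show ?thesis by blast
qed

theorem mainTheorem2:
  shows "\<exists>(A :: nat op star_alg) (\<iota> :: nat op \<Rightarrow> nat op) (q :: nat op \<Rightarrow> real op).
    cstar_algebra A \<and>
    short_exact (compact_algebra :: nat op star_alg) A (compact_algebra :: real op star_alg) \<iota> q \<and>
    essential_ideal A (\<iota> ` carrier (compact_algebra :: nat op star_alg)) \<and>
    \<not> stable_algebra A"
proof -
  obtain node :: "bool \<Rightarrow> real \<Rightarrow> nat \<Rightarrow> nat" where "diagonal_branches node"
    using ex_diagonal_branches by blast
  then interpret diagonal_branches node .
  have "\<not> stable_algebra (op_algebra alg)"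
    using stable_imp_anticommuting no_anticommuting_centralizers by metis
  moreover have "essential_ideal (op_algebra alg) (id ` carrier (compact_algebra :: nat op star_alg))"
    using essential_alg by (simp add: op_algebra_def)
  ultimately show ?thesis
    using cstar_algebra_alg short_exact_alg by blast
qed

end
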